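(* Let $\mathbb{X}$ be a Banach space and let $A$ be the generator of a $\mathrm{C}_0$-semigroup $(T_A(t))_{t\ge 0}$ on $\mathbb{X}$ with $\|T_A(t)\|\le Me^{\omega_0 t}$ for all $t\ge 0$. Assume that the semigroup $(T_A(t))_{t\ge0}$ possesses an exponential dichotomy. Then there exists $\varepsilon>0$ (depending on $A$, $M$, $\omega_0$) such that the following holds. For each $t\in\mathbb{R}$ let $B(t)\colon D(B(t))=D(A)\to\mathbb{X}$ be a linear operator, and assume that for each compact interval $[a,b]\subset\mathbb{R}$: (i) the mapping $B(\cdot)\colon[a,b]\to\mathcal{GL}_A(\mathbb{X})$ is (well defined and) continuous with respect to $\|\cdot\|_A$; (ii) for every $\mu>\omega_0$ the mapping $t\mapsto B(t)R(\mu,A)$, $[a,b]\to\mathcal{L}(\mathbb{X})$, is continuously differentiable, and \[ \limsup_{\mu\to\infty}\ \sup_{t\in[a,b]}\left\|\frac{d}{dt}\big[B(t)R(\mu,A)\big]\right\|<\infty . \] Assume moreover that $B(\cdot)\colon\mathbb{R}\to\mathcal{GL}_A(\mathbb{X})$ is uniformly continuous and that \[ \omega_1:=\sup_{t\in\mathbb{R}}\|B(t)\|_A\le\varepsilon . \] Then the evolution family $(U(t,s))_{t\ge s}$ on the whole real line generated by the equation $u'(t)=(A+B(t))u(t)$ has an exponential dichotomy.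
   Context: $\mathcal{L}(\mathbb{X})$ is the space of bounded linear operators on $\mathbb{X}$ with the operator norm, and $R(\mu,A)=(\mu I-A)^{-1}$ for $\mu\in\rho(A)$. With $A$, $M$, $\omega_0$ fixed as in the claim, $\mathcal{GL}_A(\mathbb{X})$ denotes the normed space of all linear operators $C$ in $\mathbb{X}$ with $D(C)=D(A)$ and \[ \|C\|_A:=\frac1M\sup_{\mu>\omega_0}\|(\mu-\omega_0)CR(\mu,A)\|<\infty . \] Write $A(s):=A+B(s)$ (with domain $D(A)$). On a compact interval $[a,b]$, the equation $u'(t)=(A+B(t))u(t)$ is said to admit (generate) an evolution family $(U(t,s))_{a\le s\le t\le b}$ if this is a family of bounded linear operators on $\mathbb{X}$ such that: (1) for each fixed $x\in\mathbb{X}$ the map $(t,s)\mapsto U(t,s)x$ is continuous on $\{a\le s\le t\le b\}$; $U(t,t)=I$; $U(t,s)U(s,r)=U(t,r)$ for $a\le r\le s\le t\le b$; and there are constants $M',\omega'$ with $\|U(t,s)\|\le M'e^{\omega'(t-s)}$ for $a\le s\le t\le b$; (2) for each $x\in D(A)$, $U(t,s)x$ is differentiable with respect to $t\ge s$, and \[ \frac{\partial^+U(t,s)}{\partial t}x\Big|_{t=s}=A(s)x,\qquad \frac{\partial U(t,s)}{\partial s}x=-U(t,s)A(s)x \quad (a\le s\le t\le b), \] where derivatives at endpoints are one-sided and $\partial^+/\partial t$ is the right derivative. The evolution family on the whole real line generated by the equation is the family $(U(t,s))_{t\ge s}$, $t,s\in\mathbb{R}$, whose restriction to $a\le s\le t\le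 b$ is the evolution family admitted by the equation on $[a,b]$, for every compact $[a,b]\subset\mathbb{R}$. An evolution family $(U(t,s))_{t\ge s}$ on $\mathbb{R}$ has an exponential dichotomy if there exist bounded linear projections $P(t)\colon\mathbb{X}\to\mathbb{X}$, $t\in\mathbb{R}$, and constants $N,\alpha>0$ such that for all $t\ge s$: (1) $t\mapsto P(t)x$ is continuous for every $x\in\mathbb{X}$; (2) $P(t)U(t,s)=U(t,s)P(s)$; (3) $\|U(t,s)x\|\le Ne^{-\alpha(t-s)}\|x\|$ for $x\in\operatorname{Im}P(s)$; (4) $\|U(t,s)y\|\ge N^{-1}e^{\alpha(t-s)}\|y\|$ for $y\in\ker P(s)$; (5) $U(t,s)|_{\ker P(s)}$ is an isomorphism onto $\ker P(t)$. A $\mathrm{C}_0$-semigroup $(T_A(t))_{t\ge0}$ has an exponential dichotomy if the evolution family $(t,s)\mapsto T_A(t-s)$ does. *)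

theory Defs
  imports "HOL-Analysis.Analysis"
begin

text \<open>
  An unbounded operator is given by its domain \<open>D\<close> and a function of type \<open>'a \<Rightarrow> 'a\<close> whose
  values outside \<open>D\<close> are irrelevant. An operator \<open>C\<close> with the same domain as \<open>A\<close> is a function
  \<open>C\<close> together with the same set \<open>D\<close>.
\<close>

definition linear_operator :: "'a::real_normed_vector set \<Rightarrow> ('a \<Rightarrow> 'a) \<Rightarrow> bool" where
  "linear_operator D C \<longleftrightarrow> subspace D \<and>
     (\<forall>x\<in>D. \<forall>y\<in>D. C (x + y) = C x + C y) \<and> (\<forall>c. \<forall>x\<in>D. C (c *\<^sub>R x) = c *\<^sub>R C x)"

text \<open>Semigroups are indexed by \<open>real\<close>; only the values at nonnegative times matter.\<close>

definition C0_semigroup :: "(real \<Rightarrow> 'a::real_normed_vector \<Rightarrow>\<^sub>L 'a) \<Rightarrow> bool" where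
  "C0_semigroup T \<longleftrightarrow> T 0 = id_blinfun \<and>
     (\<forall>s\<ge>0. \<forall>t\<ge>0. T (t + s) = T t o\<^sub>L T s) \<and>
     (\<forall>x. continuous_on {0..} (\<lambda>t. T t x))"

definition semigroup_generator ::
    "(real \<Rightarrow> 'a::real_normed_vector \<Rightarrow>\<^sub>L 'a) \<Rightarrow> 'a set \<Rightarrow> ('a \<Rightarrow> 'a) \<Rightarrow> bool" where
  "semigroup_generator T D A \<longleftrightarrow>
     D = {x. \<exists>y. ((\<lambda>h. (1 / h) *\<^sub>R (T h x - x)) \<longlongrightarrow> y) (at_right 0)} \<and>
     (\<forall>x\<in>D. ((\<lambda>h. (1 / h) *\<^sub>R (T h x - x)) \<longlongrightarrow> A x) (at_right 0))"

text \<open>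
  \<open>resolvent D A \<mu>\<close> is meaningful for \<open>\<mu>\<close> in the resolvent set of \<open>A\<close>. If \<open>A\<close> generates a
  C0-semigroup with growth bound \<open>M * exp (\<omega>\<^sub>0 * t)\<close>, this set contains every \<open>\<mu> > \<omega>\<^sub>0\<close>.
\<close>

definition resolvent :: "'a::real_normed_vector set \<Rightarrow> ('a \<Rightarrow> 'a) \<Rightarrow> real \<Rightarrow> 'a \<Rightarrow> 'a" where
  "resolvent D A \<mu> = inv_into D (\<lambda>x. \<mu> *\<^sub>R x - A x)"

text \<open>
  The operator \<open>C R(\<mu>, A)\<close> as an element of the space of bounded linear operators; it is
  meaningful only if \<open>C R(\<mu>, A)\<close> is bounded, which \<open>GL_space\<close> below requires.
\<close>

definition comp_resolvent ::
    "'a::real_normed_vector set \<Rightarrow> ('a \<Rightarrow> 'a) \<Rightarrow> ('a \<Rightarrow> 'a) \<Rightarrow> real \<Rightarrow> 'a \<Rightarrow>\<^sub>L 'a" where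
  "comp_resolvent D A C \<mu> = Blinfun (\<lambda>x. C (resolvent D A \<mu> x))"

definition GL_space :: "'a::real_normed_vector set \<Rightarrow> ('a \<Rightarrow> 'a) \<Rightarrow> real \<Rightarrow> ('a \<Rightarrow> 'a) set" where
  "GL_space D A \<omega>\<^sub>0 = {C. linear_operator D C \<and>
     (\<forall>\<mu>>\<omega>\<^sub>0. bounded_linear (\<lambda>x. C (resolvent D A \<mu> x))) \<and>
     bdd_above ((\<lambda>\<mu>. norm ((\<mu> - \<omega>\<^sub>0) *\<^sub>R comp_resolvent D A C \<mu>)) ` {\<omega>\<^sub>0<..})}"

definition GL_norm ::
    "'a::real_normed_vector set \<Rightarrow> ('a \<Rightarrow> 'a) \<Rightarrow> real \<Rightarrow> real \<Rightarrow> ('a \<Rightarrow> 'a) \<Rightarrow> real" where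
  "GL_norm D A M \<omega>\<^sub>0 C =
     (1 / M) * (SUP \<mu>\<in>{\<omega>\<^sub>0<..}. norm ((\<mu> - \<omega>\<^sub>0) *\<^sub>R comp_resolvent D A C \<mu>))"

definition GL_continuous_on :: "'a::real_normed_vector set \<Rightarrow> ('a \<Rightarrow> 'a) \<Rightarrow> real \<Rightarrow> real \<Rightarrow>
    real set \<Rightarrow> (real \<Rightarrow> 'a \<Rightarrow> 'a) \<Rightarrow> bool" where
  "GL_continuous_on D A M \<omega>\<^sub>0 S B \<longleftrightarrow> (\<forall>t\<in>S. B t \<in> GL_space D A \<omega>\<^sub>0) \<and>
     (\<forall>t\<in>S. \<forall>e>0. \<exists>d>0. \<forall>s\<in>S. \<bar>s - t\<bar> < d \<longrightarrow>
        GL_norm D A M \<omega>\<^sub>0 (\<lambda>x. B s x - B t x) < e)"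

definition GL_uniformly_continuous_on :: "'a::real_normed_vector set \<Rightarrow> ('a \<Rightarrow> 'a) \<Rightarrow> real \<Rightarrow> real \<Rightarrow>
    real set \<Rightarrow> (real \<Rightarrow> 'a \<Rightarrow> 'a) \<Rightarrow> bool" where
  "GL_uniformly_continuous_on D A M \<omega>\<^sub>0 S B \<longleftrightarrow> (\<forall>t\<in>S. B t \<in> GL_space D A \<omega>\<^sub>0) \<and>
     (\<forall>e>0. \<exists>d>0. \<forall>t\<in>S. \<forall>s\<in>S. \<bar>s - t\<bar> < d \<longrightarrow>
        GL_norm D A M \<omega>\<^sub>0 (\<lambda>x. B s x - B t x) < e)"

text \<open>One-sided derivatives at the endpoints; only used for \<open>a < b\<close>.\<close>

definition continuously_differentiable_on_interval ::
    "real \<Rightarrow> real \<Rightarrow> (real \<Rightarrow> 'b::real_normed_vector) \<Rightarrow> bool" where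
  "continuously_differentiable_on_interval a b f \<longleftrightarrow>
     (\<exists>f'. (\<forall>t\<in>{a..b}. (f has_vector_derivative f' t) (at t within {a..b})) \<and>
           continuous_on {a..b} f')"

text \<open>
  \<open>evolution_family_on D F a b U\<close>: the equation \<open>u'(t) = F t u(t)\<close>, where every \<open>F t\<close> has domain \<open>D\<close>,
  admits the evolution family \<open>U\<close> on \<open>[a, b]\<close>; \<open>U t s\<close> is \<open>U(t, s)\<close>, and only its values
  for \<open>s \<le> t\<close> matter. Restricting the neighbourhoods to \<open>{s..b}\<close> and \<open>{a..t}\<close>
  makes the derivatives one-sided at the endpoints (and right-sided at \<open>t = s\<close> in the
  first variable); a degenerate interval imposes no condition.
\<close>

definition evolution_family_on :: "'a::real_normed_vector set \<Rightarrow> (real \<Rightarrow> 'a \<Rightarrow> 'a) \<Rightarrow>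
    real \<Rightarrow> real \<Rightarrow> (real \<Rightarrow> real \<Rightarrow> 'a \<Rightarrow>\<^sub>L 'a) \<Rightarrow> bool" where
  "evolution_family_on D F a b U \<longleftrightarrow>
     (\<forall>x. continuous_on {(t, s). a \<le> s \<and> s \<le> t \<and> t \<le> b} (\<lambda>(t, s). U t s x)) \<and>
     (\<forall>t. a \<le> t \<and> t \<le> b \<longrightarrow> U t t = id_blinfun) \<and>
     (\<forall>r s t. a \<le> r \<and> r \<le> s \<and> s \<le> t \<and> t \<le> b \<longrightarrow> U t s o\<^sub>L U s r = U t r) \<and>
     (\<exists>M' \<omega>'. \<forall>s t. a \<le> s \<and> s \<le> t \<and> t \<le> b \<longrightarrow> norm (U t s) \<le> M' * exp (\<omega>' * (t - s))) \<and>
     (\<forall>x\<in>D. \<forall>s\<in>{a..b}.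
        (\<lambda>t. U t s x) differentiable_on {s..b} \<and>
        ((\<lambda>t. U t s x) has_vector_derivative F s x) (at s within {s..b})) \<and>
     (\<forall>x\<in>D. \<forall>s t. a \<le> s \<and> s \<le> t \<and> t \<le> b \<longrightarrow>
        ((\<lambda>r. U t r x) has_vector_derivative - (U t s (F s x))) (at s within {a..t}))"

definition generates_evolution_family :: "'a::real_normed_vector set \<Rightarrow> (real \<Rightarrow> 'a \<Rightarrow> 'a) \<Rightarrow>
    (real \<Rightarrow> real \<Rightarrow> 'a \<Rightarrow>\<^sub>L 'a) \<Rightarrow> bool" where
  "generates_evolution_family D F U \<longleftrightarrow> (\<forall>a b. a < b \<longrightarrow> evolution_family_on D F a b U)"

definition exponential_dichotomy :: "(real \<Rightarrow> real \<Rightarrow> 'a::real_normed_vector \<Rightarrow>\<^sub>L 'a) \<Rightarrow> bool" where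
  "exponential_dichotomy U \<longleftrightarrow>
     (\<exists>(P :: real \<Rightarrow> 'a \<Rightarrow>\<^sub>L 'a) N \<alpha>. N > 0 \<and> \<alpha> > 0 \<and>
        (\<forall>t. P t o\<^sub>L P t = P t) \<and>
        (\<forall>x. continuous_on UNIV (\<lambda>t. P t x)) \<and>
        (\<forall>s t. s \<le> t \<longrightarrow>
           P t o\<^sub>L U t s = U t s o\<^sub>L P s \<and>
           (\<forall>x \<in> range (P s). norm (U t s x) \<le> N * exp (- \<alpha> * (t - s)) * norm x) \<and>
           (\<forall>y \<in> {y. P s y = 0}. norm (U t s y) \<ge> (1 / N) * exp (\<alpha> * (t - s)) * norm y) \<and>
           bij_betw (U t s) {y. P s y = 0} {y. P t y = 0} \<and>
           continuous_on {y. P t y = 0} (inv_into {y. P s y = 0} (U t s))))"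

end

theory Submission
  imports Defs
begin

text \<open>
  If \<open>x\<close> is in \<open>D(A)\<close>, then \<open>C x = C R(\<mu>, A) (\<mu> x - A x)\<close>, and \<open>\<mu> \<rightarrow> \<infinity>\<close> gives
  \<open>norm (C x) \<le> M * norm x\<close> times the norm of \<open>C\<close> in \<open>GL\<^sub>A(X)\<close>. So every \<open>B(t)\<close> extends to a
  bounded operator on \<open>X\<close>, of norm at most \<open>M \<epsilon>\<close>, and the evolution family consists of the mild
  solutions of a bounded perturbation. It is uniformly close to \<open>T(t - s)\<close> on time steps of a
  fixed length \<open>h\<close>.

  Take \<open>h\<close> so large that \<open>T(h)\<close> on the stable and its inverse on the unstable subspace have
  norm at most \<open>1 / 16\<close>. On each lattice \<open>s + h \<int>\<close> the perturbed equation with an impulse at \<open>s\<close> is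
  then the fixed point equation of a contraction in a space of exponentially decaying sequences.
  Its solutions form the Green function \<open>G(t, s)\<close>, the projections are \<open>G(s, s)\<close>, and all algebraic
  properties of the dichotomy follow from the uniqueness of bounded solutions with a
  prescribed jump.
\<close>

text \<open>The conditions that cost most are the derivatives. Mild solutions give a propagator and,
  by a difference quotient, the derivative in \<open>s\<close>; differentiability in
  \<open>t\<close> for \<open>x\<close> in \<open>D\<close> rests on orbits staying in
  \<open>D\<close>, which a perturbation that is merely strongly continuous does not ensure. This is
  where the derivative of \<open>comp_resolvent\<close> at
  \<open>\<mu> = \<omega>\<^sub>0 + 1\<close> enters. The resulting classical solutions serve twice:
  they give the forward derivative of \<open>U\<close>, and they force every other evolution family
  to agree with \<open>U\<close> on the dense set \<open>D\<close>.

  The order of choices matters. The step \<open>h\<close> and the tolerance \<open>\<eta>\<close>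
  depend only on the dichotomy and growth of \<open>T\<close>. Then \<epsilon> is made small for two
  purposes: the exponent \<open>\<omega>\<^sub>0 + 1\<close> must serve every admissible
  \<open>B\<close>, and the deviation of \<open>U\<close> from \<open>T\<close> after time
  \<open>h\<close> must not exceed \<open>\<eta>\<close>. A bound on the projections that is uniform
  in time is not part of the definition of a dichotomy; it is derived beforehand from growth and
  expansion.\<close>

subsection \<open>A weighted contraction principle and discrete dichotomies\<close>

text \<open>Picard iteration from zero in the norm sup |z| / \<open>\<rho>\<close>. Pointwise
  estimates let one lemma serve sequences on \<open>int\<close>, where continuity is automatic and
  the weight decays, and functions on the plane, where the weight is exponential in time. The factor
  2 in the bound is 1 / (1 - 1 / 2).\<close>

lemma weighted_banach_fix:
  fixes \<Phi> :: "('b::topological_space \<Rightarrow> 'a::banach) \<Rightarrow> 'b \<Rightarrow> 'a" and \<rho> :: "'b \<Rightarrow> real"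
  assumes \<rho>: "continuous_on UNIV \<rho>" "\<And>x. \<rho> x > 0"
    and cont: "\<And>z. continuous_on UNIV z \<Longrightarrow> continuous_on UNIV (\<Phi> z)"
    and zero: "\<And>x. norm (\<Phi> (\<lambda>_. 0) x) \<le> C * \<rho> x"
    and contr: "\<And>z z' c x. continuous_on UNIV z \<Longrightarrow> continuous_on UNIV z' \<Longrightarrow>
      (\<And>y. norm (z y - z' y) \<le> c * \<rho> y) \<Longrightarrow> norm (\<Phi> z x - \<Phi> z' x) \<le> c / 2 * \<rho> x"
  obtains z where "continuous_on UNIV z" "\<Phi> z = z" "\<And>x. norm (z x) \<le> 2 * C * \<rho> x"
proof -
  define zs where "zs k = (\<Phi> ^^ k) (\<lambda>_. 0)" for k
  have zs0: "zs 0 = (\<lambda>_. 0)" and zsS: "zs (Suc k) = \<Phi> (zs k)" for k by (auto simp: zs_def)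
  have czs: "continuous_on UNIV (zs k)" for k by (induction k) (auto simp: zs0 zsS cont)
  have step: "norm (zs (Suc k) x - zs k x) \<le> C / 2 ^ k * \<rho> x" for k x
  proof (induction k arbitrary: x)
    case 0
    then show ?case using zero by (simp add: zs0 zsS)
  next
    case (Suc k)
    have "norm (\<Phi> (zs (Suc k)) x - \<Phi> (zs k) x) \<le> C / 2 ^ k / 2 * \<rho> x"
      by (rule contr[OF czs czs Suc])
    then show ?case by (simp add: zsS[of "Suc k"] zsS[of k] field_simps)
  qed
  have C: "0 \<le> C"
    using order_trans[OF norm_ge_zero zero[of undefined]] \<rho>(2)[of undefined]
    by (simp add: zero_le_mult_iff)
  \<comment> \<open>The closed form of the geometric sum of the increments C / 2 ^ j for k \<le> j <
    k + m.\<close>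
  have tele: "norm (zs (k + m) x - zs k x) \<le> (2 * C / 2 ^ k - 2 * C / 2 ^ (k + m)) * \<rho> x" for k m x
  proof (induction m)
    case (Suc m)
    have "norm (zs (k + Suc m) x - zs k x) \<le> norm (zs (Suc (k + m)) x - zs (k + m) x) + norm (zs (k + m) x - zs k x)"
      using norm_triangle_ineq[of "zs (Suc (k + m)) x - zs (k + m) x" "zs (k + m) x - zs k x"] by simp
    also have "\<dots> \<le> C / 2 ^ (k + m) * \<rho> x + (2 * C / 2 ^ k - 2 * C / 2 ^ (k + m)) * \<rho> x"
      by (intro add_mono step Suc)
    also have "\<dots> = (2 * C / 2 ^ k - 2 * C / 2 ^ (k + Suc m)) * \<rho> x" by (simp add: field_simps)
    finally show ?case .
  qed simp
  have tail: "norm (zs m x - zs k x) \<le> 2 * C / 2 ^ k * \<rho> x" if "k \<le> m" for k m x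
  proof -
    have "norm (zs m x - zs k x) \<le> (2 * C / 2 ^ k - 2 * C / 2 ^ m) * \<rho> x"
      using tele[of k "m - k" x] that by simp
    also have "\<dots> \<le> 2 * C / 2 ^ k * \<rho> x" using C \<rho>(2)[of x] by (intro mult_right_mono) auto
    finally show ?thesis .
  qed
  have null: "(\<lambda>k. 2 * C / 2 ^ k * r) \<longlonglongrightarrow> 0" for r :: real
  proof -
    have "(\<lambda>k. (2 * C * r) * (1 / 2) ^ k) \<longlonglongrightarrow> (2 * C * r) * 0"
      by (intro tendsto_mult_left LIMSEQ_power_zero) simp
    then show ?thesis by (simp add: power_one_over field_simps)
  qed
  have "Cauchy (\<lambda>k. zs k x)" for x
  proof (rule CauchyI)
    fix e :: real assume "e > 0"
    then have "e / 2 > 0" by simp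
    from order_tendstoD(2)[OF null this]
    obtain K where K: "\<And>k. k \<ge> K \<Longrightarrow> 2 * C / 2 ^ k * \<rho> x < e / 2"
      by (auto simp: eventually_sequentially)
    have "norm (zs m x - zs n x) < e" if "m \<ge> K" "n \<ge> K" for m n
      using tail[OF that(1), of x] tail[OF that(2), of x] K[of K]
        norm_triangle_ineq4[of "zs m x - zs K x" "zs n x - zs K x"] by simp
    then show "\<exists>M. \<forall>m\<ge>M. \<forall>n\<ge>M. norm (zs m x - zs n x) < e" by blast
  qed
  then have lim: "(\<lambda>k. zs k x) \<longlonglongrightarrow> lim (\<lambda>k. zs k x)" for x
    by (simp add: Cauchy_convergent_iff convergent_LIMSEQ_iff)
  define z where "z x = lim (\<lambda>k. zs k x)" for x
  have lim: "(\<lambda>k. zs k x) \<longlonglongrightarrow> z x" for x using lim by (simp add: z_def)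
  have zk: "norm (z x - zs k x) \<le> 2 * C / 2 ^ k * \<rho> x" for k x
  proof (rule Lim_norm_ubound[OF _ tendsto_diff[OF lim tendsto_const]])
    show "\<forall>\<^sub>F m in sequentially. norm (zs m x - zs k x) \<le> 2 * C / 2 ^ k * \<rho> x"
      using tail by (auto simp: eventually_sequentially)
  qed simp
  \<comment> \<open>Without division by \<open>\<rho>\<close> the convergence need not be uniform,
    since the weight may be unbounded; continuity of the quotient is then carried back to
    \<open>z\<close>.\<close>
  have "uniform_limit UNIV (\<lambda>k x. (1 / \<rho> x) *\<^sub>R zs k x) (\<lambda>x. (1 / \<rho> x) *\<^sub>R z x) sequentially"
  proof (rule uniform_limitI)
    fix e :: real assume "e > 0"
    from order_tendstoD(2)[OF null[of 1] this]
    show "\<forall>\<^sub>F k in sequentially. \<forall>x\<in>UNIV. dist ((1 / \<rho> x) *\<^sub>R zs k x) ((1 / \<rho> x) *\<^sub>R z x) < e"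
    proof eventually_elim
      case (elim k)
      have "dist ((1 / \<rho> x) *\<^sub>R zs k x) ((1 / \<rho> x) *\<^sub>R z x) = norm (z x - zs k x) / \<rho> x" for x
        using \<rho>(2)[of x] by (simp add: dist_norm norm_minus_commute divide_inverse_commute
            flip: scaleR_diff_right)
      also have "norm (z x - zs k x) / \<rho> x \<le> 2 * C / 2 ^ k" for x
        using zk[of x k] \<rho>(2)[of x] by (simp add: field_simps)
      finally show ?case using elim by (auto intro: le_less_trans)
    qed
  qed
  then have "continuous_on UNIV (\<lambda>x. (1 / \<rho> x) *\<^sub>R z x)"
    using \<rho>(2) by (intro uniform_limit_theorem[where F = sequentially]) (auto intro!: always_eventually
        continuous_intros \<rho>(1) czs simp: less_imp_neq[symmetric])
  from continuous_on_scaleR[OF \<rho>(1) this]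
  have "continuous_on UNIV (\<lambda>x. \<rho> x *\<^sub>R ((1 / \<rho> x) *\<^sub>R z x))" .
  moreover have "\<rho> x *\<^sub>R ((1 / \<rho> x) *\<^sub>R z x) = z x" for x using \<rho>(2)[of x] by simp
  ultimately have cz: "continuous_on UNIV z" by simp
  have "\<Phi> z x = z x" for x
  proof (rule LIMSEQ_unique)
    show "(\<lambda>k. zs (Suc k) x) \<longlonglongrightarrow> z x" by (rule LIMSEQ_Suc[OF lim])
    have "(\<lambda>k. zs (Suc k) x - \<Phi> z x) \<longlonglongrightarrow> 0"
    proof (rule Lim_null_comparison[OF always_eventually null])
      show "\<forall>k. norm (zs (Suc k) x - \<Phi> z x) \<le> 2 * C / 2 ^ k * (\<rho> x / 2)"
      proof
        fix k
        have "norm (\<Phi> z x - \<Phi> (zs k) x) \<le> (2 * C / 2 ^ k) / 2 * \<rho> x" by (rule contr[OF cz czs zk])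
        then show "norm (zs (Suc k) x - \<Phi> z x) \<le> 2 * C / 2 ^ k * (\<rho> x / 2)"
          by (simp add: zsS norm_minus_commute)
      qed
    qed
    then show "(\<lambda>k. zs (Suc k) x) \<longlonglongrightarrow> \<Phi> z x" by (rule LIM_zero_cancel)
  qed
  then have "\<Phi> z = z" by (simp add: fun_eq_iff)
  moreover have "norm (z x) \<le> 2 * C * \<rho> x" for x using zk[of x 0] by (simp add: zs0)
  ultimately show ?thesis using cz that by blast
qed

text \<open>\<open>L n\<close> is the unperturbed step and \<open>E n\<close> its perturbation;
  \<open>S n\<close> takes the unstable component at n + 1 and inverts \<open>L n\<close> between
  the kernels of \<open>P n\<close> and \<open>P (n + 1)\<close>. The product
  \<open>p * \<eta>\<close> bounds \<open>P\<close> after \<open>E\<close>, while behind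
  \<open>S\<close>, which already gains 1 / 16, the crude bound 1 on \<open>E\<close>
  suffices.\<close>

locale discrete_dichotomy =
  fixes L E P S :: "int \<Rightarrow> 'a::banach \<Rightarrow>\<^sub>L 'a" and p \<eta> :: real
  assumes PP: "P n (P n x) = P n x"
    and LP: "P (n + 1) (L n x) = L n (P n x)"
    and SL: "S n (L n x) = x - P n x"
    and LS: "L n (S n x) = x - P (n + 1) x"
    and PS: "P n (S n x) = 0"
    and norm_P: "norm (P n) \<le> p"
    and norm_LP: "norm (L n (P n x)) \<le> norm x / 16"
    and norm_S: "norm (S n x) \<le> norm x / 16"
    and norm_E: "norm (E n) \<le> \<eta>"
    and \<eta>: "p * \<eta> \<le> 1 / 16" "\<eta> \<le> 1"
begin

text \<open>Fixed points of \<open>step f\<close> solve \<open>z (n + 1) = (L n + E n) (z n) + f (n + 1)\<close>: the stable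
  component is propagated forwards by \<open>L\<close>, the unstable one backwards by \<open>S\<close>.\<close>

definition step :: "(int \<Rightarrow> 'a) \<Rightarrow> (int \<Rightarrow> 'a) \<Rightarrow> int \<Rightarrow> 'a" where
  "step f z n = L (n - 1) (P (n - 1) (z (n - 1))) + P n (E (n - 1) (z (n - 1)) + f n)
     + S n (z (n + 1) - E n (z n) - f (n + 1))"

text \<open>Forwards, \<open>P n\<close> of one recurrence and \<open>S n\<close> of the next give
  the two components of \<open>z n\<close>. Conversely \<open>P n\<close> annihilates the
  \<open>S\<close> term, so a fixed point is its stable part plus that term, and applying
  \<open>L n\<close> undoes \<open>S n\<close>.\<close>

lemma recurrence_iff_step:
  "(\<forall>n. z (n + 1) = L n (z n) + E n (z n) + f (n + 1)) \<longleftrightarrow> step f z = z"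
proof
  assume rec: "\<forall>n. z (n + 1) = L n (z n) + E n (z n) + f (n + 1)"
  show "step f z = z"
  proof
    fix n
    have z: "z n = L (n - 1) (z (n - 1)) + E (n - 1) (z (n - 1)) + f n"
      using rec[rule_format, of "n - 1"] by simp
    have 1: "L (n - 1) (P (n - 1) (z (n - 1))) + P n (E (n - 1) (z (n - 1)) + f n) = P n (z n)"
      using LP[of "n - 1" "z (n - 1)"] by (simp add: z blinfun.add_right)
    have 2: "z (n + 1) - E n (z n) - f (n + 1) = L n (z n)"
      using rec[rule_format, of n] by simp
    show "step f z n = z n" unfolding step_def 1 2 SL by simp
  qed
next
  assume fp: "step f z = z"
  show "\<forall>n. z (n + 1) = L n (z n) + E n (z n) + f (n + 1)"
  proof
    fix n
    have Pz: "P n (z n) = L (n - 1) (P (n - 1) (z (n - 1))) + P n (E (n - 1) (z (n - 1)) + f n)" for n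
    proof -
      have "P n (z n) = P n (step f z n)" by (simp add: fp)
      also have "\<dots> = L (n - 1) (P (n - 1) (z (n - 1))) + P n (E (n - 1) (z (n - 1)) + f n)"
        using LP[of "n - 1" "P (n - 1) (z (n - 1))"]
        by (simp add: step_def blinfun.add_right PP PS)
      finally show ?thesis .
    qed
    let ?w = "z (n + 1) - E n (z n) - f (n + 1)"
    have "z n = step f z n" by (simp add: fp)
    then have "z n = P n (z n) + S n ?w" by (simp add: step_def Pz[of n])
    then have "L n (z n) = L n (P n (z n)) + L n (S n ?w)"
      by (metis blinfun.add_right)
    also have "\<dots> = L n (P n (z n)) + (?w - P (n + 1) ?w)" by (simp only: LS)
    \<comment> \<open>At n + 1 the formula for the stable component reads
      \<open>P (n + 1) ?w = L n (P n (z n))\<close>, so these two terms cancel.\<close>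
    also have "\<dots> = ?w"
      using Pz[of "n + 1"] by (simp add: blinfun.add_right blinfun.diff_right)
    finally show "z (n + 1) = L n (z n) + E n (z n) + f (n + 1)" by simp
  qed
qed

lemma step_diff: "step f z n - step f z' n = step (\<lambda>_. 0) (\<lambda>n. z n - z' n) n"
  by (simp add: step_def blinfun.add_right blinfun.diff_right algebra_simps)

text \<open>The shape of the bound explains the constant 16: if all norms are at most s it gives 4 s
  / 16, and for a weight that changes by a factor 2 between neighbours it gives 7 / 16, both below 1
  / 2.\<close>

lemma norm_step0:
  "norm (step (\<lambda>_. 0) z n) \<le> (2 * norm (z (n - 1)) + norm (z (n + 1)) + norm (z n)) / 16"
proof -
  have p: "0 \<le> p" using norm_P[of 0] norm_ge_zero order_trans by blast
  have 1: "norm (P n (E (n - 1) (z (n - 1)))) \<le> norm (z (n - 1)) / 16"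
  proof -
    have "norm (P n (E (n - 1) (z (n - 1)))) \<le> norm (P n) * norm (E (n - 1) (z (n - 1)))"
      by (rule norm_blinfun)
    also have "\<dots> \<le> p * (\<eta> * norm (z (n - 1)))"
      by (intro mult_mono norm_P order_trans[OF norm_blinfun] mult_right_mono norm_E) (auto simp: p)
    also have "\<dots> \<le> norm (z (n - 1)) / 16"
      using mult_right_mono[OF \<eta>(1), of "norm (z (n - 1))"] by (simp add: mult.assoc)
    finally show ?thesis .
  qed
  have "norm (E n (z n)) \<le> 1 * norm (z n)"
    using norm_E[of n] \<eta>(2) by (intro order_trans[OF norm_blinfun] mult_right_mono) auto
  then have 2: "norm (S n (z (n + 1) - E n (z n))) \<le> (norm (z (n + 1)) + norm (z n)) / 16"
    using norm_S[of n "z (n + 1) - E n (z n)"] norm_triangle_ineq4[of "z (n + 1)" "E n (z n)"] by simp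
  have "norm (step (\<lambda>_. 0) z n) \<le> norm (L (n - 1) (P (n - 1) (z (n - 1))))
      + norm (P n (E (n - 1) (z (n - 1)))) + norm (S n (z (n + 1) - E n (z n)))"
    unfolding step_def by (intro order_trans[OF norm_triangle_ineq] add_mono) auto
  then show ?thesis using 1 2 norm_LP[of "n - 1" "z (n - 1)"] by simp
qed

text \<open>A homogeneous solution is a fixed point of \<open>step (\<lambda>_. 0)\<close>, so the
  supremum s of its norms satisfies s \<le> s / 2.\<close>

lemma bounded_solution_zero:
  assumes rec: "\<And>n. z (n + 1) = L n (z n) + E n (z n)" and b: "\<And>n. norm (z n) \<le> c"
  shows "z n = 0"
proof -
  have fp: "step (\<lambda>_. 0) z = z" using rec by (subst recurrence_iff_step[symmetric]) simp
  have bdd: "bdd_above (range (\<lambda>n. norm (z n)))" using b by (auto intro!: bdd_aboveI)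
  define s where "s = (SUP n. norm (z n))"
  have s: "norm (z n) \<le> s" for n unfolding s_def by (rule cSUP_upper[OF _ bdd]) simp
  have "norm (z n) \<le> s / 2" for n
    using norm_step0[of z n] s[of "n - 1"] s[of "n + 1"] s[of n]
      order_trans[OF norm_ge_zero s[of n]] by (simp add: fp)
  then have "s \<le> s / 2" unfolding s_def by (intro cSUP_least) auto
  then have "s \<le> 0" by simp
  from order_trans[OF s this] show ?thesis by simp
qed

text \<open>An impulse at n = 0 excites the zero sequence only at n = 0, by
  \<open>P 0 \<xi>\<close>, and at n = -1, by \<open>- S (-1) \<xi>\<close>. The weight (1 / 2) ^
  |n| is compatible with \<open>step\<close>, which looks one place to either side.\<close>

lemma decaying_green_solution:
  obtains z where
    "\<And>n. z (n + 1) = L n (z n) + E n (z n) + (if n + 1 = 0 then \<xi> else 0)"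
    "\<And>n. norm (z n) \<le> 2 * (p + 1) * norm \<xi> * (1 / 2) ^ nat \<bar>n\<bar>"
proof -
  define f where "f n = (if n = 0 then \<xi> else 0)" for n :: int
  define \<rho> :: "int \<Rightarrow> real" where "\<rho> n = (1 / 2) ^ nat \<bar>n\<bar>" for n
  have \<rho>_pos: "\<rho> n > 0" for n by (simp add: \<rho>_def)
  have \<rho>1: "\<rho> m \<le> 2 * \<rho> n" if "\<bar>n\<bar> \<le> \<bar>m\<bar> + 1" for m n
  proof -
    have "\<rho> n \<ge> (1 / 2) ^ (Suc (nat \<bar>m\<bar>))"
      unfolding \<rho>_def using that by (intro power_decreasing) auto
    then show ?thesis by (simp add: \<rho>_def)
  qed
  have p: "0 \<le> p" using norm_P[of 0] norm_ge_zero order_trans by blast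
  obtain z where z: "step f z = z" "\<And>x. norm (z x) \<le> 2 * ((p + 1) * norm \<xi>) * \<rho> x"
  proof (rule weighted_banach_fix[where \<Phi> = "step f" and \<rho> = \<rho> and C = "(p + 1) * norm \<xi>"])
    fix n
    show "norm (step f (\<lambda>_. 0) n) \<le> (p + 1) * norm \<xi> * \<rho> n"
    proof -
      have a: "norm (P 0 \<xi>) \<le> p * norm \<xi>"
        by (intro order_trans[OF norm_blinfun] mult_right_mono norm_P) auto
      consider "n = 0" | "n = -1" | "n \<noteq> 0" "n + 1 \<noteq> 0" by linarith
      then show ?thesis
      proof cases
        case 1
        then show ?thesis using a by (simp add: step_def f_def \<rho>_def algebra_simps add_increasing)
      next
        case 2
        have "norm (S (-1) \<xi>) \<le> norm \<xi> / 2" using norm_S[of "-1" \<xi>] norm_ge_zero[of \<xi>] by linarith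
        also have "\<dots> \<le> (p + 1) * norm \<xi> / 2" using p by (simp add: algebra_simps)
        finally show ?thesis using 2
          by (simp add: step_def f_def \<rho>_def blinfun.minus_right)
      next
        case 3
        then show ?thesis using p \<rho>_pos[of n] by (simp add: step_def f_def)
      qed
    qed
  next
    fix z z' :: "int \<Rightarrow> 'a" and c n
    assume d: "\<And>y. norm (z y - z' y) \<le> c * \<rho> y"
    have c: "c \<ge> 0" using order_trans[OF norm_ge_zero d[of 0]] by (simp add: \<rho>_def)
    have "norm (step f z n - step f z' n) \<le> (2 * (c * (2 * \<rho> n)) + c * (2 * \<rho> n) + c * \<rho> n) / 16"
      unfolding step_diff
      by (intro order_trans[OF norm_step0] divide_right_mono add_mono mult_left_mono
          order_trans[OF d] \<rho>1 c) auto
    also have "\<dots> \<le> c / 2 * \<rho> n" using c \<rho>_pos[of n] by simp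
    finally show "norm (step f z n - step f z' n) \<le> c / 2 * \<rho> n" .
  qed (use \<rho>_pos in auto)
  show ?thesis
  proof
    show "z (n + 1) = L n (z n) + E n (z n) + (if n + 1 = 0 then \<xi> else 0)" for n
      using z(1)[folded recurrence_iff_step] by (simp add: f_def)
    show "norm (z n) \<le> 2 * (p + 1) * norm \<xi> * (1 / 2) ^ nat \<bar>n\<bar>" for n
      using z(2)[of n] by (simp add: \<rho>_def algebra_simps)
  qed
qed

end

subsection \<open>Green functions on the line\<close>

definition propagator :: "(real \<Rightarrow> real \<Rightarrow> 'a::real_normed_vector \<Rightarrow>\<^sub>L 'a) \<Rightarrow> bool" where
  "propagator U \<longleftrightarrow> (\<forall>t. U t t = id_blinfun) \<and>
     (\<forall>r s t. r \<le> s \<and> s \<le> t \<longrightarrow> U t s o\<^sub>L U s r = U t r) \<and>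
     (\<forall>x. continuous_on {(t, s). s \<le> t} (\<lambda>(t, s). U t s x))"

lemma propagator_id: "propagator U \<Longrightarrow> U t t x = x"
  by (simp add: propagator_def)

lemma propagator_comp:
  assumes "propagator U" "r \<le> s" "s \<le> t"
  shows "U t s (U s r x) = U t r x"
proof -
  have "U t s o\<^sub>L U s r = U t r" using assms by (auto simp: propagator_def)
  then show ?thesis by (metis blinfun_apply_blinfun_compose)
qed

lemma propagator_continuous_fst:
  assumes "propagator U"
  shows "continuous_on {s..} (\<lambda>t. U t s x)"
proof -
  have "continuous_on {s..} ((\<lambda>(t, s). U t s x) \<circ> (\<lambda>t. (t, s)))"
    using assms by (intro continuous_on_compose continuous_intros)
      (auto simp: propagator_def intro: continuous_on_subset)
  then show ?thesis by (simp add: o_def)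
qed

lemma propagator_continuous_snd:
  assumes "propagator U"
  shows "continuous_on {..t} (\<lambda>s. U t s x)"
proof -
  have "continuous_on {..t} ((\<lambda>(t, s). U t s x) \<circ> (\<lambda>s. (t, s)))"
    using assms by (intro continuous_on_compose continuous_intros)
      (auto simp: propagator_def intro: continuous_on_subset)
  then show ?thesis by (simp add: o_def)
qed

text \<open>The discrete data are given at every real s with common constants, so that a lattice can
  be anchored at any time. \<open>L s\<close> stands for the unperturbed evolution from s to s + h,
  and \<open>K\<close> controls \<open>U\<close> inside one cell.\<close>

locale lattice_dichotomy =
  fixes U :: "real \<Rightarrow> real \<Rightarrow> 'a::banach \<Rightarrow>\<^sub>L 'a"
    and L P S :: "real \<Rightarrow> 'a \<Rightarrow>\<^sub>L 'a" and h p \<eta> K :: real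
  assumes h: "h > 0"
    and U: "propagator U"
    and norm_U: "s \<le> t \<Longrightarrow> t \<le> s + h \<Longrightarrow> norm (U t s) \<le> K"
    and PP: "P s (P s x) = P s x"
    and LP: "P (s + h) (L s x) = L s (P s x)"
    and SL: "S s (L s x) = x - P s x"
    and LS: "L s (S s x) = x - P (s + h) x"
    and PS: "P s (S s x) = 0"
    and norm_P: "norm (P s) \<le> p"
    and norm_LP: "norm (L s (P s x)) \<le> norm x / 16"
    and norm_S: "norm (S s x) \<le> norm x / 16"
    and norm_E: "norm (U (s + h) s - L s) \<le> \<eta>"
    and \<eta>: "p * \<eta> \<le> 1 / 16" "\<eta> \<le> 1"
begin

lemma lattice: "discrete_dichotomy (\<lambda>n. L (s + of_int n * h))
    (\<lambda>n. U (s + of_int (n + 1) * h) (s + of_int n * h) - L (s + of_int n * h))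
    (\<lambda>n. P (s + of_int n * h)) (\<lambda>n. S (s + of_int n * h)) p \<eta>"
proof -
  have eq: "s + of_int (n + 1) * h = s + of_int n * h + h" for n :: int by (simp add: algebra_simps)
  show ?thesis
    by unfold_locales (simp_all only: eq PP LP SL LS PS norm_P norm_LP norm_S norm_E \<eta>)
qed

lemma bounded_homogeneous_zero:
  assumes z: "\<And>r t. r \<le> t \<Longrightarrow> z t = U t r (z r)" and b: "\<And>t. norm (z t) \<le> c"
  shows "z t = 0"
proof -
  interpret discrete_dichotomy "\<lambda>n. L (t + of_int n * h)"
    "\<lambda>n. U (t + of_int (n + 1) * h) (t + of_int n * h) - L (t + of_int n * h)"
    "\<lambda>n. P (t + of_int n * h)" "\<lambda>n. S (t + of_int n * h)" p \<eta>
    by (rule lattice)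
  have "z (t + of_int 0 * h) = 0"
    using h z by (intro bounded_solution_zero[where z = "\<lambda>n. z (t + of_int n * h)" and c = c] b)
      (simp add: blinfun.diff_left)
  then show ?thesis by simp
qed

text \<open>Duhamel's formula for an equation forced by a Dirac mass at s of size
  \<open>\<xi>\<close>. The conditions r < s and s \<le> t put the value at s after the
  jump.\<close>

definition jump_solution :: "real \<Rightarrow> 'a \<Rightarrow> (real \<Rightarrow> 'a) \<Rightarrow> bool" where
  "jump_solution s \<xi> z \<longleftrightarrow>
     (\<forall>r t. r \<le> t \<longrightarrow> z t = U t r (z r) + (if r < s \<and> s \<le> t then U t s \<xi> else 0))"

lemma jump_solution_unique:
  assumes "jump_solution s \<xi> z" "\<And>t. norm (z t) \<le> c"
    and "jump_solution s \<xi> z'" "\<And>t. norm (z' t) \<le> c'"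
  shows "z t = z' t"
proof -
  have "z t - z' t = 0"
  proof (rule bounded_homogeneous_zero[where z = "\<lambda>t. z t - z' t"])
    show "norm (z t - z' t) \<le> c + c'" for t
      using assms(2,4) by (meson add_mono norm_triangle_ineq4 order_trans)
    show "z t - z' t = U t r (z r - z' r)" if "r \<le> t" for r t
    proof -
      have "z t = U t r (z r) + (if r < s \<and> s \<le> t then U t s \<xi> else 0)"
        "z' t = U t r (z' r) + (if r < s \<and> s \<le> t then U t s \<xi> else 0)"
        using assms(1,3) that by (auto simp: jump_solution_def)
      then show ?thesis by (simp add: blinfun.diff_right)
    qed
  qed
  then show ?thesis by simp
qed

text \<open>The factors of \<open>C\<close>: 2 (p + 1) from the discrete Green function,
  \<open>K\<close> for the passage from the last lattice point, and 2 for rounding t - s to a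
  multiple of h. The rate \<open>\<beta>\<close> expresses halving per step of length h.\<close>

definition C where "C = 4 * K * (p + 1)"
definition \<beta> where "\<beta> = ln 2 / h"

lemma \<beta>_pos: "\<beta> > 0" using h by (simp add: \<beta>_def)

lemma K_nonneg: "0 \<le> K"
  using norm_U[of 0 0] h norm_ge_zero[of "U 0 0"] by linarith

lemma p_nonneg: "0 \<le> p"
  using norm_P[of 0] norm_ge_zero[of "P 0"] by linarith

lemma C_nonneg: "0 \<le> C"
  using K_nonneg p_nonneg by (simp add: C_def)

text \<open>The lattice is anchored at s, so the jump falls on a lattice point; between lattice
  points the discrete solution is continued by \<open>U\<close>.\<close>

lemma jump_solution_exists:
  "\<exists>z. jump_solution s \<xi> z \<and> (\<forall>t. norm (z t) \<le> C * exp (- \<beta> * \<bar>t - s\<bar>) * norm \<xi>)"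
proof -
  define e where "e n = s + of_int n * h" for n :: int
  have e0: "e 0 = s" by (simp add: e_def)
  have e_mono: "e m \<le> e n \<longleftrightarrow> m \<le> n" for m n using h by (simp add: e_def)
  have e_Suc: "e (n + 1) = e n + h" for n by (simp add: e_def algebra_simps)
  interpret discrete_dichotomy "\<lambda>n. L (s + of_int n * h)"
    "\<lambda>n. U (s + of_int (n + 1) * h) (s + of_int n * h) - L (s + of_int n * h)"
    "\<lambda>n. P (s + of_int n * h)" "\<lambda>n. S (s + of_int n * h)" p \<eta>
    by (rule lattice)
  obtain z where z0: "\<And>n. z (n + 1) = L (s + of_int n * h) (z n) +
      (U (s + of_int (n + 1) * h) (s + of_int n * h) - L (s + of_int n * h)) (z n) +
      (if n + 1 = 0 then \<xi> else 0)"
    and zb: "\<And>n. norm (z n) \<le> 2 * (p + 1) * norm \<xi> * (1 / 2) ^ nat \<bar>n\<bar>"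
    using decaying_green_solution by blast
  have z: "z (n + 1) = U (e (n + 1)) (e n) (z n) + (if n + 1 = 0 then \<xi> else 0)" for n
    using z0[of n] by (simp add: e_def blinfun.diff_left)
  have zm: "z m = U (e m) (e n) (z n) + (if n < 0 \<and> 0 \<le> m then U (e m) (e 0) \<xi> else 0)"
    if "n \<le> m" for m n
    using that
  proof (induction m rule: int_ge_induct)
    case base
    then show ?case by (auto simp: propagator_id[OF U])
  next
    case (step m)
    have *: "U (e (m + 1)) (e m) (U (e m) (e k) y) = U (e (m + 1)) (e k) y" if "k \<le> m" for k y
      using that by (intro propagator_comp[OF U]) (auto simp: e_mono)
    have "z (m + 1) = U (e (m + 1)) (e n) (z n) + (if m + 1 = 0 then \<xi> else 0) +
        (if n < 0 \<and> 0 \<le> m then U (e (m + 1)) (e 0) \<xi> else 0)"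
      using step by (auto simp: z[of m] * blinfun.add_right)
    then show ?case using step(1) by (cases "m + 1 = 0") (auto simp: propagator_id[OF U])
  qed
  define k where "k t = \<lfloor>(t - s) / h\<rfloor>" for t
  have k: "e (k t) \<le> t" "t < e (k t) + h" for t
  proof -
    have "of_int (k t) \<le> (t - s) / h" "(t - s) / h < of_int (k t) + 1"
      by (auto simp: k_def)
    then show "e (k t) \<le> t" "t < e (k t) + h" using h by (auto simp: e_def field_simps)
  qed
  have k_mono: "k r \<le> k t" if "r \<le> t" for r t
    unfolding k_def using h that by (intro floor_mono divide_right_mono) auto
  \<comment> \<open>Times before the jump are exactly those in cells of negative index, which
    matches the jump condition on the lattice with the one on the line.\<close>
  have k0: "k t < 0 \<longleftrightarrow> t < s" for t
    using h by (auto simp: k_def floor_less_zero divide_less_0_iff)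
  define Z where "Z t = U t (e (k t)) (z (k t))" for t
  have "jump_solution s \<xi> Z"
    unfolding jump_solution_def
  proof (intro allI impI)
    fix r t :: real assume rt: "r \<le> t"
    have 1: "U t (e (k t)) (U (e (k t)) (e (k r)) y) = U t r (U r (e (k r)) y)" for y
    proof -
      have "U t (e (k t)) (U (e (k t)) (e (k r)) y) = U t (e (k r)) y"
        using k k_mono[OF rt] by (intro propagator_comp[OF U]) (auto simp: e_mono)
      also have "\<dots> = U t r (U r (e (k r)) y)"
        using k rt by (intro propagator_comp[OF U, symmetric]) auto
      finally show ?thesis .
    qed
    have 2: "U t (e (k t)) (U (e (k t)) (e 0) \<xi>) = U t s \<xi>" if "s \<le> t"
      using k(1)[of t] e_mono[of 0 "k t"] k0[of t] that by (subst propagator_comp[OF U]) (auto simp: e0)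
    show "Z t = U t r (Z r) + (if r < s \<and> s \<le> t then U t s \<xi> else 0)"
      unfolding Z_def zm[OF k_mono[OF rt]] using 1 2 k0[of r] k0[of t]
      by (auto simp: blinfun.add_right)
  qed
  moreover have "norm (Z t) \<le> C * exp (- \<beta> * \<bar>t - s\<bar>) * norm \<xi>" for t
  proof -
    \<comment> \<open>Rounding loses at most one cell on either side of s; this is the factor 2 in
      \<open>half\<close>.\<close>
    have "\<bar>t - s\<bar> / h \<le> of_int \<bar>k t\<bar> + 1"
    proof (cases "t < s")
      case True
      then have "k t < 0" using k0 by simp
      then show ?thesis using k(1)[of t] h True by (simp add: e_def field_simps)
    next
      case False
      then have "\<not> k t < 0" using k0 by simp
      then show ?thesis using k(2)[of t] h False by (simp add: e_def field_simps)
    qed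
    then have "- (of_int \<bar>k t\<bar> + 1) * ln 2 \<le> - (\<bar>t - s\<bar> / h) * ln (2 :: real)"
      by (intro mult_right_mono) auto
    then have "exp (- (of_int \<bar>k t\<bar> + 1) * ln (2 :: real)) \<le> exp (- \<beta> * \<bar>t - s\<bar>)"
      by (simp add: \<beta>_def mult.commute)
    moreover have "exp (- (of_int \<bar>k t\<bar> + 1) * ln (2 :: real)) = (1 / 2) ^ (nat \<bar>k t\<bar>) / 2"
    proof -
      have "exp (- (of_int \<bar>k t\<bar> + 1) * ln (2 :: real)) = exp (of_nat (Suc (nat \<bar>k t\<bar>)) * (- ln 2))"
        by (simp add: algebra_simps)
      also have "\<dots> = (1 / 2) ^ Suc (nat \<bar>k t\<bar>)"
        by (subst exp_of_nat_mult) (simp add: exp_minus inverse_eq_divide)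
      finally show ?thesis by simp
    qed
    ultimately have half: "(1 / 2) ^ (nat \<bar>k t\<bar>) \<le> 2 * exp (- \<beta> * \<bar>t - s\<bar>)" by linarith
    have "norm (Z t) \<le> K * (2 * (p + 1) * norm \<xi> * (1 / 2) ^ nat \<bar>k t\<bar>)"
      unfolding Z_def using k[of t]
      by (intro order_trans[OF norm_blinfun] mult_mono norm_U zb) (auto simp: K_nonneg)
    also have "\<dots> \<le> K * (2 * (p + 1) * norm \<xi> * (2 * exp (- \<beta> * \<bar>t - s\<bar>)))"
      using K_nonneg p_nonneg by (intro mult_left_mono half) auto
    finally show ?thesis by (simp add: C_def algebra_simps)
  qed
  ultimately show ?thesis by blast
qed

text \<open>The Green function of the perturbed equation: \<open>green s \<xi> t\<close> is \<open>G(t, s) \<xi>\<close>,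
  normalised to be right continuous in \<open>t\<close> at the jump \<open>t = s\<close>.\<close>

definition green :: "real \<Rightarrow> 'a \<Rightarrow> real \<Rightarrow> 'a" where
  "green s \<xi> = (SOME z. jump_solution s \<xi> z \<and> (\<forall>t. norm (z t) \<le> C * exp (- \<beta> * \<bar>t - s\<bar>) * norm \<xi>))"

lemma green: "jump_solution s \<xi> (green s \<xi>)"
  and norm_green: "norm (green s \<xi> t) \<le> C * exp (- \<beta> * \<bar>t - s\<bar>) * norm \<xi>"
  using someI_ex[OF jump_solution_exists[of s \<xi>]] by (auto simp: green_def)

lemma norm_green': "norm (green s \<xi> t) \<le> C * norm \<xi>"
proof -
  have "C * exp (- \<beta> * \<bar>t - s\<bar>) * norm \<xi> \<le> C * 1 * norm \<xi>"
    using \<beta>_pos C_nonneg by (intro mult_right_mono mult_left_mono) auto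
  then show ?thesis using norm_green[of s \<xi> t] by simp
qed

text \<open>The choice in \<open>green\<close> is harmless, since any bounded jump solution equals
  it. Linearity, idempotence, transport and the kernel computation below all come from exhibiting a
  candidate.\<close>

lemma green_eqI:
  assumes "jump_solution s \<xi> z" "\<And>t. norm (z t) \<le> c"
  shows "green s \<xi> t = z t"
  by (rule jump_solution_unique[OF green norm_green' assms])

lemma green_forward:
  assumes "r \<le> t" "t < s \<or> s \<le> r"
  shows "green s \<xi> t = U t r (green s \<xi> r)"
  using green[of s \<xi>] assms by (auto simp: jump_solution_def)

lemma green_across:
  assumes "r < s" "s \<le> t"
  shows "green s \<xi> t = U t r (green s \<xi> r) + U t s \<xi>"
  using green[of s \<xi>, unfolded jump_solution_def, rule_format, of r t] assms by simp

lemma bounded_linear_green: "bounded_linear (\<lambda>\<xi>. green s \<xi> t)"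
proof (rule bounded_linear_intro)
  show "green s (\<xi> + \<xi>') t = green s \<xi> t + green s \<xi>' t" for \<xi> \<xi>'
  proof (rule green_eqI)
    show "jump_solution s (\<xi> + \<xi>') (\<lambda>t. green s \<xi> t + green s \<xi>' t)"
      using green[of s \<xi>] green[of s \<xi>'] unfolding jump_solution_def
      by (auto simp: blinfun.add_right)
    show "norm (green s \<xi> t + green s \<xi>' t) \<le> C * norm \<xi> + C * norm \<xi>'" for t
      by (intro norm_triangle_mono norm_green')
  qed
  show "green s (c *\<^sub>R \<xi>) t = c *\<^sub>R green s \<xi> t" for c \<xi>
  proof (rule green_eqI)
    show "jump_solution s (c *\<^sub>R \<xi>) (\<lambda>t. c *\<^sub>R green s \<xi> t)"
      using green[of s \<xi>] unfolding jump_solution_def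
      by (auto simp: blinfun.scaleR_right scaleR_right_distrib)
    show "norm (c *\<^sub>R green s \<xi> t) \<le> \<bar>c\<bar> * (C * norm \<xi>)" for t
      by (auto intro: mult_left_mono norm_green')
  qed
  show "norm (green s \<xi> t) \<le> norm \<xi> * C" for \<xi>
    using norm_green' by (simp add: mult.commute)
qed

text \<open>The stable projection is the value just after the impulse; a vector in its kernel is one
  whose response vanishes from s onwards.\<close>

definition R :: "real \<Rightarrow> 'a \<Rightarrow>\<^sub>L 'a" where "R s = Blinfun (\<lambda>\<xi>. green s \<xi> s)"

lemma R_apply: "R s \<xi> = green s \<xi> s"
  by (simp add: R_def bounded_linear_Blinfun_apply bounded_linear_green)

lemma norm_R: "norm (R s \<xi>) \<le> C * norm \<xi>"
  by (simp add: R_apply norm_green')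

lemma green_future: "s \<le> t \<Longrightarrow> green s \<xi> t = U t s (R s \<xi>)"
  using green_forward[of s t s] by (simp add: R_apply)

text \<open>Erasing the past of \<open>green s \<xi>\<close> leaves a bounded solution with jump
  \<open>R s \<xi>\<close> at s, and its value at s is unchanged.\<close>

lemma R_idem: "R s (R s \<xi>) = R s \<xi>"
proof -
  have "green s (R s \<xi>) s = (\<lambda>t. if s \<le> t then green s \<xi> t else 0) s"
  proof (rule green_eqI[where z = "\<lambda>t. if s \<le> t then green s \<xi> t else 0"])
    show "jump_solution s (R s \<xi>) (\<lambda>t. if s \<le> t then green s \<xi> t else 0)"
      using propagator_comp[OF U, of s] by (auto simp: jump_solution_def green_future)
    show "norm (if s \<le> t then green s \<xi> t else 0) \<le> C * norm \<xi>" for t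
      using norm_green'[of s \<xi> t] C_nonneg by auto
  qed
  then show ?thesis by (simp add: R_apply)
qed

text \<open>Carrying the impulse along the flow from s to t changes the response only on [s, t),
  where the free orbit of \<open>\<xi>\<close> is missing. At r = t this yields invariance of the
  projections; at r = s it recovers unstable vectors from the past of a response.\<close>

lemma green_transport:
  assumes st: "s \<le> t"
  shows "green t (U t s \<xi>) r = green s \<xi> r - (if s \<le> r \<and> r < t then U r s \<xi> else 0)"
proof -
  \<comment> \<open>Uniqueness applies to bounded candidates; the orbit over the compact interval is
    bounded by strong continuity.\<close>
  have "bounded ((\<lambda>r. U r s \<xi>) ` {s..t})"
    by (intro compact_imp_bounded compact_continuous_image
        continuous_on_subset[OF propagator_continuous_fst[OF U, of s]]) auto
  then obtain c where c: "\<And>r. r \<in> {s..t} \<Longrightarrow> norm (U r s \<xi>) \<le> c" unfolding bounded_iff by blast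
  show ?thesis
  proof (rule green_eqI)
    show "norm (green s \<xi> r - (if s \<le> r \<and> r < t then U r s \<xi> else 0)) \<le> C * norm \<xi> + \<bar>c\<bar>" for r
      by (intro order_trans[OF norm_triangle_ineq4] add_mono norm_green') (use c[of r] in auto)
    show "jump_solution t (U t s \<xi>) (\<lambda>r. green s \<xi> r - (if s \<le> r \<and> r < t then U r s \<xi> else 0))"
      unfolding jump_solution_def
    proof (intro allI impI)
      fix q r :: real assume qr: "q \<le> r"
      have c1: "U r q (U q s \<xi>) = U r s \<xi>" if "s \<le> q" using that qr by (rule propagator_comp[OF U])
      have c2: "U r t (U t s \<xi>) = U r s \<xi>" if "t \<le> r" using st that by (rule propagator_comp[OF U])
      consider "q < s" "s \<le> r" | "r < s \<or> s \<le> q" by linarith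
      then show "green s \<xi> r - (if s \<le> r \<and> r < t then U r s \<xi> else 0) =
          U r q (green s \<xi> q - (if s \<le> q \<and> q < t then U q s \<xi> else 0)) +
          (if q < t \<and> t \<le> r then U r t (U t s \<xi>) else 0)"
      proof cases
        case 1
        then show ?thesis using st c2 by (auto simp: green_across[OF 1])
      next
        case 2
        then show ?thesis using st qr c1 c2
          by (auto simp: green_forward[OF qr 2] blinfun.diff_right)
      qed
    qed
  qed
qed

lemma R_commute: "s \<le> t \<Longrightarrow> R t (U t s \<xi>) = U t s (R s \<xi>)"
  using green_transport[of s t \<xi> t] green_future[of s t \<xi>] by (simp add: R_apply[of t])

text \<open>For s < t the vector - \<xi> is the value at s of the response to an impulse
  \<open>U t s \<xi>\<close> at t, and responses decay backwards from the impulse. The constant C +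
  1 covers s = t, where this argument is void.\<close>

lemma unstable_lower_bound:
  assumes "s \<le> t" "R s \<xi> = 0"
  shows "norm \<xi> \<le> (C + 1) * exp (- \<beta> * (t - s)) * norm (U t s \<xi>)"
proof (cases "s = t")
  case True
  then show ?thesis using C_nonneg by (simp add: propagator_id[OF U] algebra_simps)
next
  case False
  then have "- \<xi> = green t (U t s \<xi>) s"
    using green_transport[of s t \<xi> s] assms by (simp add: R_apply propagator_id[OF U])
  then have "norm \<xi> \<le> C * exp (- \<beta> * (t - s)) * norm (U t s \<xi>)"
    using norm_green[of t "U t s \<xi>" s] assms by (metis abs_minus_commute abs_of_nonneg diff_ge_0_iff_ge norm_minus_cancel)
  also have "\<dots> \<le> (C + 1) * exp (- \<beta> * (t - s)) * norm (U t s \<xi>)"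
    by (intro mult_right_mono) auto
  finally show ?thesis .
qed

text \<open>Since \<open>R t y = 0\<close>, the response to an impulse y at t vanishes at t, so its
  negative before t is a bounded backward orbit that ends in y. Truncating the response at s shows
  that its value there is in the kernel of \<open>R s\<close>.\<close>

lemma unstable_preimage:
  assumes "s \<le> t" "R t y = 0"
  obtains x where "R s x = 0" "U t s x = y"
proof (cases "s = t")
  case True
  then show ?thesis using that[of y] assms by (simp add: propagator_id[OF U])
next
  case False
  then have st: "s < t" using assms by simp
  let ?x = "- green t y s"
  have "green t y t = U t s (green t y s) + U t t y" by (rule green_across[OF st]) simp
  then have 1: "U t s ?x = y"
    using assms by (simp add: R_apply propagator_id[OF U] blinfun.minus_right add_eq_0_iff)
  have "green s ?x s = (\<lambda>r. if r < s then green t y r else 0) s"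
  proof (rule green_eqI[where z = "\<lambda>r. if r < s then green t y r else 0"])
    show "norm (if r < s then green t y r else 0) \<le> C * norm y" for r
      using norm_green'[of t y r] C_nonneg by auto
    show "jump_solution s ?x (\<lambda>r. if r < s then green t y r else 0)"
      unfolding jump_solution_def
    proof (intro allI impI)
      fix q r :: real assume qr: "q \<le> r"
      have "U r s (green t y s) = U r q (green t y q)" if "q < s" "s \<le> r"
        using that st propagator_comp[OF U, of q s r] green_forward[of q s t y] by auto
      moreover have "green t y r = U r q (green t y q)" if "r < s"
        using that st qr by (intro green_forward) auto
      ultimately show "(if r < s then green t y r else 0) = U r q (if q < s then green t y q else 0) +
         (if q < s \<and> s \<le> r then U r s ?x else 0)"
        using qr by (auto simp: blinfun.minus_right)
    qed
  qed
  then have "R s ?x = 0" by (simp add: R_apply)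
  with 1 show ?thesis using that by blast
qed

text \<open>From the right, invariance compares \<open>R r x\<close> with
  \<open>U r t (R t x)\<close>. From the left the flow cannot be run back, so x is split at t: its
  unstable part has an earlier preimage, and for its stable part the error is controlled by
  expansion.\<close>

lemma R_strongly_continuous: "continuous_on UNIV (\<lambda>t. R t x)"
proof -
  have "isCont (\<lambda>t. R t x) t" for t
  proof -
    have "((\<lambda>r. R r x) \<longlongrightarrow> R t x) (at_right t)"
    proof (rule Lim_transform)
      have 1: "((\<lambda>r. U r t y) \<longlongrightarrow> y) (at_right t)" for y
      proof -
        have "((\<lambda>r. U r t y) \<longlongrightarrow> U t t y) (at t within {t..})"
          using propagator_continuous_fst[OF U, of t y] by (auto simp: continuous_on)
        then show ?thesis by (auto simp: propagator_id[OF U] intro: tendsto_within_subset)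
      qed
      show "((\<lambda>r. U r t (R t x)) \<longlongrightarrow> R t x) (at_right t)" by (rule 1)
      show "((\<lambda>r. R r x - U r t (R t x)) \<longlongrightarrow> 0) (at_right t)"
      proof (rule Lim_null_comparison)
        show "((\<lambda>r. C * norm (U r t x - x)) \<longlongrightarrow> 0) (at_right t)"
          using tendsto_mult_right_zero[OF tendsto_norm_zero[OF LIM_zero[OF 1[of x]]], of C] by simp
        show "\<forall>\<^sub>F r in at_right t. norm (R r x - U r t (R t x)) \<le> C * norm (U r t x - x)"
        proof (rule eventually_at_rightI[of t "t + 1"])
          fix r assume "r \<in> {t<..<t + 1}"
          then have "U r t (R t x) - R r x = R r (U r t x - x)"
            by (simp add: R_commute blinfun.diff_right)
          then show "norm (R r x - U r t (R t x)) \<le> C * norm (U r t x - x)"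
            by (simp add: norm_minus_commute[of "R r x"] norm_R)
        qed simp
      qed
    qed
    moreover have "((\<lambda>r. R r x) \<longlongrightarrow> R t x) (at_left t)"
    proof -
      have cont: "((\<lambda>r. U t r y) \<longlongrightarrow> y) (at_left t)" for y
      proof -
        have "((\<lambda>r. U t r y) \<longlongrightarrow> U t t y) (at t within {..t})"
          using propagator_continuous_snd[OF U, of t y] by (simp add: continuous_on)
        then have "((\<lambda>r. U t r y) \<longlongrightarrow> U t t y) (at_left t)" by (rule tendsto_within_subset) auto
        then show ?thesis by (simp add: propagator_id[OF U])
      qed
      define w where "w = R t x"
      define y where "y = x - w"
      have Rw: "R t w = w" by (simp add: w_def R_idem)
      have "R t y = 0" by (simp add: y_def w_def blinfun.diff_right R_idem)
      \<comment> \<open>The orbit of \<open>v\<close> stays in the kernels of \<open>R r\<close> and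
        tends to \<open>y\<close> from the left, so \<open>R r y\<close> is, up to sign, a uniformly
        bounded operator applied to a small vector.\<close>
      then obtain v where v: "R (t - 1) v = 0" "U t (t - 1) v = y"
        using unstable_preimage[of "t - 1" t y] by auto
      have "((\<lambda>r. R r y) \<longlongrightarrow> 0) (at_left t)"
      proof (rule Lim_null_comparison)
        have "((\<lambda>r. U r (t - 1) v) \<longlongrightarrow> y) (at t within {t - 1..})"
          using bspec[OF propagator_continuous_fst[OF U, of "t - 1" v, unfolded continuous_on], of t] v(2)
          by simp
        then have "((\<lambda>r. U r (t - 1) v) \<longlongrightarrow> y) (at t within {t - 1..t})"
          by (rule tendsto_within_subset) auto
        then have "((\<lambda>r. U r (t - 1) v) \<longlongrightarrow> y) (at_left t)"
          by (simp add: at_within_Icc_at_left)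
        from tendsto_mult_right_zero[OF tendsto_norm_zero[OF LIM_zero[OF this]], of C]
        show "((\<lambda>r. C * norm (U r (t - 1) v - y)) \<longlongrightarrow> 0) (at_left t)" .
        show "\<forall>\<^sub>F r in at_left t. norm (R r y) \<le> C * norm (U r (t - 1) v - y)"
        proof (rule eventually_at_leftI[of "t - 1" t])
          fix r assume "r \<in> {t - 1<..<t}"
          then have "R r (U r (t - 1) v) = 0" by (simp add: R_commute v)
          then have "R r y = - R r (U r (t - 1) v - y)" by (simp add: blinfun.diff_right)
          then show "norm (R r y) \<le> C * norm (U r (t - 1) v - y)" by (simp add: norm_R)
        qed simp
      qed
      \<comment> \<open>The error \<open>w - R r w\<close> lies in the kernel of \<open>R r\<close>,
        so its norm is controlled by its image at time t, which tends to
        \<open>w - R t w = 0\<close>.\<close>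
      moreover have "((\<lambda>r. R r w) \<longlongrightarrow> w) (at_left t)"
      proof (rule LIM_zero_cancel, rule Lim_null_comparison)
        have "((\<lambda>r. U t r w - R t (U t r w)) \<longlongrightarrow> w - R t w) (at_left t)"
          by (intro tendsto_intros cont)
        then have "((\<lambda>r. U t r w - R t (U t r w)) \<longlongrightarrow> 0) (at_left t)" by (simp add: Rw)
        from tendsto_mult_right_zero[OF tendsto_norm_zero[OF this], of "C + 1"]
        show "((\<lambda>r. (C + 1) * norm (U t r w - R t (U t r w))) \<longlongrightarrow> 0) (at_left t)" .
        show "\<forall>\<^sub>F r in at_left t. norm (R r w - w) \<le> (C + 1) * norm (U t r w - R t (U t r w))"
        proof (rule eventually_at_leftI[of "t - 1" t])
          fix r assume "r \<in> {t - 1<..<t}"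
          then have rt: "r \<le> t" by simp
          have "norm (w - R r w) \<le> (C + 1) * exp (- \<beta> * (t - r)) * norm (U t r (w - R r w))"
            by (rule unstable_lower_bound[OF rt]) (simp add: blinfun.diff_right R_idem)
          also have "\<dots> \<le> (C + 1) * 1 * norm (U t r (w - R r w))"
            using \<beta>_pos C_nonneg rt by (intro mult_right_mono mult_left_mono) auto
          also have "U t r (w - R r w) = U t r w - R t (U t r w)"
            by (simp add: blinfun.diff_right R_commute[OF rt])
          finally show "norm (R r w - w) \<le> (C + 1) * norm (U t r w - R t (U t r w))"
            by (simp add: norm_minus_commute)
        qed simp
      qed
      ultimately have "((\<lambda>r. R r w + R r y) \<longlongrightarrow> w + 0) (at_left t)" by (rule tendsto_add[rotated])
      then show ?thesis by (simp add: y_def w_def blinfun.diff_right)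
    qed
    ultimately show ?thesis by (simp add: isCont_def filterlim_at_split)
  qed
  then show ?thesis by (simp add: continuous_on_eq_continuous_at)
qed

lemma exponential_dichotomy_perturbed: "exponential_dichotomy U"
  unfolding exponential_dichotomy_def
proof (rule exI[of _ R], rule exI[of _ "C + 1"], rule exI[of _ \<beta>], intro conjI allI impI ballI)
  show "0 < C + 1" using C_nonneg by simp
  show "0 < \<beta>" by (rule \<beta>_pos)
  show "R t o\<^sub>L R t = R t" for t by (rule blinfun_eqI) (simp add: R_idem)
  show "continuous_on UNIV (\<lambda>t. R t x)" for x by (rule R_strongly_continuous)
next
  fix s t :: real assume st: "s \<le> t"
  show "R t o\<^sub>L U t s = U t s o\<^sub>L R s" by (rule blinfun_eqI) (simp add: R_commute[OF st])
  have expand: "norm y \<le> (C + 1) * exp (- \<beta> * (t - s)) * norm (U t s y)" if "R s y = 0" for y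
    by (rule unstable_lower_bound[OF st that])
  show "norm (U t s x) \<le> (C + 1) * exp (- \<beta> * (t - s)) * norm x" if x: "x \<in> range (R s)" for x
  proof -
    have "R s x = x" using x by (auto simp: R_idem)
    then have "norm (U t s x) \<le> C * exp (- \<beta> * (t - s)) * norm x"
      using norm_green[of s x t] green_future[OF st, of x] st by simp
    also have "\<dots> \<le> (C + 1) * exp (- \<beta> * (t - s)) * norm x" by (intro mult_right_mono) auto
    finally show ?thesis .
  qed
  show "1 / (C + 1) * exp (\<beta> * (t - s)) * norm y \<le> norm (U t s y)" if "y \<in> {y. R s y = 0}" for y
  proof -
    define e where "e = exp (\<beta> * (t - s))"
    have e: "e > 0" "exp (- \<beta> * (t - s)) = 1 / e" by (simp_all add: e_def exp_minus inverse_eq_divide)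
    then show ?thesis using expand[of y] that C_nonneg
      unfolding e_def[symmetric] e(2) by (simp add: divide_simps mult.commute)
  qed
  show bij: "bij_betw (U t s) {y. R s y = 0} {y. R t y = 0}"
    unfolding bij_betw_def
  proof
    show "inj_on (U t s) {y. R s y = 0}"
    proof (rule inj_onI)
      fix x y assume "x \<in> {y. R s y = 0}" "y \<in> {y. R s y = 0}" "U t s x = U t s y"
      then show "x = y" using expand[of "x - y"] by (simp add: blinfun.diff_right)
    qed
    show "U t s ` {y. R s y = 0} = {y. R t y = 0}"
    proof (intro subset_antisym subsetI)
      fix y assume "y \<in> {y. R t y = 0}"
      then obtain x where "R s x = 0" "U t s x = y" using unstable_preimage[OF st, of y] by auto
      then show "y \<in> U t s ` {y. R s y = 0}" by auto
    qed (auto simp: R_commute[OF st])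
  qed
  define J where "J = inv_into {y. R s y = 0} (U t s)"
  have J: "R s (J y) = 0" "U t s (J y) = y" if "R t y = 0" for y
    using bij_betw_inv_into_right[OF bij, of y] bij_betwE[OF bij_betw_inv_into[OF bij]] that
    by (auto simp: J_def)
  \<comment> \<open>Expansion on the kernels is a Lipschitz bound for the inverse.\<close>
  have "((C + 1) * exp (- \<beta> * (t - s)))-lipschitz_on {y. R t y = 0} J"
  proof (rule lipschitz_onI)
    fix x y assume "x \<in> {y. R t y = 0}" "y \<in> {y. R t y = 0}"
    then show "dist (J x) (J y) \<le> (C + 1) * exp (- \<beta> * (t - s)) * dist x y"
      using expand[of "J x - J y"] by (simp add: J dist_norm blinfun.diff_right)
  qed (use C_nonneg in auto)
  then show "continuous_on {y. R t y = 0} (inv_into {y. R s y = 0} (U t s))"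
    unfolding J_def by (rule lipschitz_on_continuous_on)
qed

end

subsection \<open>Robustness of exponential dichotomies\<close>

text \<open>Each \<open>P t\<close> is bounded, but a common bound has to be proved. A vector with a
  disproportionate unstable component would grow, after a suitable time \<open>\<tau>\<close>, more
  than \<open>c \<tau>\<close> and its stable component permit.\<close>

lemma exponential_dichotomy_projections_bounded:
  fixes U :: "real \<Rightarrow> real \<Rightarrow> 'a::real_normed_vector \<Rightarrow>\<^sub>L 'a" and P :: "real \<Rightarrow> 'a \<Rightarrow>\<^sub>L 'a"
    and N \<alpha> :: real
  assumes N: "N > 0" and \<alpha>: "\<alpha> > 0"
    and growth: "\<And>s t. s \<le> t \<Longrightarrow> norm (U t s) \<le> c (t - s)"
    and PP: "\<And>s x. P s (P s x) = P s x"
    and stable: "\<And>s t x. s \<le> t \<Longrightarrow> norm (U t s (P s x)) \<le> N * exp (- \<alpha> * (t - s)) * norm (P s x)"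
    and unstable: "\<And>s t y. s \<le> t \<Longrightarrow> P s y = 0 \<Longrightarrow>
      norm (U t s y) \<ge> (1 / N) * exp (\<alpha> * (t - s)) * norm y"
  obtains p where "p > 0" "\<And>s x. norm (P s x) \<le> p * norm x" "\<And>s x. norm (x - P s x) \<le> p * norm x"
proof -
  \<comment> \<open>Makes exp (\<alpha> \<tau>) / N at least 1 + N: the norm of the unstable part
    then counts 1 + N times, and N of these absorb the stable part, whose norm is at most |x| plus
    that of the unstable part.\<close>
  define \<tau> where "\<tau> = ln (N + N\<^sup>2 + 1) / \<alpha>"
  have e: "exp (\<alpha> * \<tau>) = N + N\<^sup>2 + 1" using N \<alpha> by (simp add: \<tau>_def add_pos_pos)
  have \<tau>: "\<tau> \<ge> 0" using N \<alpha> by (simp add: \<tau>_def)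
  have c: "c \<tau> \<ge> 0" using order_trans[OF norm_ge_zero growth[of 0 \<tau>]] \<tau> by simp
  have Q: "norm (x - P s x) \<le> (c \<tau> + N) * norm x" for s x
  proof -
    let ?y = "x - P s x"
    have "(1 + N) * norm ?y \<le> (1 / N) * exp (\<alpha> * \<tau>) * norm ?y"
      using N unfolding e by (intro mult_right_mono) (auto simp: field_simps power2_eq_square)
    also have "\<dots> \<le> norm (U (s + \<tau>) s ?y)"
      using unstable[of s "s + \<tau>" ?y] \<tau> by (simp add: blinfun.diff_right PP)
    also have "\<dots> \<le> norm (U (s + \<tau>) s x) + norm (U (s + \<tau>) s (P s x))"
      unfolding blinfun.diff_right by (rule norm_triangle_ineq4)
    also have "\<dots> \<le> c \<tau> * norm x + N * exp (- \<alpha> * \<tau>) * norm (P s x)"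
    proof (rule add_mono)
      show "norm (U (s + \<tau>) s x) \<le> c \<tau> * norm x"
        using growth[of s "s + \<tau>"] \<tau> by (intro order_trans[OF norm_blinfun] mult_right_mono) auto
      show "norm (U (s + \<tau>) s (P s x)) \<le> N * exp (- \<alpha> * \<tau>) * norm (P s x)"
        using stable[of s "s + \<tau>" x] \<tau> by simp
    qed
    also have "N * exp (- \<alpha> * \<tau>) * norm (P s x) \<le> N * 1 * (norm x + norm ?y)"
    proof (rule mult_mono)
      show "N * exp (- \<alpha> * \<tau>) \<le> N * 1" using N \<alpha> \<tau> by (intro mult_left_mono) auto
      show "norm (P s x) \<le> norm x + norm ?y" using norm_triangle_ineq4[of x ?y] by simp
    qed (use N in auto)
    finally show ?thesis by (simp add: algebra_simps)
  qed
  show ?thesis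
  proof
    show "c \<tau> + N + 1 > 0" using c N by simp
    show "norm (x - P s x) \<le> (c \<tau> + N + 1) * norm x" for s x
      by (rule order_trans[OF Q]) (intro mult_right_mono, auto)
    show "norm (P s x) \<le> (c \<tau> + N + 1) * norm x" for s x
      using Q[of x s] norm_triangle_ineq4[of x "x - P s x"] by (simp add: algebra_simps)
  qed
qed

text \<open>The pair \<open>h\<close>, \<open>\<eta>\<close> is fixed before \<open>U\<close> is
  known, and closeness is tested over steps of length exactly \<open>h\<close>. The bound
  \<open>K\<close> may depend on \<open>U\<close>, since it enters the dichotomy constant but not
  the contraction.\<close>

theorem exponential_dichotomy_robust:
  fixes U\<^sub>0 :: "real \<Rightarrow> real \<Rightarrow> 'a::banach \<Rightarrow>\<^sub>L 'a"
  assumes dich: "exponential_dichotomy U\<^sub>0"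
    and growth: "\<And>s t. s \<le> t \<Longrightarrow> norm (U\<^sub>0 t s) \<le> c (t - s)"
  obtains h \<eta> where "h > 0" "\<eta> > 0"
    "\<And>U K. propagator U \<Longrightarrow> (\<And>s t. s \<le> t \<Longrightarrow> t \<le> s + h \<Longrightarrow> norm (U t s) \<le> K) \<Longrightarrow>
      (\<And>s. norm (U (s + h) s - U\<^sub>0 (s + h) s) \<le> \<eta>) \<Longrightarrow> exponential_dichotomy U"
proof -
  from dich[unfolded exponential_dichotomy_def] obtain P :: "real \<Rightarrow> 'a \<Rightarrow>\<^sub>L 'a" and N \<alpha> :: real
    where P: "N > 0 \<and> \<alpha> > 0 \<and> (\<forall>t. P t o\<^sub>L P t = P t) \<and>
        (\<forall>x. continuous_on UNIV (\<lambda>t. P t x)) \<and>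
        (\<forall>s t. s \<le> t \<longrightarrow>
           P t o\<^sub>L U\<^sub>0 t s = U\<^sub>0 t s o\<^sub>L P s \<and>
           (\<forall>x \<in> range (P s). norm (U\<^sub>0 t s x) \<le> N * exp (- \<alpha> * (t - s)) * norm x) \<and>
           (\<forall>y \<in> {y. P s y = 0}. norm (U\<^sub>0 t s y) \<ge> (1 / N) * exp (\<alpha> * (t - s)) * norm y) \<and>
           bij_betw (U\<^sub>0 t s) {y. P s y = 0} {y. P t y = 0} \<and>
           continuous_on {y. P t y = 0} (inv_into {y. P s y = 0} (U\<^sub>0 t s)))"
    by (elim exE) (rule that)
  have N: "N > 0" and \<alpha>: "\<alpha> > 0" and PP: "P t o\<^sub>L P t = P t" for t
    using P by auto
  note dich' = P[THEN conjunct2, THEN conjunct2, THEN conjunct2, THEN conjunct2, rule_format]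
  have PP: "P t (P t x) = P t x" for t x using PP[of t] by (metis blinfun_apply_blinfun_compose)
  have comm: "P t (U\<^sub>0 t s x) = U\<^sub>0 t s (P s x)" if "s \<le> t" for s t x
    using dich'[OF that, THEN conjunct1] by (metis blinfun_apply_blinfun_compose)
  have stable: "norm (U\<^sub>0 t s (P s x)) \<le> N * exp (- \<alpha> * (t - s)) * norm (P s x)" if "s \<le> t" for s t x
    using dich'[OF that, THEN conjunct2, THEN conjunct1] by blast
  have unstable: "norm (U\<^sub>0 t s y) \<ge> (1 / N) * exp (\<alpha> * (t - s)) * norm y" if "s \<le> t" "P s y = 0" for s t y
    using dich'[OF that(1), THEN conjunct2, THEN conjunct2, THEN conjunct1] that(2) by blast
  obtain p where p: "p > 0" and Pp: "\<And>s x. norm (P s x) \<le> p * norm x"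
    and Qp: "\<And>s x. norm (x - P s x) \<le> p * norm x"
    using exponential_dichotomy_projections_bounded[of N \<alpha> U\<^sub>0 c P, OF N \<alpha> growth PP stable unstable] by blast
  \<comment> \<open>Makes N p exp (- \<alpha> h) at most 1 / 16; the summand 2 keeps the logarithm
    positive.\<close>
  define h where "h = ln (16 * (N * p) + 2) / \<alpha>"
  have Np: "N * p > 0" using N p by simp
  have h: "h > 0" using \<alpha> Np by (simp add: h_def)
  have eh: "exp (- \<alpha> * h) = 1 / (16 * (N * p) + 2)"
    using \<alpha> Np by (simp add: h_def exp_minus inverse_eq_divide)
  have small: "N * exp (- \<alpha> * h) * p \<le> 1 / 16"
    using Np unfolding eh by (simp add: field_simps)
  \<comment> \<open>The inverse on the unstable kernels, preceded by the complementary projection so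
    that it acts on the whole space.\<close>
  define S where "S s = Blinfun (\<lambda>x. inv_into {y. P s y = 0} (U\<^sub>0 (s + h) s) (x - P (s + h) x))" for s
  define J where "J s = inv_into {y. P s y = 0} (U\<^sub>0 (s + h) s)" for s
  have bij: "bij_betw (U\<^sub>0 (s + h) s) {y. P s y = 0} {y. P (s + h) y = 0}" for s
    using dich'[of s "s + h"] h by simp
  have J: "P s (J s y) = 0" "U\<^sub>0 (s + h) s (J s y) = y" if "P (s + h) y = 0" for y s
    using bij_betw_inv_into_right[OF bij, of y s] bij_betwE[OF bij_betw_inv_into[OF bij[of s]]] that
    by (auto simp: J_def)
  have J_eqI: "J s y = x" if "P s x = 0" "U\<^sub>0 (s + h) s x = y" for s x y
    using bij_betw_inv_into_left[OF bij[of s], of x] that by (simp add: J_def)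
  have Q0: "P t (x - P t x) = 0" for t x by (simp add: blinfun.diff_right PP)
  have Jbound: "norm (J s (x - P (s + h) x)) \<le> norm x / 16" for s x
  proof -
    let ?y = "x - P (s + h) x"
    have "(1 / N) * exp (\<alpha> * h) * norm (J s ?y) \<le> norm ?y"
      using unstable[of s "s + h" "J s ?y"] J[OF Q0[of "s + h" x]] h by simp
    then have "norm (J s ?y) \<le> N * exp (- \<alpha> * h) * norm ?y"
      using N by (simp add: exp_minus field_simps)
    also have "\<dots> \<le> N * exp (- \<alpha> * h) * (p * norm x)"
      using N by (intro mult_left_mono Qp) auto
    also have "\<dots> \<le> norm x / 16"
      using mult_right_mono[OF small, of "norm x"] by (simp add: mult.assoc)
    finally show ?thesis .
  qed
  have S: "S s x = J s (x - P (s + h) x)" for s x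
  proof -
    have "bounded_linear (\<lambda>x. J s (x - P (s + h) x))"
    proof (rule bounded_linear_intro)
      fix x y :: 'a and c :: real
      show "J s (x + y - P (s + h) (x + y)) = J s (x - P (s + h) x) + J s (y - P (s + h) y)"
        by (rule J_eqI) (simp_all add: blinfun.add_right J[OF Q0])
      show "J s (c *\<^sub>R x - P (s + h) (c *\<^sub>R x)) = c *\<^sub>R J s (x - P (s + h) x)"
        by (rule J_eqI) (simp_all add: blinfun.scaleR_right J[OF Q0] scaleR_diff_right)
      show "norm (J s (x - P (s + h) x)) \<le> norm x * (1 / 16)" using Jbound by simp
    qed
    then show ?thesis by (simp add: S_def J_def bounded_linear_Blinfun_apply)
  qed
  define \<eta> where "\<eta> = min 1 (1 / (16 * p))"
  show ?thesis
  proof (rule that[of h \<eta>])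
    show "h > 0" "\<eta> > 0" using h p by (auto simp: \<eta>_def)
    fix U :: "real \<Rightarrow> real \<Rightarrow> 'a \<Rightarrow>\<^sub>L 'a" and K
    assume U: "propagator U" "\<And>s t. s \<le> t \<Longrightarrow> t \<le> s + h \<Longrightarrow> norm (U t s) \<le> K"
      "\<And>s. norm (U (s + h) s - U\<^sub>0 (s + h) s) \<le> \<eta>"
    interpret lattice_dichotomy U "\<lambda>s. U\<^sub>0 (s + h) s" P S h p \<eta> K
    proof
      fix s x
      show "norm (U\<^sub>0 (s + h) s (P s x)) \<le> norm x / 16"
      proof -
        have "norm (U\<^sub>0 (s + h) s (P s x)) \<le> N * exp (- \<alpha> * h) * norm (P s x)"
          using stable[of s "s + h" x] h by simp
        also have "\<dots> \<le> N * exp (- \<alpha> * h) * (p * norm x)"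
          using N by (intro mult_left_mono Pp) auto
        also have "\<dots> \<le> norm x / 16"
          using mult_right_mono[OF small, of "norm x"] by (simp add: mult.assoc)
        finally show ?thesis .
      qed
      show "norm (S s x) \<le> norm x / 16" unfolding S by (rule Jbound)
      show "S s (U\<^sub>0 (s + h) s x) = x - P s x"
        unfolding S using h by (intro J_eqI Q0) (simp add: comm blinfun.diff_right)
      show "norm (P s) \<le> p" using p Pp by (intro norm_blinfun_bound) auto
      show "p * \<eta> \<le> 1 / 16" using p by (simp add: \<eta>_def min_def field_simps)
    qed (use h U in \<open>auto simp: PP comm S J[OF Q0] \<eta>_def\<close>)
    show "exponential_dichotomy U" by (rule exponential_dichotomy_perturbed)
  qed
qed

subsection \<open>Strong derivatives and classical solutions\<close>

text \<open>Pointwise convergence of operators tolerates a moving argument once the norms stay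
  bounded: split \<open>F c (f c)\<close> at the limit y. Semigroups and evolution families are in
  general only strongly continuous, so products are handled this way throughout.\<close>

lemma tendsto_blinfun_apply_strong:
  fixes F :: "'c \<Rightarrow> 'a::real_normed_vector \<Rightarrow>\<^sub>L 'b::real_normed_vector"
  assumes F: "((\<lambda>c. F c y) \<longlongrightarrow> l) G" and f: "(f \<longlongrightarrow> y) G"
    and b: "\<forall>\<^sub>F c in G. norm (F c) \<le> C c" and C: "(C \<longlongrightarrow> k) G"
  shows "((\<lambda>c. F c (f c)) \<longlongrightarrow> l) G"
proof -
  have "((\<lambda>c. F c (f c - y)) \<longlongrightarrow> 0) G"
  proof (rule Lim_null_comparison)
    show "\<forall>\<^sub>F c in G. norm (F c (f c - y)) \<le> C c * norm (f c - y)"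
      using b by eventually_elim (intro order_trans[OF norm_blinfun] mult_right_mono, auto)
    show "((\<lambda>c. C c * norm (f c - y)) \<longlongrightarrow> 0) G"
      using tendsto_mult[OF C tendsto_norm_zero[OF LIM_zero[OF f]]] by simp
  qed
  from tendsto_add[OF this F] show ?thesis by (simp add: blinfun.diff_right)
qed

lemma continuous_on_blinfun_apply_strong:
  fixes F :: "'c::topological_space \<Rightarrow> 'a::real_normed_vector \<Rightarrow>\<^sub>L 'b::real_normed_vector"
  assumes F: "\<And>x. continuous_on X (\<lambda>c. F c x)" and b: "\<And>c. c \<in> X \<Longrightarrow> norm (F c) \<le> C c"
    and C: "continuous_on X C" and g: "continuous_on S g" "g ` S \<subseteq> X" and f: "continuous_on S f"
  shows "continuous_on S (\<lambda>z. F (g z) (f z))"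
  unfolding continuous_on_def
proof
  fix z assume z: "z \<in> S"
  show "((\<lambda>w. F (g w) (f w)) \<longlongrightarrow> F (g z) (f z)) (at z within S)"
  proof (rule tendsto_blinfun_apply_strong)
    show "((\<lambda>w. F (g w) (f z)) \<longlongrightarrow> F (g z) (f z)) (at z within S)"
      using continuous_on_compose2[OF F g] z unfolding continuous_on_def by blast
    show "(f \<longlongrightarrow> f z) (at z within S)" using f z unfolding continuous_on_def by blast
    show "((\<lambda>w. C (g w)) \<longlongrightarrow> C (g z)) (at z within S)"
      using continuous_on_compose2[OF C g] z unfolding continuous_on_def by blast
    show "\<forall>\<^sub>F w in at z within S. norm (F (g w)) \<le> C (g w)"
      unfolding eventually_at_filter using g(2) by (intro always_eventually) (auto intro!: b)
  qed
qed

lemma has_vector_derivative_quotient_iff: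
  "(f has_vector_derivative y) (at s within S) \<longleftrightarrow>
    ((\<lambda>r. (1 / (r - s)) *\<^sub>R (f r - f s)) \<longlongrightarrow> y) (at s within S)"
proof -
  have "(f has_vector_derivative y) (at s within S) \<longleftrightarrow>
      ((\<lambda>r. (1 / norm (r - s)) *\<^sub>R (f r - (f s + (r - s) *\<^sub>R y))) \<longlongrightarrow> 0) (at s within S)"
    by (simp add: has_vector_derivative_def has_derivative_within bounded_linear_scaleR_left)
  also have "\<dots> \<longleftrightarrow> ((\<lambda>r. norm ((1 / norm (r - s)) *\<^sub>R (f r - (f s + (r - s) *\<^sub>R y)))) \<longlongrightarrow> 0) (at s within S)"
    by (simp only: tendsto_norm_zero_iff)
  also have "\<dots> \<longleftrightarrow> ((\<lambda>r. norm ((1 / (r - s)) *\<^sub>R (f r - f s) - y)) \<longlongrightarrow> 0) (at s within S)"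
  proof (rule Lim_cong_within)
    fix r assume "r \<noteq> s"
    then have "(1 / (r - s)) *\<^sub>R (f r - f s) - y = (1 / (r - s)) *\<^sub>R (f r - (f s + (r - s) *\<^sub>R y))"
      unfolding diff_diff_eq[symmetric] scaleR_diff_right[of _ "f r - f s"] by simp
    then show "norm ((1 / norm (r - s)) *\<^sub>R (f r - (f s + (r - s) *\<^sub>R y))) =
        norm ((1 / (r - s)) *\<^sub>R (f r - f s) - y)" by simp
  qed auto
  also have "\<dots> \<longleftrightarrow> ((\<lambda>r. (1 / (r - s)) *\<^sub>R (f r - f s)) \<longlongrightarrow> y) (at s within S)"
    by (simp only: tendsto_norm_zero_iff LIM_zero_iff)
  finally show ?thesis .
qed

text \<open>Product rule with \<open>W\<close> differentiable along the fixed vector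
  \<open>q s\<close>: split the increment into W r (q r - q s) and the increment of W along q s. The
  first part uses the bound on \<open>W\<close> and strong continuity along
  \<open>q'\<close>.\<close>

lemma has_vector_derivative_blinfun_apply_strong:
  fixes W :: "real \<Rightarrow> 'a::real_normed_vector \<Rightarrow>\<^sub>L 'b::real_normed_vector"
  assumes q: "(q has_vector_derivative q') (at s within S)"
    and W: "((\<lambda>r. W r (q s)) has_vector_derivative w') (at s within S)"
    and cont: "((\<lambda>r. W r q') \<longlongrightarrow> W s q') (at s within S)"
    and b: "\<And>r. r \<in> S \<Longrightarrow> norm (W r) \<le> C"
  shows "((\<lambda>r. W r (q r)) has_vector_derivative (W s q' + w')) (at s within S)"
proof -
  let ?Q = "\<lambda>r. (1 / (r - s)) *\<^sub>R (q r - q s)"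
  have "((\<lambda>r. W r (?Q r)) \<longlongrightarrow> W s q') (at s within S)"
  proof (rule tendsto_blinfun_apply_strong[OF cont _ _ tendsto_const])
    show "(?Q \<longlongrightarrow> q') (at s within S)" using q by (simp add: has_vector_derivative_quotient_iff)
    show "\<forall>\<^sub>F r in at s within S. norm (W r) \<le> C"
      unfolding eventually_at_filter by (intro always_eventually) (auto intro!: b)
  qed
  from tendsto_add[OF this W[unfolded has_vector_derivative_quotient_iff]]
  show ?thesis
    unfolding has_vector_derivative_quotient_iff
    by (simp add: blinfun.scaleR_right blinfun.diff_right flip: scaleR_add_right)
qed

lemma integral_unit_stretch:
  fixes g :: "real \<Rightarrow> 'a::banach"
  assumes "\<sigma> \<ge> 0"
  shows "integral {0..\<sigma>} g = \<sigma> *\<^sub>R integral {0..1} (\<lambda>\<theta>. g (\<sigma> * \<theta>))"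
proof (cases "\<sigma> = 0")
  case False
  then have "(\<lambda>x. x / \<sigma>) ` {0..\<sigma>} = {0..1}"
    using assms by (auto simp: image_iff divide_simps intro!: bexI[of _ "\<sigma> * x" for x])
  then show ?thesis using integral_stretch_real[of \<sigma> 0 \<sigma> g] False assms by simp
qed simp

text \<open>Rescaling to the unit interval moves the parameter from the limit of integration into
  the integrand.\<close>

lemma continuous_on_volterra_integral:
  fixes k :: "'c::topological_space \<Rightarrow> real \<Rightarrow> 'a::banach"
  assumes g: "continuous_on S g" "\<And>p. p \<in> S \<Longrightarrow> g p \<ge> 0"
    and k: "continuous_on {(p, \<tau>). p \<in> S \<and> 0 \<le> \<tau> \<and> \<tau> \<le> g p} (\<lambda>(p, \<tau>). k p \<tau>)"
  shows "continuous_on S (\<lambda>p. integral {0..g p} (k p))"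
proof -
  have "continuous_on (S \<times> cbox 0 1) ((\<lambda>(p, \<tau>). k p \<tau>) \<circ> (\<lambda>(p, \<theta>). (p, g p * \<theta>)))"
  proof (rule continuous_on_compose)
    show "continuous_on (S \<times> cbox 0 1) (\<lambda>(p, \<theta>). (p, g p * \<theta>))"
      unfolding split_beta
      by (intro continuous_intros continuous_on_compose2[OF g(1)]) auto
    show "continuous_on ((\<lambda>(p, \<theta>). (p, g p * \<theta>)) ` (S \<times> cbox 0 1)) (\<lambda>(p, \<tau>). k p \<tau>)"
      using g(2) by (intro continuous_on_subset[OF k]) (auto simp: mult_left_le)
  qed
  then have "continuous_on S (\<lambda>p. integral (cbox 0 1) (\<lambda>\<theta>. k p (g p * \<theta>)))"
    by (intro integral_continuous_on_param) (simp add: o_def split_beta)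
  then have "continuous_on S (\<lambda>p. g p *\<^sub>R integral {0..1} (\<lambda>\<theta>. k p (g p * \<theta>)))"
    by (intro continuous_intros g) simp
  then show ?thesis
    by (rule continuous_on_eq) (simp add: integral_unit_stretch[OF g(2)])
qed

text \<open>For r < s the increment is \<open>U t s (U s r x - x)\<close>, for r > s it is
  \<open>- U t r (U r s x - x)\<close>. Written with max and min, both sides share one quotient and
  one strongly convergent factor.\<close>

lemma propagator_backward_derivative:
  fixes U :: "real \<Rightarrow> real \<Rightarrow> 'a::real_normed_vector \<Rightarrow>\<^sub>L 'a"
  assumes U: "propagator U" and s: "a \<le> s" "s \<le> t"
    and b: "\<And>r. s \<le> r \<Longrightarrow> r \<le> t \<Longrightarrow> norm (U t r) \<le> C"
    and y: "((\<lambda>r. (1 / \<bar>r - s\<bar>) *\<^sub>R (U (max r s) (min r s) x - x)) \<longlongrightarrow> y) (at s)"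
  shows "((\<lambda>r. U t r x) has_vector_derivative - U t s y) (at s within {a..t})"
proof -
  let ?q = "\<lambda>r. (1 / \<bar>r - s\<bar>) *\<^sub>R (U (max r s) (min r s) x - x)"
  have "((\<lambda>r. U t (max r s) (?q r)) \<longlongrightarrow> U t s y) (at s within {a..t})"
  proof (rule tendsto_blinfun_apply_strong[OF _ _ _ tendsto_const])
    have "continuous_on {a..t} (\<lambda>r. U t (max r s) y)"
      using s by (intro continuous_on_compose2[OF propagator_continuous_snd[OF U]] continuous_intros) auto
    then have "((\<lambda>r. U t (max r s) y) \<longlongrightarrow> U t (max s s) y) (at s within {a..t})"
      using s unfolding continuous_on by (intro bspec[where x = s]) auto
    then show "((\<lambda>r. U t (max r s) y) \<longlongrightarrow> U t s y) (at s within {a..t})" by simp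
    show "(?q \<longlongrightarrow> y) (at s within {a..t})" using y by (rule tendsto_within_subset) auto
    show "\<forall>\<^sub>F r in at s within {a..t}. norm (U t (max r s)) \<le> C"
      unfolding eventually_at_filter using s by (intro always_eventually) (auto intro!: b)
  qed
  then have lim: "((\<lambda>r. - U t (max r s) (?q r)) \<longlongrightarrow> - U t s y) (at s within {a..t})"
    by (rule tendsto_minus)
  have eq: "- U t (max r s) (?q r) = (1 / (r - s)) *\<^sub>R (U t r x - U t s x)"
    if "r \<in> {a..t}" "r \<noteq> s" for r
  proof (cases "r < s")
    case True
    then have "1 / \<bar>r - s\<bar> = - (1 / (r - s))" "max r s = s" "min r s = r"
      by (auto simp: divide_simps)
    then show ?thesis using propagator_comp[OF U, of r s t x] True s
      by (simp only: blinfun.scaleR_right blinfun.diff_right blinfun.minus_right scaleR_minus_left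
          minus_minus less_imp_le simp_thms)
  next
    case False
    then have "1 / \<bar>r - s\<bar> = 1 / (r - s)" "max r s = r" "min r s = s"
      by (auto simp: divide_simps)
    then show ?thesis using propagator_comp[OF U, of s r t x] that False
      by (simp add: blinfun.scaleR_right blinfun.diff_right scaleR_diff_right)
  qed
  have "((\<lambda>r. - U t (max r s) (?q r)) \<longlongrightarrow> - U t s y) (at s within {a..t}) \<longleftrightarrow>
      ((\<lambda>r. (1 / (r - s)) *\<^sub>R (U t r x - U t s x)) \<longlongrightarrow> - U t s y) (at s within {a..t})"
    by (intro Lim_cong_within refl eq)
  with lim show ?thesis unfolding has_vector_derivative_quotient_iff by blast
qed

text \<open>The two terms of the product rule for \<open>V r (p r)\<close> cancel. With V r = U(t,
  r) this identifies classical solutions with orbits of a propagator; with V r = T(t - r) it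
  computes the orbit of an eigenvector of the generator.\<close>

lemma classical_solution_eq:
  fixes V :: "real \<Rightarrow> 'a::real_normed_vector \<Rightarrow>\<^sub>L 'a"
  assumes st: "s \<le> t"
    and cont: "\<And>y. continuous_on {s..t} (\<lambda>r. V r y)"
    and b: "\<And>r. r \<in> {s..t} \<Longrightarrow> norm (V r) \<le> C"
    and V: "\<And>r y. r \<in> {s..t} \<Longrightarrow> y \<in> D \<Longrightarrow>
      ((\<lambda>r. V r y) has_vector_derivative - V r (F r y)) (at r within {s..t})"
    and p: "\<And>r. r \<in> {s..t} \<Longrightarrow> p r \<in> D"
      "\<And>r. r \<in> {s..t} \<Longrightarrow> (p has_vector_derivative F r (p r)) (at r within {s..t})"
  shows "V t (p t) = V s (p s)"
proof -
  have "((\<lambda>r. V r (p r)) has_vector_derivative 0) (at r within {s..t})" if r: "r \<in> {s..t}" for r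
  proof -
    have "((\<lambda>q. V q (F r (p r))) \<longlongrightarrow> V r (F r (p r))) (at r within {s..t})"
      using cont r by (auto simp: continuous_on)
    from has_vector_derivative_blinfun_apply_strong[OF p(2)[OF r] V[OF r p(1)[OF r]] this b]
    show ?thesis by simp
  qed
  then obtain c where "\<And>r. r \<in> {s..t} \<Longrightarrow> V r (p r) = c"
    using has_vector_derivative_zero_constant[of "{s..t}" "\<lambda>r. V r (p r)"] by auto
  then show ?thesis using st by simp
qed

subsection \<open>Mild solutions for bounded perturbations\<close>

locale bounded_c0_semigroup =
  fixes T :: "real \<Rightarrow> 'a::banach \<Rightarrow>\<^sub>L 'a" and M \<omega> :: real
  assumes C0: "C0_semigroup T"
    and norm_T: "t \<ge> 0 \<Longrightarrow> norm (T t) \<le> M * exp (\<omega> * t)"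
begin

lemma T_0 [simp]: "T 0 x = x"
  using C0 by (simp add: C0_semigroup_def)

lemma T_add: "0 \<le> s \<Longrightarrow> 0 \<le> t \<Longrightarrow> T t (T s x) = T (t + s) x"
  using C0 unfolding C0_semigroup_def by (metis blinfun_apply_blinfun_compose)

lemma M_nonneg: "0 \<le> M"
  using order_trans[OF norm_ge_zero norm_T[of 0]] by simp

lemma norm_T_apply: "t \<ge> 0 \<Longrightarrow> norm (T t x) \<le> M * exp (\<omega> * t) * norm x"
  by (intro order_trans[OF norm_blinfun] mult_right_mono norm_T) auto

lemma continuous_on_T:
  assumes "continuous_on S g" "\<And>z. z \<in> S \<Longrightarrow> g z \<ge> 0" "continuous_on S f"
  shows "continuous_on S (\<lambda>z. T (g z) (f z))"
proof (rule continuous_on_blinfun_apply_strong[where X = "{0..}" and C = "\<lambda>t. M * exp (\<omega> * t)"])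
  show "continuous_on {0..} (\<lambda>t. T t x)" for x
    using C0 by (auto simp: C0_semigroup_def)
qed (use assms norm_T in \<open>auto intro!: continuous_intros\<close>)

lemma propagator_semigroup: "propagator (\<lambda>t s. T (t - s))"
  unfolding propagator_def
proof (intro conjI allI impI)
  show "T (t - t) = id_blinfun" for t using C0 by (simp add: C0_semigroup_def)
  show "T (t - s) o\<^sub>L T (s - r) = T (t - r)" if "r \<le> s \<and> s \<le> t" for r s t
    using that by (intro blinfun_eqI) (simp add: T_add)
  show "continuous_on {(t, s). s \<le> t} (\<lambda>(t, s). T (t - s) x)" for x
    unfolding split_beta by (intro continuous_on_T continuous_intros) auto
qed

end

text \<open>The exponent \<open>\<kappa>\<close> exceeds \<open>\<omega>\<close> so much that, in the norm weighted by \<open>exp (- \<kappa> * t)\<close>, the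
  Volterra operator of the perturbation is a contraction with constant \<open>1 / 2\<close>.\<close>

locale bounded_perturbation = bounded_c0_semigroup T M \<omega>
  for T :: "real \<Rightarrow> 'a::banach \<Rightarrow>\<^sub>L 'a" and M \<omega> :: real +
  fixes B :: "real \<Rightarrow> 'a \<Rightarrow>\<^sub>L 'a" and \<delta> \<kappa> :: real
  assumes B_cont: "continuous_on UNIV (\<lambda>t. B t x)"
    and norm_B: "norm (B t) \<le> \<delta>"
    and \<kappa>: "\<kappa> > \<omega>" "2 * M * \<delta> \<le> \<kappa> - \<omega>"
begin

lemma \<delta>_nonneg: "0 \<le> \<delta>"
  using order_trans[OF norm_ge_zero norm_B] .

lemma continuous_on_B:
  assumes "continuous_on S g" "continuous_on S f"
  shows "continuous_on S (\<lambda>z. B (g z) (f z))"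
  by (rule continuous_on_blinfun_apply_strong[where X = UNIV and C = "\<lambda>_. \<delta>"])
    (use assms norm_B B_cont in \<open>auto intro!: continuous_intros\<close>)

text \<open>The Volterra term in the elapsed time since s, which makes the starting time a mere
  parameter.\<close>

definition conv :: "real \<Rightarrow> (real \<Rightarrow> 'a) \<Rightarrow> real \<Rightarrow> 'a" where
  "conv s u \<sigma> = integral {0..\<sigma>} (\<lambda>\<tau>. T (\<sigma> - \<tau>) (B (s + \<tau>) (u \<tau>)))"

lemma continuous_conv_integrand:
  assumes "continuous_on {0..\<sigma>} u"
  shows "continuous_on {0..\<sigma>} (\<lambda>\<tau>. T (\<sigma> - \<tau>) (B (s + \<tau>) (u \<tau>)))"
  by (intro continuous_on_T continuous_on_B continuous_intros assms) auto

lemma conv_diff: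
  assumes "continuous_on {0..\<sigma>} u" "continuous_on {0..\<sigma>} v"
  shows "conv s u \<sigma> - conv s v \<sigma> = conv s (\<lambda>\<tau>. u \<tau> - v \<tau>) \<sigma>"
  unfolding conv_def blinfun.diff_right
  by (intro integral_diff[symmetric] integrable_continuous_real continuous_conv_integrand assms)

text \<open>The integral of exp (\<omega> (\<sigma> - \<tau>)) exp (\<kappa> \<tau>) is at most exp
  (\<kappa> \<sigma>) / (\<kappa> - \<omega>). The factor stays explicit because it is proportional
  to \<open>\<delta>\<close>, which later makes \<open>U\<close> close to \<open>T\<close>.\<close>

lemma norm_conv:
  assumes \<sigma>: "0 \<le> \<sigma>" and u: "continuous_on {0..\<sigma>} u"
    and b: "\<And>\<tau>. 0 \<le> \<tau> \<Longrightarrow> \<tau> \<le> \<sigma> \<Longrightarrow> norm (u \<tau>) \<le> c * exp (\<kappa> * \<tau>)"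
  shows "norm (conv s u \<sigma>) \<le> M * \<delta> / (\<kappa> - \<omega>) * c * exp (\<kappa> * \<sigma>)"
proof -
  have c: "0 \<le> c" using order_trans[OF norm_ge_zero b[of 0]] \<sigma> by simp
  let ?k = "\<kappa> - \<omega>"
  have k: "?k > 0" using \<kappa> by simp
  have int: "((\<lambda>\<tau>. exp (?k * \<tau>)) has_integral (exp (?k * \<sigma>) / ?k - exp (?k * 0) / ?k)) {0..\<sigma>}"
    using \<sigma> k by (intro fundamental_theorem_of_calculus)
      (auto intro!: derivative_eq_intros simp flip: has_real_derivative_iff_has_vector_derivative)
  have "norm (conv s u \<sigma>) \<le> integral {0..\<sigma>} (\<lambda>\<tau>. (M * \<delta> * c * exp (\<omega> * \<sigma>)) * exp (?k * \<tau>))"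
    unfolding conv_def
  proof (rule integral_norm_bound_integral)
    show "(\<lambda>\<tau>. T (\<sigma> - \<tau>) (B (s + \<tau>) (u \<tau>))) integrable_on {0..\<sigma>}"
      by (intro integrable_continuous_real continuous_conv_integrand u)
    show "(\<lambda>\<tau>. (M * \<delta> * c * exp (\<omega> * \<sigma>)) * exp (?k * \<tau>)) integrable_on {0..\<sigma>}"
      by (intro integrable_continuous_real continuous_intros)
    fix \<tau> assume \<tau>: "\<tau> \<in> {0..\<sigma>}"
    have "norm (T (\<sigma> - \<tau>) (B (s + \<tau>) (u \<tau>))) \<le> M * exp (\<omega> * (\<sigma> - \<tau>)) * norm (B (s + \<tau>) (u \<tau>))"
      using \<tau> by (intro norm_T_apply) auto
    also have "\<dots> \<le> M * exp (\<omega> * (\<sigma> - \<tau>)) * (\<delta> * (c * exp (\<kappa> * \<tau>)))"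
      using \<tau> by (intro mult_left_mono order_trans[OF norm_blinfun] mult_mono norm_B b)
        (auto simp: M_nonneg \<delta>_nonneg)
    also have "\<dots> = (M * \<delta> * c) * (exp (\<omega> * (\<sigma> - \<tau>)) * exp (\<kappa> * \<tau>))" by (simp only: mult_ac)
    also have "exp (\<omega> * (\<sigma> - \<tau>)) * exp (\<kappa> * \<tau>) = exp (\<omega> * \<sigma>) * exp (?k * \<tau>)"
      by (simp add: algebra_simps flip: exp_add)
    finally show "norm (T (\<sigma> - \<tau>) (B (s + \<tau>) (u \<tau>))) \<le> (M * \<delta> * c * exp (\<omega> * \<sigma>)) * exp (?k * \<tau>)"
      by (simp only: mult_ac)
  qed
  also have "\<dots> = (M * \<delta> * c * exp (\<omega> * \<sigma>)) * (exp (?k * \<sigma>) / ?k - exp (?k * 0) / ?k)"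
    using integral_unique[OF int] by simp
  also have "\<dots> \<le> (M * \<delta> * c * exp (\<omega> * \<sigma>)) * (exp (?k * \<sigma>) / ?k)"
    using k c by (intro mult_left_mono) (auto simp: M_nonneg \<delta>_nonneg)
  also have "\<dots> = M * \<delta> / ?k * c * (exp (\<omega> * \<sigma>) * exp (?k * \<sigma>))"
    by simp
  also have "exp (\<omega> * \<sigma>) * exp (?k * \<sigma>) = exp (\<kappa> * \<sigma>)" by (simp add: algebra_simps flip: exp_add)
  finally show ?thesis .
qed

lemma contraction_constant: "0 \<le> M * \<delta> / (\<kappa> - \<omega>)" "M * \<delta> / (\<kappa> - \<omega>) \<le> 1 / 2"
  using \<kappa> M_nonneg \<delta>_nonneg by (auto simp: field_simps)

lemma norm_conv_half:
  assumes "0 \<le> \<sigma>" "continuous_on {0..\<sigma>} u"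
    "\<And>\<tau>. 0 \<le> \<tau> \<Longrightarrow> \<tau> \<le> \<sigma> \<Longrightarrow> norm (u \<tau>) \<le> c * exp (\<kappa> * \<tau>)"
  shows "norm (conv s u \<sigma>) \<le> c / 2 * exp (\<kappa> * \<sigma>)"
proof -
  have c: "0 \<le> c" using order_trans[OF norm_ge_zero assms(3)[of 0]] assms(1) by simp
  have "norm (conv s u \<sigma>) \<le> M * \<delta> / (\<kappa> - \<omega>) * c * exp (\<kappa> * \<sigma>)" by (rule norm_conv[OF assms])
  also have "\<dots> \<le> 1 / 2 * c * exp (\<kappa> * \<sigma>)"
    by (intro mult_right_mono contraction_constant c) auto
  finally show ?thesis by simp
qed

text \<open>Gronwall by a weighted maximum: if c is the maximum of exp (- \<kappa> \<sigma>) |u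
  \<sigma>|, the mild equation at a maximal point gives c \<le> M |x| + c / 2.\<close>

lemma mild_bound:
  assumes L: "0 \<le> L" and u: "continuous_on {0..L} u"
    and mild: "\<And>\<sigma>. 0 \<le> \<sigma> \<Longrightarrow> \<sigma> \<le> L \<Longrightarrow> u \<sigma> = T \<sigma> x + conv s u \<sigma>"
    and \<sigma>: "0 \<le> \<sigma>" "\<sigma> \<le> L"
  shows "norm (u \<sigma>) \<le> 2 * M * norm x * exp (\<kappa> * \<sigma>)"
proof -
  have "continuous_on {0..L} (\<lambda>\<sigma>. exp (- \<kappa> * \<sigma>) * norm (u \<sigma>))"
    by (intro continuous_intros u)
  then obtain r where r: "r \<in> {0..L}"
    "\<And>\<sigma>. \<sigma> \<in> {0..L} \<Longrightarrow> exp (- \<kappa> * \<sigma>) * norm (u \<sigma>) \<le> exp (- \<kappa> * r) * norm (u r)"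
    using continuous_attains_sup[of "{0..L}" "\<lambda>\<sigma>. exp (- \<kappa> * \<sigma>) * norm (u \<sigma>)"] L by auto
  define c where "c = exp (- \<kappa> * r) * norm (u r)"
  have c: "norm (u \<tau>) \<le> c * exp (\<kappa> * \<tau>)" if "0 \<le> \<tau>" "\<tau> \<le> L" for \<tau>
    using r(2)[of \<tau>] that by (simp add: c_def exp_minus field_simps)
  have "norm (u r) \<le> norm (T r x) + norm (conv s u r)"
    using mild[of r] r(1) norm_triangle_ineq by simp
  also have "\<dots> \<le> M * exp (\<kappa> * r) * norm x + c / 2 * exp (\<kappa> * r)"
  proof (rule add_mono)
    have "norm (T r x) \<le> M * exp (\<omega> * r) * norm x" using r(1) by (intro norm_T_apply) auto
    also have "\<dots> \<le> M * exp (\<kappa> * r) * norm x"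
      using r(1) \<kappa>(1) by (intro mult_right_mono mult_left_mono) (auto simp: M_nonneg intro: mult_right_mono)
    finally show "norm (T r x) \<le> M * exp (\<kappa> * r) * norm x" .
    show "norm (conv s u r) \<le> c / 2 * exp (\<kappa> * r)"
      using r(1) by (intro norm_conv_half continuous_on_subset[OF u] c) auto
  qed
  finally have "norm (u r) \<le> (M * norm x + c / 2) * exp (\<kappa> * r)" by (simp add: algebra_simps)
  then have "c \<le> exp (- \<kappa> * r) * ((M * norm x + c / 2) * exp (\<kappa> * r))"
    by (subst c_def) (intro mult_left_mono, auto)
  also have "\<dots> = (M * norm x + c / 2) * (exp (- \<kappa> * r) * exp (\<kappa> * r))" by (simp only: mult_ac)
  also have "exp (- \<kappa> * r) * exp (\<kappa> * r) = 1" by (simp flip: exp_add)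
  finally have "c \<le> M * norm x + c / 2" by simp
  then have "c \<le> 2 * M * norm x" by simp
  then have "c * exp (\<kappa> * \<sigma>) \<le> 2 * M * norm x * exp (\<kappa> * \<sigma>)" by (intro mult_right_mono) auto
  with c[OF \<sigma>] show ?thesis by linarith
qed

lemma mild_unique:
  assumes L: "0 \<le> L" and u: "continuous_on {0..L} u" and v: "continuous_on {0..L} v"
    and mu: "\<And>\<sigma>. 0 \<le> \<sigma> \<Longrightarrow> \<sigma> \<le> L \<Longrightarrow> u \<sigma> = T \<sigma> x + conv s u \<sigma>"
    and mv: "\<And>\<sigma>. 0 \<le> \<sigma> \<Longrightarrow> \<sigma> \<le> L \<Longrightarrow> v \<sigma> = T \<sigma> x + conv s v \<sigma>"
  shows "u L = v L"
proof -
  have "norm (u L - v L) \<le> 2 * M * norm (0 :: 'a) * exp (\<kappa> * L)"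
  proof (rule mild_bound[where s = s and L = L])
    show "continuous_on {0..L} (\<lambda>\<sigma>. u \<sigma> - v \<sigma>)" by (intro continuous_intros u v)
    fix \<sigma> assume \<sigma>: "0 \<le> \<sigma>" "\<sigma> \<le> L"
    have "u \<sigma> - v \<sigma> = conv s u \<sigma> - conv s v \<sigma>" using mu[OF \<sigma>] mv[OF \<sigma>] by simp
    also have "\<dots> = conv s (\<lambda>\<sigma>. u \<sigma> - v \<sigma>) \<sigma>"
      using \<sigma> by (intro conv_diff continuous_on_subset[OF u] continuous_on_subset[OF v]) auto
    finally show "u \<sigma> - v \<sigma> = T \<sigma> 0 + conv s (\<lambda>\<sigma>. u \<sigma> - v \<sigma>) \<sigma>" by simp
  qed (use L in auto)
  then show ?thesis by simp
qed

text \<open>The fixed point is taken over elapsed time and starting time together, which yields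
  joint continuity at once; \<open>max 0\<close> extends the equation to negative elapsed times so
  that it lives on the whole plane.\<close>

lemma mild_exists:
  "\<exists>u. continuous_on UNIV (\<lambda>(\<sigma>, s). u \<sigma> s) \<and>
     (\<forall>\<sigma> s. 0 \<le> \<sigma> \<longrightarrow> u \<sigma> s = T \<sigma> x + conv s (\<lambda>\<tau>. u \<tau> s) \<sigma>)"
proof -
  define \<Phi> where "\<Phi> z = (\<lambda>p. T (max 0 (fst p)) x + conv (snd p) (\<lambda>\<tau>. z (\<tau>, snd p)) (max 0 (fst p)))"
    for z :: "real \<times> real \<Rightarrow> 'a"
  define \<rho> where "\<rho> p = exp (\<kappa> * max 0 (fst p))" for p :: "real \<times> real"
  obtain z where z: "continuous_on UNIV z" "\<Phi> z = z"
  proof (rule weighted_banach_fix[of \<rho> \<Phi> "M * norm x"])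
    show "continuous_on UNIV \<rho>" unfolding \<rho>_def by (intro continuous_intros)
    show "\<rho> p > 0" for p by (simp add: \<rho>_def)
    show "continuous_on UNIV (\<Phi> z)" if z: "continuous_on UNIV z" for z
    proof -
      have "continuous_on UNIV (\<lambda>p. conv (snd p) (\<lambda>\<tau>. z (\<tau>, snd p)) (max 0 (fst p)))"
        unfolding conv_def
      proof (rule continuous_on_volterra_integral)
        show "continuous_on {(p, \<tau>). p \<in> UNIV \<and> 0 \<le> \<tau> \<and> \<tau> \<le> max 0 (fst p)}
          (\<lambda>(p, \<tau>). T (max 0 (fst p) - \<tau>) (B (snd p + \<tau>) (z (\<tau>, snd p))))"
          unfolding split_beta
          by (intro continuous_on_T continuous_on_B continuous_on_compose2[OF z] continuous_intros) auto
      qed (auto intro!: continuous_intros)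
      then show ?thesis
        unfolding \<Phi>_def by (intro continuous_on_add continuous_on_T continuous_intros) auto
    qed
    show "norm (\<Phi> (\<lambda>_. 0) p) \<le> M * norm x * \<rho> p" for p
    proof -
      let ?r = "max 0 (fst p)"
      have "norm (T ?r x) \<le> M * exp (\<omega> * ?r) * norm x" by (intro norm_T_apply) auto
      also have "\<dots> \<le> M * exp (\<kappa> * ?r) * norm x"
        using \<kappa>(1) by (intro mult_right_mono mult_left_mono) (auto simp: M_nonneg intro: mult_right_mono)
      finally show ?thesis by (simp add: \<Phi>_def \<rho>_def conv_def mult_ac)
    qed
    fix z z' :: "real \<times> real \<Rightarrow> 'a" and c and p :: "real \<times> real"
    assume zz: "continuous_on UNIV z" "continuous_on UNIV z'"
      and d: "\<And>y. norm (z y - z' y) \<le> c * \<rho> y"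
    let ?r = "max 0 (fst p)"
    have cz: "continuous_on {0..?r} (\<lambda>\<tau>. w (\<tau>, snd p))" if "continuous_on UNIV w" for w :: "real \<times> real \<Rightarrow> 'a"
      by (intro continuous_on_compose2[OF that] continuous_intros) auto
    have "\<Phi> z p - \<Phi> z' p = conv (snd p) (\<lambda>\<tau>. z (\<tau>, snd p) - z' (\<tau>, snd p)) ?r"
      unfolding \<Phi>_def using conv_diff[OF cz[OF zz(1)] cz[OF zz(2)]] by simp
    also have "norm \<dots> \<le> c / 2 * exp (\<kappa> * ?r)"
    proof (rule norm_conv_half)
      show "continuous_on {0..?r} (\<lambda>\<tau>. z (\<tau>, snd p) - z' (\<tau>, snd p))"
        by (intro continuous_on_diff cz zz)
      show "norm (z (\<tau>, snd p) - z' (\<tau>, snd p)) \<le> c * exp (\<kappa> * \<tau>)" if "0 \<le> \<tau>" for \<tau>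
        using d[of "(\<tau>, snd p)"] that by (simp add: \<rho>_def)
    qed auto
    finally show "norm (\<Phi> z p - \<Phi> z' p) \<le> c / 2 * \<rho> p" by (simp add: \<rho>_def)
  qed
  show ?thesis
  proof (intro exI[of _ "\<lambda>\<sigma> s. z (\<sigma>, s)"] conjI allI impI)
    show "continuous_on UNIV (\<lambda>(\<sigma>, s). z (\<sigma>, s))" using z(1) by simp
    show "z (\<sigma>, s) = T \<sigma> x + conv s (\<lambda>\<tau>. z (\<tau>, s)) \<sigma>" if "0 \<le> \<sigma>" for \<sigma> s
      using fun_cong[OF z(2), of "(\<sigma>, s)"] that by (simp add: \<Phi>_def)
  qed
qed

definition sol :: "'a \<Rightarrow> real \<Rightarrow> real \<Rightarrow> 'a" where
  "sol x = (SOME u. continuous_on UNIV (\<lambda>(\<sigma>, s). u \<sigma> s) \<and>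
     (\<forall>\<sigma> s. 0 \<le> \<sigma> \<longrightarrow> u \<sigma> s = T \<sigma> x + conv s (\<lambda>\<tau>. u \<tau> s) \<sigma>))"

lemma continuous_on_sol_pair: "continuous_on UNIV (\<lambda>(\<sigma>, s). sol x \<sigma> s)"
  and sol: "0 \<le> \<sigma> \<Longrightarrow> sol x \<sigma> s = T \<sigma> x + conv s (\<lambda>\<tau>. sol x \<tau> s) \<sigma>"
  using someI_ex[OF mild_exists[of x]] unfolding sol_def[symmetric] by auto

lemma continuous_on_sol:
  assumes "continuous_on S f" "continuous_on S g"
  shows "continuous_on S (\<lambda>z. sol x (f z) (g z))"
  using continuous_on_compose2[OF continuous_on_sol_pair[of x], of S "\<lambda>z. (f z, g z)"] assms
  by (simp add: continuous_on_Pair)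

lemma norm_sol: "0 \<le> \<sigma> \<Longrightarrow> norm (sol x \<sigma> s) \<le> 2 * M * norm x * exp (\<kappa> * \<sigma>)"
  by (rule mild_bound[where L = \<sigma> and s = s]) (auto intro!: continuous_on_sol continuous_intros sol)

section \<open>The propagator of the perturbed equation\<close>

definition U :: "real \<Rightarrow> real \<Rightarrow> 'a \<Rightarrow>\<^sub>L 'a" where
  "U t s = Blinfun (\<lambda>x. sol x (t - s) s)"

lemma U_apply:
  assumes "s \<le> t"
  shows "U t s x = sol x (t - s) s"
proof -
  have "bounded_linear (\<lambda>x. sol x (t - s) s)"
  proof (rule bounded_linear_intro)
    show "sol (x + y) (t - s) s = sol x (t - s) s + sol y (t - s) s" for x y
    proof (rule mild_unique[where x = "x + y" and s = s and L = "t - s" and v = "\<lambda>\<sigma>. sol x \<sigma> s + sol y \<sigma> s"])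
      fix \<sigma> :: real assume \<sigma>: "0 \<le> \<sigma>"
      have "conv s (\<lambda>\<sigma>. sol x \<sigma> s) \<sigma> + conv s (\<lambda>\<sigma>. sol y \<sigma> s) \<sigma> = conv s (\<lambda>\<sigma>. sol x \<sigma> s + sol y \<sigma> s) \<sigma>"
        unfolding conv_def blinfun.add_right
        by (intro integral_add[symmetric] integrable_continuous_real continuous_conv_integrand
            continuous_on_sol continuous_intros)
      then show "sol x \<sigma> s + sol y \<sigma> s = T \<sigma> (x + y) + conv s (\<lambda>\<sigma>. sol x \<sigma> s + sol y \<sigma> s) \<sigma>"
        using sol[OF \<sigma>, of x s] sol[OF \<sigma>, of y s] by (simp add: blinfun.add_right)
    qed (use assms in \<open>auto intro!: continuous_on_sol continuous_intros sol\<close>)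
    show "sol (c *\<^sub>R x) (t - s) s = c *\<^sub>R sol x (t - s) s" for c x
    proof (rule mild_unique[where x = "c *\<^sub>R x" and s = s and L = "t - s" and v = "\<lambda>\<sigma>. c *\<^sub>R sol x \<sigma> s"])
      fix \<sigma> :: real assume \<sigma>: "0 \<le> \<sigma>"
      have "c *\<^sub>R conv s (\<lambda>\<sigma>. sol x \<sigma> s) \<sigma> = conv s (\<lambda>\<sigma>. c *\<^sub>R sol x \<sigma> s) \<sigma>"
        unfolding conv_def blinfun.scaleR_right by simp
      then show "c *\<^sub>R sol x \<sigma> s = T \<sigma> (c *\<^sub>R x) + conv s (\<lambda>\<sigma>. c *\<^sub>R sol x \<sigma> s) \<sigma>"
        using sol[OF \<sigma>, of x s] by (simp add: blinfun.scaleR_right scaleR_add_right)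
    qed (use assms in \<open>auto intro!: continuous_on_sol continuous_intros sol\<close>)
    show "norm (sol x (t - s) s) \<le> norm x * (2 * M * exp (\<kappa> * (t - s)))" for x
      using norm_sol[of "t - s" x s] assms by (simp add: mult_ac)
  qed
  then show ?thesis by (simp add: U_def bounded_linear_Blinfun_apply)
qed

lemma norm_U: "s \<le> t \<Longrightarrow> norm (U t s) \<le> 2 * M * exp (\<kappa> * (t - s))"
  using norm_sol[of "t - s" _ s] M_nonneg
  by (intro norm_blinfun_bound) (auto simp: U_apply mult_ac)

lemma propagator_U: "propagator U"
  unfolding propagator_def
proof (intro conjI allI impI)
  show "U t t = id_blinfun" for t
    by (intro blinfun_eqI) (simp add: U_apply sol conv_def)
  show "continuous_on {(t, s). s \<le> t} (\<lambda>(t, s). U t s x)" for x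
  proof -
    have "continuous_on {(t, s). s \<le> t} (\<lambda>(t, s). sol x (t - s) s)"
      unfolding split_beta by (intro continuous_on_sol continuous_intros)
    then show ?thesis by (rule continuous_on_eq) (auto simp: U_apply)
  qed
  fix r s t :: real assume rst: "r \<le> s \<and> s \<le> t"
  show "U t s o\<^sub>L U s r = U t r"
  proof (rule blinfun_eqI)
    fix x
    let ?y = "sol x (s - r) r"
    \<comment> \<open>Both sides are mild solutions from time s with initial value
      \<open>?y\<close>: the integral up to s becomes \<open>T \<sigma>\<close> of the integral
      contained in \<open>?y\<close>, and the rest is a shifted convolution.\<close>
    have "sol x (s - r + (t - s)) r = sol ?y (t - s) s"
    proof (rule mild_unique[where s = s and x = ?y and L = "t - s" and u = "\<lambda>\<sigma>. sol x (s - r + \<sigma>) r"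
          and v = "\<lambda>\<sigma>. sol ?y \<sigma> s"])
      fix \<sigma> :: real assume \<sigma>: "0 \<le> \<sigma>" "\<sigma> \<le> t - s"
      let ?a = "s - r"
      let ?k = "\<lambda>b \<tau>. T (b - \<tau>) (B (r + \<tau>) (sol x \<tau> r))"
      have ck: "continuous_on {0..b} (?k b)" for b
        by (intro continuous_conv_integrand continuous_on_sol continuous_intros)
      have 1: "integral {0..?a} (?k (?a + \<sigma>)) = T \<sigma> (integral {0..?a} (?k ?a))"
      proof -
        have "integral {0..?a} (?k (?a + \<sigma>)) = integral {0..?a} (T \<sigma> \<circ> ?k ?a)"
          using \<sigma> by (intro integral_cong) (simp add: T_add algebra_simps)
        also have "\<dots> = T \<sigma> (integral {0..?a} (?k ?a))"
          by (intro integral_linear integrable_continuous_real ck blinfun.bounded_linear_right)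
        finally show ?thesis .
      qed
      have 2: "integral {?a..?a + \<sigma>} (?k (?a + \<sigma>)) = conv s (\<lambda>\<tau>. sol x (?a + \<tau>) r) \<sigma>"
        using integral_shift_Icc_real[of 0 \<sigma> "?k (?a + \<sigma>)" ?a]
        by (simp add: conv_def o_def algebra_simps)
      have "sol x (?a + \<sigma>) r = T (?a + \<sigma>) x + integral {0..?a + \<sigma>} (?k (?a + \<sigma>))"
        using rst \<sigma> by (subst sol) (auto simp: conv_def)
      also have "integral {0..?a + \<sigma>} (?k (?a + \<sigma>)) =
          integral {0..?a} (?k (?a + \<sigma>)) + integral {?a..?a + \<sigma>} (?k (?a + \<sigma>))"
        using rst \<sigma> by (intro Henstock_Kurzweil_Integration.integral_combine[symmetric]
            integrable_continuous_real ck) auto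
      also have "T (?a + \<sigma>) x = T \<sigma> (T ?a x)" using rst \<sigma> by (simp add: T_add add.commute)
      finally show "sol x (?a + \<sigma>) r = T \<sigma> ?y + conv s (\<lambda>\<tau>. sol x (?a + \<tau>) r) \<sigma>"
        using rst unfolding 1 2 by (simp add: sol[of ?a] blinfun.add_right conv_def)
    qed (use rst in \<open>auto intro!: continuous_on_sol continuous_intros sol\<close>)
    then show "(U t s o\<^sub>L U s r) x = U t r x" using rst by (simp add: U_apply)
  qed
qed

lemma norm_U_minus_T:
  assumes "0 \<le> \<sigma>"
  shows "norm (U (s + \<sigma>) s - T \<sigma>) \<le> M * \<delta> / (\<kappa> - \<omega>) * (2 * M) * exp (\<kappa> * \<sigma>)"
proof (rule norm_blinfun_bound)
  show "0 \<le> M * \<delta> / (\<kappa> - \<omega>) * (2 * M) * exp (\<kappa> * \<sigma>)"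
    using contraction_constant M_nonneg by (intro mult_nonneg_nonneg) auto
  fix x
  have "norm (conv s (\<lambda>\<tau>. sol x \<tau> s) \<sigma>) \<le> M * \<delta> / (\<kappa> - \<omega>) * (2 * M * norm x) * exp (\<kappa> * \<sigma>)"
    by (intro norm_conv assms continuous_on_sol continuous_intros norm_sol)
  then show "norm ((U (s + \<sigma>) s - T \<sigma>) x) \<le> M * \<delta> / (\<kappa> - \<omega>) * (2 * M) * exp (\<kappa> * \<sigma>) * norm x"
    using assms by (simp add: blinfun.diff_left U_apply sol mult_ac)
qed

text \<open>Divided by the elapsed time, the Volterra term is an average over the unit interval,
  continuous in r up to r = s with value \<open>B s x\<close> there. Using |r - s| and min r s
  treats both sides at once.\<close>

lemma U_quotient:
  assumes y: "((\<lambda>h. (1 / h) *\<^sub>R (T h x - x)) \<longlongrightarrow> y) (at_right 0)"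
  shows "((\<lambda>r. (1 / \<bar>r - s\<bar>) *\<^sub>R (U (max r s) (min r s) x - x)) \<longlongrightarrow> y + B s x) (at s)"
proof -
  define I where "I \<sigma> q = integral (cbox 0 1) (\<lambda>\<theta>. T (\<sigma> - \<sigma> * \<theta>) (B (q + \<sigma> * \<theta>) (sol x (\<sigma> * \<theta>) q)))"
    for \<sigma> q
  have "continuous_on UNIV (\<lambda>r. I \<bar>r - s\<bar> (min r s))"
    unfolding I_def
  proof (rule integral_continuous_on_param)
    show "continuous_on (UNIV \<times> cbox 0 1) (\<lambda>(r, \<theta>). T (\<bar>r - s\<bar> - \<bar>r - s\<bar> * \<theta>)
        (B (min r s + \<bar>r - s\<bar> * \<theta>) (sol x (\<bar>r - s\<bar> * \<theta>) (min r s))))"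
      unfolding split_beta
      by (intro continuous_on_T continuous_on_B continuous_on_sol continuous_intros)
        (auto simp: mult_left_le)
  qed
  then have "((\<lambda>r. I \<bar>r - s\<bar> (min r s)) \<longlongrightarrow> I \<bar>s - s\<bar> (min s s)) (at s)"
    unfolding continuous_on by blast
  moreover have "I 0 s = B s x" by (simp add: I_def sol conv_def)
  ultimately have I: "((\<lambda>r. I \<bar>r - s\<bar> (min r s)) \<longlongrightarrow> B s x) (at s)" by simp
  have "filterlim (\<lambda>r. \<bar>r - s\<bar>) (at_right 0) (at s)"
  proof -
    have "((\<lambda>r. \<bar>r - s\<bar>) \<longlongrightarrow> \<bar>s - s\<bar>) (at s)" by (intro tendsto_intros)
    then show ?thesis by (auto simp: filterlim_at eventually_at_filter)
  qed
  from tendsto_add[OF filterlim_compose[OF y this] I]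
  have "((\<lambda>r. (1 / \<bar>r - s\<bar>) *\<^sub>R (T \<bar>r - s\<bar> x - x) + I \<bar>r - s\<bar> (min r s)) \<longlongrightarrow> y + B s x) (at s)" .
  moreover have "(1 / \<bar>r - s\<bar>) *\<^sub>R (T \<bar>r - s\<bar> x - x) + I \<bar>r - s\<bar> (min r s) =
      (1 / \<bar>r - s\<bar>) *\<^sub>R (U (max r s) (min r s) x - x)" if "r \<noteq> s" for r
  proof -
    have m: "max r s - min r s = \<bar>r - s\<bar>" by (auto simp: max_def min_def)
    have "conv (min r s) (\<lambda>\<tau>. sol x \<tau> (min r s)) \<bar>r - s\<bar> = \<bar>r - s\<bar> *\<^sub>R I \<bar>r - s\<bar> (min r s)"
      unfolding conv_def I_def by (subst integral_unit_stretch) auto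
    then have q: "U (max r s) (min r s) x - x = (T \<bar>r - s\<bar> x - x) + \<bar>r - s\<bar> *\<^sub>R I \<bar>r - s\<bar> (min r s)"
      by (simp add: U_apply m sol)
    show ?thesis using that unfolding q scaleR_add_right by simp
  qed
  ultimately show ?thesis by (subst (asm) Lim_cong_within[OF refl refl refl]) auto
qed

end

subsection \<open>Generators\<close>

locale generated_semigroup = bounded_c0_semigroup T M \<omega>
  for T :: "real \<Rightarrow> 'a::banach \<Rightarrow>\<^sub>L 'a" and M \<omega> :: real +
  fixes D :: "'a set" and A :: "'a \<Rightarrow> 'a"
  assumes gen: "semigroup_generator T D A"
begin

lemma generator_tendsto: "x \<in> D \<Longrightarrow> ((\<lambda>h. (1 / h) *\<^sub>R (T h x - x)) \<longlongrightarrow> A x) (at_right 0)"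
  using gen by (auto simp: semigroup_generator_def)

lemma generator_eqI:
  assumes "((\<lambda>h. (1 / h) *\<^sub>R (T h x - x)) \<longlongrightarrow> y) (at_right 0)"
  shows "x \<in> D" "A x = y"
proof -
  show "x \<in> D" using gen assms by (auto simp: semigroup_generator_def)
  from tendsto_unique[OF _ generator_tendsto[OF this] assms] show "A x = y" by simp
qed

lemma generator_add:
  assumes "x \<in> D" "y \<in> D"
  shows "x + y \<in> D" "A (x + y) = A x + A y"
proof -
  from tendsto_add[OF assms[THEN generator_tendsto]]
  have "((\<lambda>h. (1 / h) *\<^sub>R (T h (x + y) - (x + y))) \<longlongrightarrow> A x + A y) (at_right 0)"
    by (simp add: blinfun.add_right add_diff_add flip: scaleR_add_right)
  then show "x + y \<in> D" "A (x + y) = A x + A y" by (fact generator_eqI)+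
qed

lemma generator_scale:
  assumes "x \<in> D"
  shows "c *\<^sub>R x \<in> D" "A (c *\<^sub>R x) = c *\<^sub>R A x"
proof -
  from tendsto_scaleR[OF tendsto_const[of c] generator_tendsto[OF assms]]
  have "((\<lambda>h. (1 / h) *\<^sub>R (T h (c *\<^sub>R x) - c *\<^sub>R x)) \<longlongrightarrow> c *\<^sub>R A x) (at_right 0)"
    by (simp add: blinfun.scaleR_right scaleR_diff_right mult.commute)
  then show "c *\<^sub>R x \<in> D" "A (c *\<^sub>R x) = c *\<^sub>R A x" by (fact generator_eqI)+
qed

lemma generator_diff:
  assumes "x \<in> D" "y \<in> D"
  shows "x - y \<in> D" "A (x - y) = A x - A y"
  using generator_add[OF assms(1) generator_scale(1)[OF assms(2), of "-1"]] generator_scale(2)[OF assms(2), of "-1"]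
  by auto

text \<open>An eigenvector would have the orbit exp (\<mu> t) x, too fast for the growth bound. This
  is the injectivity behind \<open>resolvent\<close>.\<close>

lemma generator_eigenvector_zero:
  assumes x: "x \<in> D" and eig: "A x = \<mu> *\<^sub>R x" and \<mu>: "\<mu> > \<omega>"
  shows "x = 0"
proof (rule ccontr)
  assume "x \<noteq> 0"
  \<comment> \<open>Makes exp ((\<mu> - \<omega>) t) equal to exp M, which exceeds M.\<close>
  define t where "t = M / (\<mu> - \<omega>)"
  have t: "t \<ge> 0" using \<mu> M_nonneg by (simp add: t_def)
  have "T (t - t) (exp (\<mu> * t) *\<^sub>R x) = T (t - 0) (exp (\<mu> * 0) *\<^sub>R x)"
  proof (rule classical_solution_eq[OF t, where D = D and F = "\<lambda>_. A" and C = "M * exp (\<bar>\<omega>\<bar> * t)"])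
    show "continuous_on {0..t} (\<lambda>r. T (t - r) y)" for y by (intro continuous_on_T continuous_intros) auto
    show b: "norm (T (t - r)) \<le> M * exp (\<bar>\<omega>\<bar> * t)" if "r \<in> {0..t}" for r
    proof -
      have "\<omega> * (t - r) \<le> \<bar>\<omega>\<bar> * t" using that by (intro mult_mono) auto
      then have "M * exp (\<omega> * (t - r)) \<le> M * exp (\<bar>\<omega>\<bar> * t)" using M_nonneg by (intro mult_left_mono) auto
      with norm_T[of "t - r"] that show ?thesis by simp
    qed
    show "exp (\<mu> * r) *\<^sub>R x \<in> D" for r by (intro generator_scale x)
    show "((\<lambda>r. exp (\<mu> * r) *\<^sub>R x) has_vector_derivative A (exp (\<mu> * r) *\<^sub>R x)) (at r within {0..t})" for r
      by (auto intro!: derivative_eq_intros simp: generator_scale[OF x] eig mult.commute)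
    fix r y assume r: "r \<in> {0..t}" and y: "y \<in> D"
    show "((\<lambda>r. T (t - r) y) has_vector_derivative - T (t - r) (A y)) (at r within {0..t})"
    proof (rule propagator_backward_derivative[OF propagator_semigroup])
      show "norm (T (t - q)) \<le> M * exp (\<bar>\<omega>\<bar> * t)" if "r \<le> q" "q \<le> t" for q
        using b[of q] that r by simp
      have "filterlim (\<lambda>q. \<bar>q - r\<bar>) (at_right 0) (at r)"
      proof -
        have "((\<lambda>q. \<bar>q - r\<bar>) \<longlongrightarrow> \<bar>r - r\<bar>) (at r)" by (intro tendsto_intros)
        then show ?thesis by (auto simp: filterlim_at eventually_at_filter)
      qed
      from filterlim_compose[OF generator_tendsto[OF y] this]
      have "((\<lambda>q. (1 / \<bar>q - r\<bar>) *\<^sub>R (T \<bar>q - r\<bar> y - y)) \<longlongrightarrow> A y) (at r)" .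
      moreover have "max q r - min q r = \<bar>q - r\<bar>" for q by (auto simp: max_def min_def)
      ultimately show "((\<lambda>q. (1 / \<bar>q - r\<bar>) *\<^sub>R (T (max q r - min q r) y - y)) \<longlongrightarrow> A y) (at r)"
        by simp
    qed (use r in auto)
  qed
  then have "exp (\<mu> * t) * norm x = norm (T t x)" by (metis T_0 abs_exp_cancel diff_self diff_zero exp_zero
        mult_zero_right norm_scaleR scaleR_one)
  also have "\<dots> \<le> M * exp (\<omega> * t) * norm x" by (rule norm_T_apply[OF t])
  finally have "exp (\<mu> * t) \<le> M * exp (\<omega> * t)" using \<open>x \<noteq> 0\<close> by simp
  moreover have "exp (\<mu> * t) = exp (M) * exp (\<omega> * t)"
    using \<mu> by (simp add: t_def field_simps flip: exp_add)
  ultimately have "exp M \<le> M" by simp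
  then show False using exp_ge_add_one_self[of M] by simp
qed

lemma resolvent_inverse:
  assumes "\<mu> > \<omega>" "x \<in> D"
  shows "resolvent D A \<mu> (\<mu> *\<^sub>R x - A x) = x"
  unfolding resolvent_def
proof (rule inv_into_f_f[OF _ assms(2)], rule inj_onI)
  fix x y assume xy: "x \<in> D" "y \<in> D" and eq: "\<mu> *\<^sub>R x - A x = \<mu> *\<^sub>R y - A y"
  have "A (x - y) = \<mu> *\<^sub>R (x - y)"
    using eq by (simp add: generator_diff[OF xy] scaleR_diff_right algebra_simps)
  with generator_eigenvector_zero[OF generator_diff(1)[OF xy] _ assms(1)] show "x = y" by simp
qed

text \<open>A mild solution need not take values in \<open>D\<close>, but its integral does, and the
  equation holds in integrated form. The semigroup law turns \<open>T h (v \<sigma>)\<close> into a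
  shift of v minus a short integral of the forcing, so the quotient of the integrated solution
  reduces to boundary terms and an average of f.\<close>

lemma integral_mild_solution:
  assumes f: "continuous_on UNIV f" and v: "continuous_on UNIV v"
    and mild: "\<And>\<sigma>. 0 \<le> \<sigma> \<Longrightarrow> v \<sigma> = T \<sigma> v\<^sub>0 + integral {0..\<sigma>} (\<lambda>\<tau>. T (\<sigma> - \<tau>) (f \<tau>))"
    and t: "0 \<le> t"
  shows "integral {0..t} v \<in> D" "A (integral {0..t} v) = v t - v\<^sub>0 - integral {0..t} f"
proof -
  define V where "V t = integral {0..t} v" for t
  \<comment> \<open>The forcing collected during one step of length h from \<sigma>, divided by h;
    the rescaled form is continuous up to h = 0, where it is \<open>f \<sigma>\<close>.\<close>
  define J where "J h \<sigma> = integral (cbox 0 1) (\<lambda>\<theta>. T (h - h * \<theta>) (f (\<sigma> + h * \<theta>)))" for h \<sigma>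
  have fc: "continuous_on S (\<lambda>x. f (g x))" if "continuous_on S g" for S :: "'b::topological_space set" and g
    using continuous_on_compose2[OF f that] by simp
  have fc': "continuous_on S f" for S using f continuous_on_subset by blast
  have vc: "continuous_on S v" for S using v continuous_on_subset by blast
  have Jc: "continuous_on ({0..} \<times> S) (\<lambda>(h, \<sigma>). J h \<sigma>)" for S
    unfolding J_def split_beta
  proof (rule integral_continuous_on_param)
    show "continuous_on (({0..} \<times> S) \<times> cbox 0 1) (\<lambda>(p, \<theta>). T (fst p - fst p * \<theta>) (f (snd p + fst p * \<theta>)))"
      unfolding split_beta
      by (intro continuous_on_T fc continuous_intros) (auto simp: mult_left_le)
  qed
  have step: "T h (v \<sigma>) = v (h + \<sigma>) - h *\<^sub>R J h \<sigma>" if h: "0 \<le> h" and \<sigma>: "0 \<le> \<sigma>" for h \<sigma>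
  proof -
    let ?k = "\<lambda>b \<tau>. T (b - \<tau>) (f \<tau>)"
    have ck: "continuous_on {0..b} (?k b)" for b by (intro continuous_on_T continuous_intros fc') auto
    have 1: "integral {0..\<sigma>} (?k (h + \<sigma>)) = T h (integral {0..\<sigma>} (?k \<sigma>))"
    proof -
      have "integral {0..\<sigma>} (?k (h + \<sigma>)) = integral {0..\<sigma>} (T h \<circ> ?k \<sigma>)"
        using h by (intro integral_cong) (simp add: T_add algebra_simps)
      also have "\<dots> = T h (integral {0..\<sigma>} (?k \<sigma>))"
        by (intro integral_linear integrable_continuous_real ck blinfun.bounded_linear_right)
      finally show ?thesis .
    qed
    have 2: "integral {\<sigma>..h + \<sigma>} (?k (h + \<sigma>)) = h *\<^sub>R J h \<sigma>"
    proof -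
      have "integral {\<sigma>..h + \<sigma>} (?k (h + \<sigma>)) = integral {0..h} (\<lambda>\<tau>. T (h - \<tau>) (f (\<sigma> + \<tau>)))"
        using integral_shift_Icc_real[of 0 h "?k (h + \<sigma>)" \<sigma>] by (simp add: o_def algebra_simps)
      also have "\<dots> = h *\<^sub>R J h \<sigma>" unfolding J_def by (subst integral_unit_stretch[OF h]) simp
      finally show ?thesis .
    qed
    have "v (h + \<sigma>) = T (h + \<sigma>) v\<^sub>0 + integral {0..h + \<sigma>} (?k (h + \<sigma>))"
      using h \<sigma> by (intro mild) simp
    also have "integral {0..h + \<sigma>} (?k (h + \<sigma>)) =
        integral {0..\<sigma>} (?k (h + \<sigma>)) + integral {\<sigma>..h + \<sigma>} (?k (h + \<sigma>))"
      using h \<sigma> by (intro Henstock_Kurzweil_Integration.integral_combine[symmetric]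
          integrable_continuous_real ck) auto
    finally show ?thesis using h \<sigma> unfolding 1 2 by (simp add: mild[OF \<sigma>] blinfun.add_right T_add)
  qed
  have quot: "(1 / h) *\<^sub>R (T h (V t) - V t) =
      (1 / h) *\<^sub>R (V (h + t) - V t) - (1 / h) *\<^sub>R V h - integral (cbox 0 t) (J h)" if h: "0 < h" for h
  proof -
    have Jint: "J h integrable_on {0..t}"
    proof (rule integrable_continuous_real)
      have "continuous_on {0..t} ((\<lambda>(h, \<sigma>). J h \<sigma>) \<circ> (\<lambda>\<sigma>. (h, \<sigma>)))"
        using h by (intro continuous_on_compose continuous_intros continuous_on_subset[OF Jc[of UNIV]]) auto
      then show "continuous_on {0..t} (J h)" by (simp add: o_def)
    qed
    have "T h (V t) = integral {0..t} (T h \<circ> v)"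
      unfolding V_def by (intro integral_linear[symmetric] integrable_continuous_real vc
          blinfun.bounded_linear_right)
    also have "\<dots> = integral {0..t} (\<lambda>\<sigma>. (v \<circ> (+) h) \<sigma> - h *\<^sub>R J h \<sigma>)"
      using h by (intro integral_cong) (simp add: step)
    also have "\<dots> = integral {0..t} (v \<circ> (+) h) - h *\<^sub>R integral {0..t} (J h)"
      by (subst integral_diff) (auto intro!: integrable_continuous_real continuous_intros vc
          continuous_on_compose integrable_cmul Jint)
    also have "integral {0..t} (v \<circ> (+) h) = integral {h..h + t} v"
      using integral_shift_Icc_real[of 0 t v h] by (simp add: add.commute)
    also have "\<dots> = V (h + t) - V h"
      unfolding V_def using Henstock_Kurzweil_Integration.integral_combine[of 0 h "h + t" v] h t
      by (simp add: integrable_continuous_real vc algebra_simps)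
    finally have q: "T h (V t) = V (h + t) - V h - h *\<^sub>R integral {0..t} (J h)" .
    show ?thesis unfolding q using h by (simp add: scaleR_diff_right)
  qed
  have derivV: "((\<lambda>h. (1 / h) *\<^sub>R (V (h + r) - V r)) \<longlongrightarrow> v r) (at_right 0)" if "0 \<le> r" for r
  proof -
    have "(V has_vector_derivative v r) (at r within {0..r + 1})"
      unfolding V_def using that by (intro integral_has_vector_derivative vc) auto
    then have "((\<lambda>q. (1 / (q - r)) *\<^sub>R (V q - V r)) \<longlongrightarrow> v r) (at r within {0..r + 1})"
      by (simp add: has_vector_derivative_quotient_iff)
    then have "((\<lambda>q. (1 / (q - r)) *\<^sub>R (V q - V r)) \<longlongrightarrow> v r) (at r within {r..r + 1})"
      by (rule tendsto_within_subset) (use that in auto)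
    then have "((\<lambda>q. (1 / (q - r)) *\<^sub>R (V q - V r)) \<longlongrightarrow> v r) (at_right r)"
      by (simp add: at_within_Icc_at_right)
    then show ?thesis by (subst (asm) filterlim_at_right_to_0) simp
  qed
  have "continuous_on {0..} (\<lambda>h. integral (cbox 0 t) (J h))"
    by (intro integral_continuous_on_param Jc)
  then have "((\<lambda>h. integral (cbox 0 t) (J h)) \<longlongrightarrow> integral (cbox 0 t) (J 0)) (at 0 within {0..})"
    by (simp add: continuous_on)
  then have "((\<lambda>h. integral (cbox 0 t) (J h)) \<longlongrightarrow> integral (cbox 0 t) (J 0)) (at_right 0)"
    by (rule tendsto_within_subset) auto
  moreover have "J 0 = f" by (simp add: J_def fun_eq_iff)
  moreover have "((\<lambda>h. (1 / h) *\<^sub>R V h) \<longlongrightarrow> v\<^sub>0) (at_right 0)"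
    using derivV[of 0] mild[of 0] by (simp add: V_def)
  ultimately have "((\<lambda>h. (1 / h) *\<^sub>R (V (h + t) - V t) - (1 / h) *\<^sub>R V h - integral (cbox 0 t) (J h))
      \<longlongrightarrow> v t - v\<^sub>0 - integral {0..t} f) (at_right 0)"
    using derivV[OF t] by (auto intro!: tendsto_diff)
  moreover have "\<forall>\<^sub>F h in at_right 0. (1 / h) *\<^sub>R (V (h + t) - V t) - (1 / h) *\<^sub>R V h - integral (cbox 0 t) (J h)
      = (1 / h) *\<^sub>R (T h (V t) - V t)"
    using quot by (intro eventually_at_rightI[of 0 1]) auto
  ultimately have "((\<lambda>h. (1 / h) *\<^sub>R (T h (V t) - V t)) \<longlongrightarrow> v t - v\<^sub>0 - integral {0..t} f) (at_right 0)"
    by (rule Lim_transform_eventually)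
  from generator_eqI[OF this] show "integral {0..t} v \<in> D" "A (integral {0..t} v) = v t - v\<^sub>0 - integral {0..t} f"
    by (auto simp: V_def)
qed

text \<open>With f = 0 the integrated equation puts time averages of orbits into \<open>D\<close>,
  and these tend to the initial value.\<close>

lemma generator_domain_dense: "closure D = UNIV"
proof -
  have "x \<in> closure D" for x
  proof -
    define v where "v \<sigma> = T (max 0 \<sigma>) x" for \<sigma>
    have vc: "continuous_on UNIV v" unfolding v_def by (intro continuous_on_T continuous_intros) auto
    have inD: "integral {0..t} v \<in> D" if "0 \<le> t" for t
      by (rule integral_mild_solution(1)[of "\<lambda>_. 0", OF _ vc _ that]) (auto simp: v_def)
    have "((\<lambda>u. integral {0..u} v) has_vector_derivative v 0) (at 0 within {0..1})"
      by (intro integral_has_vector_derivative continuous_on_subset[OF vc]) auto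
    then have lim: "((\<lambda>u. (1 / u) *\<^sub>R integral {0..u} v) \<longlongrightarrow> x) (at_right 0)"
      by (simp add: has_vector_derivative_quotient_iff at_within_Icc_at_right v_def)
    have "\<forall>\<^sub>F u in at_right 0. (1 / u) *\<^sub>R integral {0..u} v \<in> closure D"
      by (intro eventually_at_rightI[of 0 1] subsetD[OF closure_subset] generator_scale(1) inD) auto
    from Lim_in_closed_set[OF closed_closure this _ lim] show ?thesis by simp
  qed
  then show ?thesis by auto
qed

section \<open>Elements of \<open>GL_space\<close> as bounded operators\<close>

lemma GL_space_bound:
  assumes C: "C \<in> GL_space D A \<omega>" and x: "x \<in> D"
  shows "norm (C x) \<le> M * GL_norm D A M \<omega> C * norm x"
proof (cases "M = 0")
  \<comment> \<open>\<open>T 0\<close> is the identity, so M = 0 forces the space to be trivial; the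
    case is separate because \<open>GL_norm\<close> divides by M.\<close>
  case True
  then have "y = 0" for y :: 'a using norm_T_apply[of 0 y] by simp
  then show ?thesis by (metis norm_zero mult_zero_right order_refl)
next
  case False
  define K where "K = (SUP \<mu>\<in>{\<omega><..}. norm ((\<mu> - \<omega>) *\<^sub>R comp_resolvent D A C \<mu>))"
  have K: "(\<mu> - \<omega>) * norm (comp_resolvent D A C \<mu>) \<le> K" if "\<mu> > \<omega>" for \<mu>
  proof -
    have "norm ((\<mu> - \<omega>) *\<^sub>R comp_resolvent D A C \<mu>) \<le> K"
      unfolding K_def using C that by (intro cSUP_upper) (auto simp: GL_space_def)
    then show ?thesis using that by simp
  qed
  have K0: "K \<ge> 0" using order_trans[OF _ K[of "\<omega> + 1"]] by simp
  define c where "c = K * (\<bar>\<omega>\<bar> * norm x + norm (A x))"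
  have c: "0 \<le> c" using K0 by (auto simp: c_def)
  \<comment> \<open>A limit-free form of \<mu> \<rightarrow> \<infinity>: with \<nu> = \<mu> -
    \<omega>, a positive defect times every \<nu> > 0 would stay below the fixed number
    \<open>c\<close>.\<close>
  have bound: "\<nu> * (norm (C x) - K * norm x) \<le> c" if \<nu>: "\<nu> > 0" for \<nu>
  proof -
    define \<mu> where "\<mu> = \<omega> + \<nu>"
    have \<mu>: "\<mu> > \<omega>" using \<nu> by (simp add: \<mu>_def)
    have "comp_resolvent D A C \<mu> y = C (resolvent D A \<mu> y)" for y
      using C \<mu> by (simp add: comp_resolvent_def GL_space_def bounded_linear_Blinfun_apply)
    then have "C x = comp_resolvent D A C \<mu> (\<mu> *\<^sub>R x - A x)"
      by (simp add: resolvent_inverse[OF \<mu> x])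
    then have "\<nu> * norm (C x) \<le> \<nu> * (norm (comp_resolvent D A C \<mu>) * norm (\<mu> *\<^sub>R x - A x))"
      using \<nu> by (intro mult_left_mono) (auto intro: norm_blinfun)
    also have "\<dots> \<le> K * norm (\<mu> *\<^sub>R x - A x)"
      using mult_right_mono[OF K[OF \<mu>], of "norm (\<mu> *\<^sub>R x - A x)"] by (simp add: \<mu>_def mult_ac)
    also have "\<dots> \<le> K * (\<bar>\<mu>\<bar> * norm x + norm (A x))"
      using norm_triangle_ineq4[of "\<mu> *\<^sub>R x" "A x"] by (intro mult_left_mono K0) simp
    also have "\<dots> \<le> K * ((\<bar>\<omega>\<bar> + \<nu>) * norm x + norm (A x))"
      using \<nu> by (intro mult_left_mono K0 add_mono mult_right_mono) (auto simp: \<mu>_def)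
    finally show ?thesis by (simp add: c_def algebra_simps)
  qed
  have "norm (C x) \<le> K * norm x"
  proof (rule ccontr)
    assume "\<not> norm (C x) \<le> K * norm x"
    then have d: "norm (C x) - K * norm x > 0" by simp
    then have "(c + 1) / (norm (C x) - K * norm x) > 0" using c by simp
    from bound[OF this] d show False by simp
  qed
  moreover have "M * GL_norm D A M \<omega> C = K" using False by (simp add: GL_norm_def K_def)
  ultimately show ?thesis by simp
qed

end

lemma bounded_extension_dense:
  fixes C :: "'a::real_normed_vector \<Rightarrow> 'b::banach"
  assumes lin: "subspace D" "\<And>x y. x \<in> D \<Longrightarrow> y \<in> D \<Longrightarrow> C (x + y) = C x + C y"
      "\<And>c x. x \<in> D \<Longrightarrow> C (c *\<^sub>R x) = c *\<^sub>R C x"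
    and dense: "closure D = UNIV" and b: "\<And>x. x \<in> D \<Longrightarrow> norm (C x) \<le> k * norm x" and k: "0 \<le> k"
  obtains E :: "'a \<Rightarrow>\<^sub>L 'b" where "norm E \<le> k" "\<And>x. x \<in> D \<Longrightarrow> E x = C x"
proof -
  have "\<exists>q. (\<forall>n. q n \<in> D) \<and> q \<longlonglongrightarrow> x" for x
    using dense by (auto simp flip: closure_sequential)
  then obtain q where q: "\<And>x n. q x n \<in> D" "\<And>x. q x \<longlonglongrightarrow> x" by metis
  have Cd: "C (x - y) = C x - C y" "x - y \<in> D" if "x \<in> D" "y \<in> D" for x y
  proof -
    show "x - y \<in> D" using lin(1) that by (rule subspace_diff)
    from lin(2)[OF this that(2)] show "C (x - y) = C x - C y" by simp
  qed
  have lip: "norm (C x - C y) \<le> k * norm (x - y)" if "x \<in> D" "y \<in> D" for x y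
    using b[OF Cd(2)[OF that]] by (simp add: Cd that)
  have conv: "convergent (\<lambda>n. C (q x n))" for x
  proof -
    have "k-lipschitz_on D C" using lip k by (auto intro!: lipschitz_onI simp: dist_norm)
    then have "uniformly_continuous_on D C" by (rule lipschitz_on_uniformly_continuous)
    moreover have "Cauchy (q x)" using q(2) LIMSEQ_imp_Cauchy by blast
    ultimately have "Cauchy (\<lambda>n. C (q x n))"
      using uniformly_continuous_on_Cauchy[of D C "q x"] q(1) by simp
    then show ?thesis by (simp add: Cauchy_convergent_iff)
  qed
  define E where "E x = lim (\<lambda>n. C (q x n))" for x
  have E: "(\<lambda>n. C (q x n)) \<longlonglongrightarrow> E x" for x using conv by (simp add: E_def convergent_LIMSEQ_iff)
  \<comment> \<open>Independence of the approximating sequence, from which linearity and agreement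
    with \<open>C\<close> on \<open>D\<close> follow.\<close>
  have E_eqI: "E x = l" if y: "\<And>n. y n \<in> D" "y \<longlonglongrightarrow> x" and l: "(\<lambda>n. C (y n)) \<longlonglongrightarrow> l" for x y l
  proof (rule LIMSEQ_unique[OF E])
    have "(\<lambda>n. C (q x n) - C (y n)) \<longlonglongrightarrow> 0"
    proof (rule Lim_null_comparison[OF always_eventually])
      show "\<forall>n. norm (C (q x n) - C (y n)) \<le> k * norm (q x n - y n)" using lip q(1) y(1) by blast
      have "(\<lambda>n. k * norm (q x n - y n)) \<longlonglongrightarrow> k * norm (x - x)" by (intro tendsto_intros q(2) y(2))
      then show "(\<lambda>n. k * norm (q x n - y n)) \<longlonglongrightarrow> 0" by simp
    qed
    from tendsto_add[OF this l] show "(\<lambda>n. C (q x n)) \<longlonglongrightarrow> l" by simp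
  qed
  have Eb: "norm (E x) \<le> k * norm x" for x
  proof (rule tendsto_le[OF _ _ tendsto_norm[OF E]])
    show "(\<lambda>n. k * norm (q x n)) \<longlonglongrightarrow> k * norm x" by (intro tendsto_intros q(2))
  qed (use b q(1) in auto)
  have "bounded_linear E"
  proof (rule bounded_linear_intro)
    show "E (x + y) = E x + E y" for x y
      using tendsto_add[OF E E, of x y] tendsto_add[OF q(2) q(2), of x y] lin q(1)
      by (intro E_eqI[of "\<lambda>n. q x n + q y n"]) (auto simp: subspace_add)
    show "E (c *\<^sub>R x) = c *\<^sub>R E x" for c x
      using tendsto_scaleR[OF tendsto_const E, of c x] tendsto_scaleR[OF tendsto_const q(2), of c x] lin q(1)
      by (intro E_eqI[of "\<lambda>n. c *\<^sub>R q x n"]) (auto simp: subspace_scale)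
    show "norm (E x) \<le> norm x * k" for x using Eb[of x] by (simp add: mult.commute)
  qed
  then have BE: "blinfun_apply (Blinfun E) = E" by (rule bounded_linear_Blinfun_apply)
  show ?thesis
  proof
    show "norm (Blinfun E) \<le> k" using k Eb by (intro norm_blinfun_bound) (simp_all add: BE)
    show "Blinfun E x = C x" if "x \<in> D" for x
      unfolding BE using that by (intro E_eqI[of "\<lambda>_. x"]) auto
  qed
qed

subsection \<open>Classical solutions of the perturbed equation\<close>

lemma integral_shift_has_vector_derivative:
  fixes w :: "real \<Rightarrow> 'a::banach"
  assumes w: "continuous_on UNIV w" and r: "s \<le> r" "r \<le> b"
  shows "((\<lambda>r. integral {0..r - s} w) has_vector_derivative w (r - s)) (at r within {s..b})"
proof -
  have "((\<lambda>u. integral {0..u} w) \<circ> (\<lambda>r. r - s) has_vector_derivative 1 *\<^sub>R w (r - s)) (at r within {s..b})"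
  proof (rule vector_diff_chain_within)
    show "((\<lambda>r. r - s) has_vector_derivative 1) (at r within {s..b})"
      by (auto intro!: derivative_eq_intros)
    have "(\<lambda>r. r - s) ` {s..b} = {0..b - s}" by simp
    then show "((\<lambda>u. integral {0..u} w) has_vector_derivative w (r - s)) (at (r - s) within (\<lambda>r. r - s) ` {s..b})"
      using r by (auto intro!: integral_has_vector_derivative continuous_on_subset[OF w])
  qed
  then show ?thesis by (simp add: o_def)
qed

locale perturbed_generator = bounded_perturbation T M \<omega> B \<delta> \<kappa> + generated_semigroup T M \<omega> D A
  for T :: "real \<Rightarrow> 'a::banach \<Rightarrow>\<^sub>L 'a" and M \<omega> B \<delta> \<kappa> D A
begin

text \<open>Formally, \<open>v = p'\<close> and \<open>m = \<mu> p + B p\<close> satisfy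
  \<open>v' = A v + f\<close>, \<open>m' = \<mu> v + f\<close> with \<open>f = (B p)' = B v + B' p\<close>, where
  \<open>B' p = K (\<mu> p - A p) = K (m - v)\<close>. The mild solution of this system on \<open>'a \<times> 'a\<close> exists
  without any regularity of \<open>p\<close>, and \<open>p\<close> is recovered from it by integrating \<open>v\<close>.\<close>

lemma classical_solution_exists:
  fixes K :: "real \<Rightarrow> 'a \<Rightarrow>\<^sub>L 'a"
  assumes s: "a \<le> s" "s \<le> b" and x: "x \<in> D" and K: "continuous_on {a..b} K"
    and B': "\<And>t y. t \<in> {a..b} \<Longrightarrow> y \<in> D \<Longrightarrow>
      ((\<lambda>r. B r y) has_vector_derivative K t (\<mu> *\<^sub>R y - A y)) (at t within {a..b})"
  obtains p where "p s = x" "\<And>r. r \<in> {s..b} \<Longrightarrow> p r \<in> D"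
    "\<And>r. r \<in> {s..b} \<Longrightarrow> (p has_vector_derivative A (p r) + B r (p r)) (at r within {s..b})"
proof -
  \<comment> \<open>Clamping time extends \<open>K\<close> to the whole line, continuously and with
    the same bound, as \<open>bounded_perturbation\<close> asks; on [a, b] nothing changes.\<close>
  define K' where "K' t = K (max a (min b t))" for t
  have K'_eq: "K' t = K t" if "t \<in> {a..b}" for t using that by (simp add: K'_def)
  have K'c: "continuous_on UNIV K'"
    unfolding K'_def using s by (intro continuous_on_compose2[OF K] continuous_intros) auto
  obtain k where "\<forall>z\<in>K ` {a..b}. norm z \<le> k"
    using compact_imp_bounded[OF compact_continuous_image[OF K compact_Icc]] by (auto simp: bounded_iff)
  then have K'b: "norm (K' t) \<le> k" for t using s by (auto simp: K'_def)
  have k: "0 \<le> k" using order_trans[OF norm_ge_zero K'b] .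
  define f where "f t z = B t (fst z) - K' t (fst z) + K' t (snd z)" for t and z :: "'a \<times> 'a"
  \<comment> \<open>The equation for m has no unbounded part, so the semigroup is the identity on
    that component. Its growth rate 0 is the reason for \<open>\<bar>\<omega>\<bar>\<close>
    below.\<close>
  define T2 :: "real \<Rightarrow> ('a \<times> 'a) \<Rightarrow>\<^sub>L ('a \<times> 'a)" where "T2 t = Blinfun (\<lambda>z. (T t (fst z), snd z))" for t
  define B2 :: "real \<Rightarrow> ('a \<times> 'a) \<Rightarrow>\<^sub>L ('a \<times> 'a)" where "B2 t = Blinfun (\<lambda>z. (f t z, \<mu> *\<^sub>R fst z + f t z))" for t
  have f_lin: "bounded_linear (f t)" for t
    unfolding f_def by (intro bounded_linear_add bounded_linear_sub
        bounded_linear_compose[OF blinfun.bounded_linear_right] bounded_linear_fst bounded_linear_snd)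
  have T2: "T2 t z = (T t (fst z), snd z)" for t z
  proof -
    have "bounded_linear (\<lambda>z :: 'a \<times> 'a. (T t (fst z), snd z))"
      by (intro bounded_linear_Pair bounded_linear_compose[OF blinfun.bounded_linear_right]
          bounded_linear_fst bounded_linear_snd)
    then show ?thesis by (simp add: T2_def bounded_linear_Blinfun_apply)
  qed
  have B2: "B2 t z = (f t z, \<mu> *\<^sub>R fst z + f t z)" for t z
  proof -
    have "bounded_linear (\<lambda>z. (f t z, \<mu> *\<^sub>R fst z + f t z))"
      by (intro bounded_linear_Pair bounded_linear_add bounded_linear_compose[OF bounded_linear_scaleR_right]
          bounded_linear_fst f_lin)
    then show ?thesis by (simp add: B2_def bounded_linear_Blinfun_apply)
  qed
  have fc: "continuous_on S (\<lambda>t. f (g t) (z t))" if "continuous_on S g" "continuous_on S z"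
    for S :: "real set" and g z
  proof -
    have "continuous_on S (\<lambda>t. K' (g t))" using continuous_on_compose2[OF K'c that(1)] by simp
    then show ?thesis
      unfolding f_def by (intro continuous_intros continuous_on_B that)
  qed
  have nfst: "norm (fst z) \<le> norm z" and nsnd: "norm (snd z) \<le> norm z" for z :: "'a \<times> 'a"
    using norm_fst_le[of "fst z" "snd z"] norm_snd_le[of "snd z" "fst z"] by auto
  have nf: "norm (f t z) \<le> (\<delta> + 2 * k) * norm z" for t z
  proof -
    have "norm (B t (fst z)) \<le> \<delta> * norm z" "norm (K' t (fst z)) \<le> k * norm z" "norm (K' t (snd z)) \<le> k * norm z"
      using nfst[of z] nsnd[of z] k \<delta>_nonneg
      by (auto intro!: order_trans[OF norm_blinfun] mult_mono norm_B K'b)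
    then show ?thesis
      unfolding f_def using norm_triangle_ineq[of "B t (fst z) - K' t (fst z)" "K' t (snd z)"]
        norm_triangle_ineq4[of "B t (fst z)" "K' t (fst z)"] by (simp add: algebra_simps)
  qed
  define \<delta>2 where "\<delta>2 = 2 * (\<delta> + 2 * k) + \<bar>\<mu>\<bar>"
  have \<delta>2: "0 \<le> \<delta>2" using \<delta>_nonneg k by (simp add: \<delta>2_def)
  \<comment> \<open>The exponent is chosen for this system alone:
    \<open>2 * (M + 1) * \<delta>2\<close> meets the contraction condition, and the summand 1 makes
    the inequality with \<open>\<bar>\<omega>\<bar>\<close> strict.\<close>
  interpret P: bounded_perturbation T2 "M + 1" "\<bar>\<omega>\<bar>" B2 \<delta>2 "\<bar>\<omega>\<bar> + 2 * (M + 1) * \<delta>2 + 1"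
  proof
    show "C0_semigroup T2"
      unfolding C0_semigroup_def
    proof (intro conjI allI impI)
      show "T2 0 = id_blinfun" by (intro blinfun_eqI) (simp add: T2)
      show "T2 (t + s) = T2 t o\<^sub>L T2 s" if "0 \<le> s" "0 \<le> t" for s t
        using that by (intro blinfun_eqI) (simp add: T2 T_add)
      show "continuous_on {0..} (\<lambda>t. T2 t z)" for z
        unfolding T2 by (intro continuous_on_Pair continuous_on_T continuous_intros) auto
    qed
    show "norm (T2 t) \<le> (M + 1) * exp (\<bar>\<omega>\<bar> * t)" if t: "0 \<le> t" for t
    proof (rule norm_blinfun_bound)
      show "0 \<le> (M + 1) * exp (\<bar>\<omega>\<bar> * t)" using M_nonneg by simp
      fix z :: "'a \<times> 'a"
      have e: "exp (\<omega> * t) \<le> exp (\<bar>\<omega>\<bar> * t)" "1 \<le> exp (\<bar>\<omega>\<bar> * t)"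
        using t by (auto intro: mult_right_mono)
      have "norm (T2 t z) \<le> norm (T t (fst z)) + norm (snd z)"
        unfolding T2 by (rule norm_Pair_le)
      also have "\<dots> \<le> M * exp (\<omega> * t) * norm z + 1 * norm z"
        using norm_T_apply[OF t, of "fst z"] mult_left_mono[OF nfst[of z], of "M * exp (\<omega> * t)"] nsnd[of z] M_nonneg
        by simp
      also have "\<dots> \<le> M * exp (\<bar>\<omega>\<bar> * t) * norm z + exp (\<bar>\<omega>\<bar> * t) * norm z"
        using M_nonneg e by (intro add_mono mult_right_mono mult_left_mono) auto
      finally show "norm (T2 t z) \<le> (M + 1) * exp (\<bar>\<omega>\<bar> * t) * norm z" by (simp add: algebra_simps)
    qed
    show "continuous_on UNIV (\<lambda>t. B2 t z)" for z
      unfolding B2 by (intro continuous_on_Pair continuous_on_add fc continuous_intros)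
    show "norm (B2 t) \<le> \<delta>2" for t
    proof (rule norm_blinfun_bound[OF \<delta>2])
      fix z
      have "norm (B2 t z) \<le> norm (f t z) + (norm (\<mu> *\<^sub>R fst z) + norm (f t z))"
        unfolding B2 by (intro order_trans[OF norm_Pair_le] add_left_mono norm_triangle_ineq)
      then show "norm (B2 t z) \<le> \<delta>2 * norm z"
        using nf[of t z] mult_left_mono[OF nfst[of z], of "\<bar>\<mu>\<bar>"] by (simp add: \<delta>2_def algebra_simps)
    qed
    show "\<bar>\<omega>\<bar> < \<bar>\<omega>\<bar> + 2 * (M + 1) * \<delta>2 + 1" using M_nonneg \<delta>2 by (simp add: add_nonneg_pos)
  qed simp
  define v\<^sub>0 where "v\<^sub>0 = A x + B s x"
  define m\<^sub>0 where "m\<^sub>0 = \<mu> *\<^sub>R x + B s x"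
  define Z where "Z \<sigma> = P.sol (v\<^sub>0, m\<^sub>0) \<sigma> s" for \<sigma>
  define v where "v \<sigma> = fst (Z \<sigma>)" for \<sigma>
  define m where "m \<sigma> = snd (Z \<sigma>)" for \<sigma>
  define w where "w \<sigma> = f (s + \<sigma>) (Z \<sigma>)" for \<sigma>
  have Zc: "continuous_on S Z" for S
    unfolding Z_def by (intro P.continuous_on_sol continuous_intros)
  have vc: "continuous_on S v" for S unfolding v_def by (intro continuous_intros Zc)
  have wc: "continuous_on S w" for S unfolding w_def by (intro fc continuous_intros Zc)
  have Z_eq: "Z \<sigma> = (T \<sigma> v\<^sub>0 + integral {0..\<sigma>} (\<lambda>\<tau>. T (\<sigma> - \<tau>) (w \<tau>)),
      m\<^sub>0 + integral {0..\<sigma>} (\<lambda>\<tau>. \<mu> *\<^sub>R v \<tau> + w \<tau>))" if \<sigma>: "0 \<le> \<sigma>" for \<sigma>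
  proof -
    let ?G = "\<lambda>\<tau>. T2 (\<sigma> - \<tau>) (B2 (s + \<tau>) (Z \<tau>))"
    have G: "?G integrable_on {0..\<sigma>}"
      by (intro integrable_continuous_real P.continuous_conv_integrand Zc)
    have "Z \<sigma> = T2 \<sigma> (v\<^sub>0, m\<^sub>0) + integral {0..\<sigma>} ?G"
      using P.sol[OF \<sigma>, of "(v\<^sub>0, m\<^sub>0)" s] by (simp add: P.conv_def Z_def)
    moreover have "fst (integral {0..\<sigma>} ?G) = integral {0..\<sigma>} (\<lambda>\<tau>. T (\<sigma> - \<tau>) (w \<tau>))"
      using integral_linear[OF G bounded_linear_fst] by (simp add: o_def T2 B2 w_def)
    moreover have "snd (integral {0..\<sigma>} ?G) = integral {0..\<sigma>} (\<lambda>\<tau>. \<mu> *\<^sub>R v \<tau> + w \<tau>)"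
      using integral_linear[OF G bounded_linear_snd] by (simp add: o_def T2 B2 w_def v_def)
    ultimately show ?thesis by (simp add: prod_eq_iff T2)
  qed
  define p where "p r = x + integral {0..r - s} v" for r
  \<comment> \<open>The candidate for \<open>B r (p r)\<close>. The two are known to agree only
    after both are shown to have derivative \<open>w (r - s)\<close> and the same initial
    value.\<close>
  define g where "g r = B s x + integral {0..r - s} w" for r
  have int: "integral {0..r - s} v \<in> D"
    "A (integral {0..r - s} v) = v (r - s) - v\<^sub>0 - integral {0..r - s} w" if "s \<le> r" for r
    using that by (intro integral_mild_solution[OF wc vc]; simp add: v_def Z_eq)+
  have pD: "p r \<in> D" and Ap: "A (p r) = v (r - s) - g r" if "s \<le> r" for r
    using generator_add[OF x int(1)[OF that]] int(2)[OF that] by (simp_all add: p_def g_def v\<^sub>0_def)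
  have m: "m (r - s) = \<mu> *\<^sub>R p r + g r" if "s \<le> r" for r
  proof -
    have "integral {0..r - s} (\<lambda>\<tau>. \<mu> *\<^sub>R v \<tau> + w \<tau>) = \<mu> *\<^sub>R integral {0..r - s} v + integral {0..r - s} w"
      by (subst integral_add) (auto intro!: integrable_continuous_real continuous_intros vc wc)
    then show ?thesis using that by (simp add: m_def Z_eq m\<^sub>0_def p_def g_def scaleR_add_right)
  qed
  have p': "(p has_vector_derivative v (r - s)) (at r within {s..b})" if "r \<in> {s..b}" for r
    unfolding p_def using that by (intro has_vector_derivative_eq_rhs[OF has_vector_derivative_add[OF
        has_vector_derivative_const integral_shift_has_vector_derivative[OF vc]]]) auto
  have g': "(g has_vector_derivative w (r - s)) (at r within {s..b})" if "r \<in> {s..b}" for r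
    unfolding g_def using that by (intro has_vector_derivative_eq_rhs[OF has_vector_derivative_add[OF
        has_vector_derivative_const integral_shift_has_vector_derivative[OF wc]]]) auto
  \<comment> \<open>The vector \<open>\<mu> *\<^sub>R p r - A (p r)\<close> equals m - v at r - s,
    because \<open>g\<close> cancels between the formulas for \<open>m\<close> and
    \<open>A (p r)\<close>; this closes the argument without knowing
    \<open>B r (p r)\<close>.\<close>
  have Bp': "((\<lambda>r. B r (p r)) has_vector_derivative w (r - s)) (at r within {s..b})" if r: "r \<in> {s..b}" for r
  proof -
    have rab: "r \<in> {a..b}" using r s by auto
    have W: "((\<lambda>q. B q (p r)) has_vector_derivative K r (\<mu> *\<^sub>R p r - A (p r))) (at r within {s..b})"
      using B'[OF rab pD] r s by (intro has_vector_derivative_within_subset[OF B'[OF rab pD]]) auto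
    have cont: "((\<lambda>q. B q (v (r - s))) \<longlongrightarrow> B r (v (r - s))) (at r within {s..b})"
      using B_cont[of "v (r - s)"] by (auto simp: continuous_on intro: tendsto_within_subset)
    from has_vector_derivative_blinfun_apply_strong[OF p'[OF r] W cont norm_B]
    have "((\<lambda>r. B r (p r)) has_vector_derivative
        B r (v (r - s)) + K r (\<mu> *\<^sub>R p r - A (p r))) (at r within {s..b})" .
    moreover have "\<mu> *\<^sub>R p r - A (p r) = m (r - s) - v (r - s)"
      using r by (simp add: Ap m)
    moreover have "w (r - s) = B r (v (r - s)) + K r (m (r - s) - v (r - s))"
      using K'_eq[OF rab] by (simp add: w_def f_def v_def m_def blinfun.diff_right)
    ultimately show ?thesis by simp
  qed
  have "((\<lambda>r. B r (p r) - g r) has_vector_derivative 0) (at r within {s..b})" if "r \<in> {s..b}" for r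
    using has_vector_derivative_diff[OF Bp'[OF that] g'[OF that]] by simp
  then obtain c where c: "\<And>r. r \<in> {s..b} \<Longrightarrow> B r (p r) - g r = c"
    using has_vector_derivative_zero_constant[of "{s..b}" "\<lambda>r. B r (p r) - g r"] by auto
  have "c = 0" using c[of s] s by (simp add: p_def g_def)
  with c have Bp: "B r (p r) = g r" if "r \<in> {s..b}" for r using that by auto
  show ?thesis
  proof
    show "p s = x" by (simp add: p_def)
    show "p r \<in> D" if "r \<in> {s..b}" for r using pD that by simp
    show "(p has_vector_derivative A (p r) + B r (p r)) (at r within {s..b})" if "r \<in> {s..b}" for r
      using p'[OF that] that by (simp add: Ap Bp)
  qed
qed

lemma U_backward_derivative:
  assumes "a \<le> s" "s \<le> t" "x \<in> D"
  shows "((\<lambda>r. U t r x) has_vector_derivative - U t s (A x + B s x)) (at s within {a..t})"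
proof (rule propagator_backward_derivative[OF propagator_U assms(1,2) _ U_quotient[OF generator_tendsto[OF assms(3)]]])
  fix r assume r: "s \<le> r" "r \<le> t"
  have "\<kappa> * (t - r) \<le> \<bar>\<kappa>\<bar> * (t - s)" using r by (intro mult_mono) auto
  then have "2 * M * exp (\<kappa> * (t - r)) \<le> 2 * M * exp (\<bar>\<kappa>\<bar> * (t - s))"
    using M_nonneg by (intro mult_left_mono) auto
  with norm_U[OF r(2)] show "norm (U t r) \<le> 2 * M * exp (\<bar>\<kappa>\<bar> * (t - s))" by linarith
qed

text \<open>Works for an arbitrary evolution family through its backward derivative, which is what
  makes the comparison for uniqueness possible.\<close>

lemma evolution_family_on_classical_solution:
  assumes V: "evolution_family_on D F a b V" and s: "a \<le> s" "s \<le> t" "t \<le> b"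
    and p: "\<And>r. r \<in> {s..t} \<Longrightarrow> p r \<in> D"
      "\<And>r. r \<in> {s..t} \<Longrightarrow> (p has_vector_derivative F r (p r)) (at r within {s..t})"
  shows "V t s (p s) = p t"
proof -
  have pair: "continuous_on {(t, s). a \<le> s \<and> s \<le> t \<and> t \<le> b} (\<lambda>(t, s). V t s y)" for y
    using V by (simp add: evolution_family_on_def)
  have id: "V t t = id_blinfun" using V s unfolding evolution_family_on_def by auto
  have deriv: "((\<lambda>r. V t r y) has_vector_derivative - V t r (F r y)) (at r within {a..t})"
    if "y \<in> D" "a \<le> r" "r \<le> t" for y r
    using V that s unfolding evolution_family_on_def by blast
  have "\<exists>M' \<omega>'. \<forall>s t. a \<le> s \<and> s \<le> t \<and> t \<le> b \<longrightarrow> norm (V t s) \<le> M' * exp (\<omega>' * (t - s))"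
    using V unfolding evolution_family_on_def by (elim conjE)
  then obtain M' \<omega>' where growth: "\<And>s t. a \<le> s \<Longrightarrow> s \<le> t \<Longrightarrow> t \<le> b \<Longrightarrow> norm (V t s) \<le> M' * exp (\<omega>' * (t - s))"
    by blast
  have M': "0 \<le> M'" using order_trans[OF norm_ge_zero growth[of t t]] s by simp
  have "V t t (p t) = V t s (p s)"
  proof (rule classical_solution_eq[where V = "V t" and D = D and F = F and
        C = "M' * exp (\<bar>\<omega>'\<bar> * (t - s))"])
    show "continuous_on {s..t} (\<lambda>r. V t r y)" for y
    proof -
      have "continuous_on {s..t} ((\<lambda>(t, s). V t s y) \<circ> (\<lambda>r. (t, r)))"
        using s by (intro continuous_on_compose continuous_intros continuous_on_subset[OF pair]) auto
      then show ?thesis by (simp add: o_def)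
    qed
    show "norm (V t r) \<le> M' * exp (\<bar>\<omega>'\<bar> * (t - s))" if "r \<in> {s..t}" for r
    proof -
      have "\<omega>' * (t - r) \<le> \<bar>\<omega>'\<bar> * (t - s)" using that by (intro mult_mono) auto
      then have "M' * exp (\<omega>' * (t - r)) \<le> M' * exp (\<bar>\<omega>'\<bar> * (t - s))"
        using M' by (intro mult_left_mono) auto
      with growth[of r t] that s show ?thesis by auto
    qed
    show "((\<lambda>r. V t r y) has_vector_derivative - V t r (F r y)) (at r within {s..t})"
      if "r \<in> {s..t}" "y \<in> D" for r y
      using s that by (intro has_vector_derivative_within_subset[OF deriv]) auto
  qed (use s p in auto)
  then show ?thesis by (simp add: id)
qed

text \<open>\<open>K\<close> plays the derivative of \<open>B(t) R(\<mu>, A)\<close>; evaluated at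
  \<open>\<mu> *\<^sub>R y - A y\<close>, whose image under the resolvent is y, it gives the
  derivative of \<open>B(t) y\<close>.\<close>

context
  fixes \<mu> :: real
  assumes smooth: "\<And>a b. a < b \<Longrightarrow> \<exists>K :: real \<Rightarrow> 'a \<Rightarrow>\<^sub>L 'a. continuous_on {a..b} K \<and>
    (\<forall>t\<in>{a..b}. \<forall>y\<in>D. ((\<lambda>r. blinfun_apply (B r) y) has_vector_derivative
      blinfun_apply (K t) (\<mu> *\<^sub>R y - A y)) (at t within {a..b}))"
begin

lemma classical_solution:
  assumes "a < b" "a \<le> s" "s \<le> b" "x \<in> D"
  obtains p where "p s = x" "\<And>r. r \<in> {s..b} \<Longrightarrow> p r \<in> D"
    "\<And>r. r \<in> {s..b} \<Longrightarrow> (p has_vector_derivative A (p r) + B r (p r)) (at r within {s..b})"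
proof -
  obtain K :: "real \<Rightarrow> 'a \<Rightarrow>\<^sub>L 'a" where K: "continuous_on {a..b} K"
    "\<And>t y. t \<in> {a..b} \<Longrightarrow> y \<in> D \<Longrightarrow>
      ((\<lambda>r. B r y) has_vector_derivative K t (\<mu> *\<^sub>R y - A y)) (at t within {a..b})"
    using smooth[OF assms(1)] by blast
  show ?thesis using classical_solution_exists[OF assms(2-4) K] that by metis
qed

lemma U_classical_solution:
  assumes "s \<le> b" and p: "\<And>r. r \<in> {s..b} \<Longrightarrow> p r \<in> D"
    "\<And>r. r \<in> {s..b} \<Longrightarrow> (p has_vector_derivative A (p r) + B r (p r)) (at r within {s..b})"
    and t: "t \<in> {s..b}"
  shows "U t s (p s) = p t"
proof -
  have "U t t (p t) = U t s (p s)"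
  proof (rule classical_solution_eq[where C = "2 * M * exp (\<bar>\<kappa>\<bar> * (t - s))" and D = D and
        F = "\<lambda>t x. A x + B t x"])
    show "continuous_on {s..t} (\<lambda>r. U t r y)" for y
      by (rule continuous_on_subset[OF propagator_continuous_snd[OF propagator_U]]) auto
    show "norm (U t r) \<le> 2 * M * exp (\<bar>\<kappa>\<bar> * (t - s))" if "r \<in> {s..t}" for r
    proof -
      have "\<kappa> * (t - r) \<le> \<bar>\<kappa>\<bar> * (t - s)" using that by (intro mult_mono) auto
      then have "2 * M * exp (\<kappa> * (t - r)) \<le> 2 * M * exp (\<bar>\<kappa>\<bar> * (t - s))"
        using M_nonneg by (intro mult_left_mono) auto
      with norm_U[of r t] that show ?thesis by auto
    qed
    show "((\<lambda>r. U t r y) has_vector_derivative - U t r (A y + B r y)) (at r within {s..t})"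
      if "r \<in> {s..t}" "y \<in> D" for r y
      using that by (intro U_backward_derivative) auto
    show "(p has_vector_derivative A (p r) + B r (p r)) (at r within {s..t})" if "r \<in> {s..t}" for r
      using that t by (intro has_vector_derivative_within_subset[OF p(2)]) auto
  qed (use t p in auto)
  then show ?thesis by (simp add: propagator_id[OF propagator_U])
qed

text \<open>Everything but the derivatives in t is inherited from the mild theory; those come from
  identifying orbits that start in \<open>D\<close> with classical solutions.\<close>

lemma U_evolution_family_on:
  assumes ab: "a < b"
  shows "evolution_family_on D (\<lambda>t x. A x + B t x) a b U"
  unfolding evolution_family_on_def
proof (intro conjI allI impI ballI)
  show "continuous_on {(t, s). a \<le> s \<and> s \<le> t \<and> t \<le> b} (\<lambda>(t, s). U t s x)" for x
    using propagator_U unfolding propagator_def by (auto intro: continuous_on_subset)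
  show "U t t = id_blinfun" for t using propagator_U by (simp add: propagator_def)
  show "U t s o\<^sub>L U s r = U t r" if "a \<le> r \<and> r \<le> s \<and> s \<le> t \<and> t \<le> b" for r s t
    using propagator_U that by (simp add: propagator_def)
  show "\<exists>M' \<omega>'. \<forall>s t. a \<le> s \<and> s \<le> t \<and> t \<le> b \<longrightarrow> norm (U t s) \<le> M' * exp (\<omega>' * (t - s))"
    using norm_U by blast
  show "((\<lambda>r. U t r x) has_vector_derivative - U t s (A x + B s x)) (at s within {a..t})"
    if "x \<in> D" "a \<le> s \<and> s \<le> t \<and> t \<le> b" for x s t
    using that by (intro U_backward_derivative) auto
  fix x s assume x: "x \<in> D" and s: "s \<in> {a..b}"
  obtain p where p: "p s = x" "\<And>r. r \<in> {s..b} \<Longrightarrow> p r \<in> D"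
    "\<And>r. r \<in> {s..b} \<Longrightarrow> (p has_vector_derivative A (p r) + B r (p r)) (at r within {s..b})"
    using classical_solution[OF ab _ _ x, of s] s by auto
  have Up: "U t s x = p t" if "t \<in> {s..b}" for t
    using U_classical_solution[of s b p t] p s that by auto
  have U': "((\<lambda>t. U t s x) has_vector_derivative A (p r) + B r (p r)) (at r within {s..b})"
    if "r \<in> {s..b}" for r
    by (rule has_vector_derivative_transform[OF that Up p(3)[OF that]])
  then show "(\<lambda>t. U t s x) differentiable_on {s..b}"
    unfolding differentiable_on_def by (blast intro: differentiableI_vector)
  show "((\<lambda>t. U t s x) has_vector_derivative A x + B s x) (at s within {s..b})"
    using U'[of s] s p(1) by simp
qed

text \<open>Both families carry an initial value in \<open>D\<close> along the same classical
  solution, and \<open>D\<close> is dense.\<close>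

lemma evolution_family_unique:
  assumes V: "generates_evolution_family D (\<lambda>t x. A x + B t x) V" and st: "s \<le> t"
  shows "V t s = U t s"
proof -
  have eqD: "V t s x = U t s x" if x: "x \<in> D" for x
  proof -
    \<comment> \<open>The interval reaches to t + 1 because evolution families are constrained on
      nondegenerate intervals only, while s = t is allowed.\<close>
    obtain p where p: "p s = x" "\<And>r. r \<in> {s..t + 1} \<Longrightarrow> p r \<in> D"
      "\<And>r. r \<in> {s..t + 1} \<Longrightarrow> (p has_vector_derivative A (p r) + B r (p r)) (at r within {s..t + 1})"
      using classical_solution[of s "t + 1" s x] st x by auto
    have "V t s (p s) = p t"
    proof (rule evolution_family_on_classical_solution)
      show "evolution_family_on D (\<lambda>t x. A x + B t x) s (t + 1) V"
        using V st by (simp add: generates_evolution_family_def)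
      show "(p has_vector_derivative A (p r) + B r (p r)) (at r within {s..t})" if "r \<in> {s..t}" for r
        using that by (intro has_vector_derivative_within_subset[OF p(3)]) auto
    qed (use st p in auto)
    moreover have "U t s (p s) = p t" using U_classical_solution[of s "t + 1" p t] p st by auto
    ultimately show ?thesis using p(1) by simp
  qed
  show ?thesis
  proof (rule blinfun_eqI)
    fix x
    obtain q where q: "\<And>n. q n \<in> D" "q \<longlonglongrightarrow> x"
      using generator_domain_dense closure_sequential[of x D] by auto
    have "(\<lambda>n. V t s (q n)) \<longlonglongrightarrow> V t s x" "(\<lambda>n. U t s (q n)) \<longlonglongrightarrow> U t s x"
      by (intro blinfun.tendsto tendsto_const q)+
    then show "V t s x = U t s x" using eqD q(1) by (intro LIMSEQ_unique[of "\<lambda>n. V t s (q n)"]) auto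
  qed
qed

end

end

text \<open>The definition evaluates the right-hand side on \<open>D\<close> only, so
  \<open>B t\<close> may be exchanged for its bounded extension.\<close>

lemma generates_evolution_family_cong:
  assumes "\<And>t x. x \<in> D \<Longrightarrow> F t x = G t x"
  shows "generates_evolution_family D F U \<longleftrightarrow> generates_evolution_family D G U"
  by (simp add: generates_evolution_family_def evolution_family_on_def assms cong: ball_cong)

theorem theorem4p4:
  fixes T :: "real \<Rightarrow> 'a::banach \<Rightarrow>\<^sub>L 'a"
    and D :: "'a set" and A :: "'a \<Rightarrow> 'a" and M \<omega>\<^sub>0 :: real
  assumes "C0_semigroup T"
    and "semigroup_generator T D A"
    and "\<And>t. t \<ge> 0 \<Longrightarrow> norm (T t) \<le> M * exp (\<omega>\<^sub>0 * t)"
    and "exponential_dichotomy (\<lambda>t s. T (t - s))"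
  shows "\<exists>\<epsilon>>0. \<forall>B :: real \<Rightarrow> 'a \<Rightarrow> 'a.
    (\<forall>t. linear_operator D (B t)) \<and>
    (\<forall>a b. a < b \<longrightarrow>
       GL_continuous_on D A M \<omega>\<^sub>0 {a..b} B \<and>
       (\<forall>\<mu>>\<omega>\<^sub>0. continuously_differentiable_on_interval a b (\<lambda>t. comp_resolvent D A (B t) \<mu>)) \<and>
       Limsup at_top (\<lambda>\<mu>. SUP t\<in>{a..b}. ereal (norm
         (vector_derivative (\<lambda>r. comp_resolvent D A (B r) \<mu>) (at t within {a..b})))) < \<infinity>) \<and>
    GL_uniformly_continuous_on D A M \<omega>\<^sub>0 UNIV B \<and>
    (SUP t. ereal (GL_norm D A M \<omega>\<^sub>0 (B t))) \<le> ereal \<epsilon>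
    \<longrightarrow> (\<exists>U. generates_evolution_family D (\<lambda>t x. A x + B t x) U \<and>
           (\<forall>V. generates_evolution_family D (\<lambda>t x. A x + B t x) V \<longrightarrow>
              (\<forall>s t. s \<le> t \<longrightarrow> V t s = U t s)) \<and>
           exponential_dichotomy U)"
proof -
  interpret generated_semigroup T M \<omega>\<^sub>0 D A by unfold_locales (use assms in auto)
  obtain h \<eta> where h: "h > 0" and \<eta>: "\<eta> > 0" and robust:
    "\<And>U K. propagator U \<Longrightarrow> (\<And>s t. s \<le> t \<Longrightarrow> t \<le> s + h \<Longrightarrow> norm (U t s) \<le> K) \<Longrightarrow>
      (\<And>s. norm (U (s + h) s - T (s + h - s)) \<le> \<eta>) \<Longrightarrow> exponential_dichotomy U"
    using exponential_dichotomy_robust[OF assms(4), of "\<lambda>t. M * exp (\<omega>\<^sub>0 * t)"] norm_T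
    by (metis diff_ge_0_iff_ge)
  let ?e = "exp ((\<omega>\<^sub>0 + 1) * h)"
  \<comment> \<open>The extensions will have norm at most M \<epsilon>. The first bound gives 2 M (M
    \<epsilon>) \<le> 1, the contraction condition for
    \<open>\<kappa> = \<omega>\<^sub>0 + 1\<close>; the second makes \<open>norm_U_minus_T\<close>
    at time h at most \<open>\<eta>\<close>. The summands 1 avoid division by zero when M =
    0.\<close>
  define \<epsilon> where "\<epsilon> = min (1 / (2 * M\<^sup>2 + 1)) (\<eta> / (2 * M ^ 3 * ?e + 1))"
  have M3: "0 \<le> 2 * M ^ 3 * ?e" using M_nonneg by simp
  have \<epsilon>: "\<epsilon> > 0" using \<eta> M3 by (simp add: \<epsilon>_def add_nonneg_pos)
  have \<epsilon>1: "2 * M * (M * \<epsilon>) \<le> 1"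
  proof -
    have "(2 * M\<^sup>2 + 1) * \<epsilon> \<le> (2 * M\<^sup>2 + 1) * (1 / (2 * M\<^sup>2 + 1))"
      by (intro mult_left_mono) (auto simp: \<epsilon>_def)
    also have "\<dots> = 1" using add_nonneg_pos[of "2 * M\<^sup>2" 1] by simp
    finally show ?thesis using \<epsilon> by (simp add: power2_eq_square algebra_simps)
  qed
  have \<epsilon>2: "M * (M * \<epsilon>) * (2 * M) * ?e \<le> \<eta>"
  proof -
    have "(2 * M ^ 3 * ?e + 1) * \<epsilon> \<le> (2 * M ^ 3 * ?e + 1) * (\<eta> / (2 * M ^ 3 * ?e + 1))"
      using M3 by (intro mult_left_mono) (auto simp: \<epsilon>_def)
    also have "\<dots> = \<eta>" using M3 by simp
    finally show ?thesis using \<epsilon> by (simp add: power3_eq_cube algebra_simps)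
  qed
  show ?thesis
  proof (intro exI[of _ \<epsilon>] conjI \<epsilon> allI impI, elim conjE)
    fix B :: "real \<Rightarrow> 'a \<Rightarrow> 'a"
    assume lin: "\<forall>t. linear_operator D (B t)"
      and loc: "\<forall>a b. a < b \<longrightarrow> GL_continuous_on D A M \<omega>\<^sub>0 {a..b} B \<and>
       (\<forall>\<mu>>\<omega>\<^sub>0. continuously_differentiable_on_interval a b (\<lambda>t. comp_resolvent D A (B t) \<mu>)) \<and>
       Limsup at_top (\<lambda>\<mu>. SUP t\<in>{a..b}. ereal (norm
         (vector_derivative (\<lambda>r. comp_resolvent D A (B r) \<mu>) (at t within {a..b})))) < \<infinity>"
      and unif: "GL_uniformly_continuous_on D A M \<omega>\<^sub>0 UNIV B"
      and small: "(SUP t. ereal (GL_norm D A M \<omega>\<^sub>0 (B t))) \<le> ereal \<epsilon>"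
    have GL: "B t \<in> GL_space D A \<omega>\<^sub>0" for t using unif by (simp add: GL_uniformly_continuous_on_def)
    have "ereal (GL_norm D A M \<omega>\<^sub>0 (B t)) \<le> ereal \<epsilon>" for t
      using small by (meson SUP_upper UNIV_I order_trans)
    then have GLn: "GL_norm D A M \<omega>\<^sub>0 (B t) \<le> \<epsilon>" for t by simp
    have bound: "norm (B t x) \<le> M * \<epsilon> * norm x" if "x \<in> D" for t x
      using GL_space_bound[OF GL that, of t] mult_left_mono[OF GLn[of t] M_nonneg]
      by (meson mult_right_mono norm_ge_zero order_trans)
    have "\<exists>E :: 'a \<Rightarrow>\<^sub>L 'a. norm E \<le> M * \<epsilon> \<and> (\<forall>x\<in>D. blinfun_apply E x = B t x)" for t
    proof (rule bounded_extension_dense[of D "B t" "M * \<epsilon>"])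
      show "closure D = UNIV" by (rule generator_domain_dense)
      show "norm (B t x) \<le> M * \<epsilon> * norm x" if "x \<in> D" for x using that by (rule bound)
    qed (use lin M_nonneg \<epsilon> in \<open>auto simp: linear_operator_def\<close>)
    then obtain E :: "real \<Rightarrow> 'a \<Rightarrow>\<^sub>L 'a" where E: "\<And>t. norm (E t) \<le> M * \<epsilon>" "\<And>t x. x \<in> D \<Longrightarrow> E t x = B t x"
      by metis
    define \<mu> where "\<mu> = \<omega>\<^sub>0 + 1"
    have \<mu>: "\<mu> > \<omega>\<^sub>0" by (simp add: \<mu>_def)
    \<comment> \<open>Rewrites the extension on \<open>D\<close> through the resolvent, so that
      differentiability of \<open>comp_resolvent\<close> in operator norm passes to each
      \<open>E t y\<close>.\<close>
    have cr: "E t y = comp_resolvent D A (B t) \<mu> (\<mu> *\<^sub>R y - A y)" if "y \<in> D" for t y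
      using GL[of t] \<mu> that
      by (simp add: E comp_resolvent_def GL_space_def bounded_linear_Blinfun_apply resolvent_inverse)
    have smooth: "\<exists>K :: real \<Rightarrow> 'a \<Rightarrow>\<^sub>L 'a. continuous_on {a..b} K \<and>
      (\<forall>t\<in>{a..b}. \<forall>y\<in>D. ((\<lambda>r. blinfun_apply (E r) y) has_vector_derivative
        blinfun_apply (K t) (\<mu> *\<^sub>R y - A y)) (at t within {a..b}))"
      if ab: "a < b" for a b
    proof -
      have "continuously_differentiable_on_interval a b (\<lambda>t. comp_resolvent D A (B t) \<mu>)"
        using loc ab \<mu> by blast
      then obtain K where K: "continuous_on {a..b} K" "\<And>t. t \<in> {a..b} \<Longrightarrow>
          ((\<lambda>t. comp_resolvent D A (B t) \<mu>) has_vector_derivative K t) (at t within {a..b})"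
        unfolding continuously_differentiable_on_interval_def by blast
      have "((\<lambda>r. E r y) has_vector_derivative K t (\<mu> *\<^sub>R y - A y)) (at t within {a..b})"
        if "t \<in> {a..b}" "y \<in> D" for t y
        unfolding cr[OF that(2)]
        by (rule bounded_linear.has_vector_derivative[OF blinfun.bounded_linear_left K(2)[OF that(1)]])
      with K(1) show ?thesis by blast
    qed
    \<comment> \<open>Differentiability gives continuity for vectors of \<open>D\<close>; the bound
      M \<epsilon>, uniform in t, and density carry it to all x as a uniform limit.\<close>
    have E_cont: "continuous_on UNIV (\<lambda>t. E t x)" for x
    proof -
      have contD: "isCont (\<lambda>t. E t y) t" if y: "y \<in> D" for t y
      proof -
        obtain K where "((\<lambda>r. E r y) has_vector_derivative K t (\<mu> *\<^sub>R y - A y)) (at t within {t - 1..t + 1})"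
          using smooth[of "t - 1" "t + 1"] y by fastforce
        then have "continuous (at t within {t - 1..t + 1}) (\<lambda>r. E r y)"
          by (rule has_vector_derivative_continuous)
        then show ?thesis by (simp add: at_within_Icc_at)
      qed
      obtain q where q: "\<And>n. q n \<in> D" "q \<longlonglongrightarrow> x"
        using generator_domain_dense closure_sequential[of x D] by auto
      have "uniform_limit UNIV (\<lambda>n t. E t (q n)) (\<lambda>t. E t x) sequentially"
      proof (rule uniform_limitI)
        fix e :: real assume "e > 0"
        have "(\<lambda>n. M * \<epsilon> * norm (q n - x)) \<longlonglongrightarrow> M * \<epsilon> * norm (x - x)"
          by (intro tendsto_intros q)
        then have "\<forall>\<^sub>F n in sequentially. M * \<epsilon> * norm (q n - x) < e"
          using \<open>e > 0\<close> by (intro order_tendstoD(2)) auto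
        then show "\<forall>\<^sub>F n in sequentially. \<forall>t\<in>UNIV. dist (E t (q n)) (E t x) < e"
        proof eventually_elim
          case (elim n)
          have "dist (E t (q n)) (E t x) \<le> M * \<epsilon> * norm (q n - x)" for t
            unfolding dist_norm blinfun.diff_right[symmetric]
            by (intro order_trans[OF norm_blinfun] mult_right_mono E) auto
          then show ?case using elim le_less_trans by blast
        qed
      qed
      then show ?thesis
        by (rule uniform_limit_theorem[rotated])
          (auto intro!: always_eventually continuous_at_imp_continuous_on contD q)
    qed
    interpret P: perturbed_generator T M \<omega>\<^sub>0 E "M * \<epsilon>" "\<omega>\<^sub>0 + 1" D A
    proof
      show "continuous_on UNIV (\<lambda>t. E t x)" for x by (rule E_cont)
      show "norm (E t) \<le> M * \<epsilon>" for t by (rule E(1))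
      show "2 * M * (M * \<epsilon>) \<le> \<omega>\<^sub>0 + 1 - \<omega>\<^sub>0" using \<epsilon>1 by simp
    qed simp
    have gen_iff: "generates_evolution_family D (\<lambda>t x. A x + B t x) V \<longleftrightarrow>
        generates_evolution_family D (\<lambda>t x. A x + E t x) V" for V
      by (rule generates_evolution_family_cong) (simp add: E)
    show "\<exists>U. generates_evolution_family D (\<lambda>t x. A x + B t x) U \<and>
           (\<forall>V. generates_evolution_family D (\<lambda>t x. A x + B t x) V \<longrightarrow>
              (\<forall>s t. s \<le> t \<longrightarrow> V t s = U t s)) \<and>
           exponential_dichotomy U"
    proof (intro exI[of _ P.U] conjI allI impI)
      show "generates_evolution_family D (\<lambda>t x. A x + B t x) P.U"
        by (rule gen_iff[THEN iffD2], unfold generates_evolution_family_def, intro allI impI P.U_evolution_family_on[where \<mu> = \<mu>] smooth)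
      show "V t s = P.U t s" if "generates_evolution_family D (\<lambda>t x. A x + B t x) V" "s \<le> t" for V s t
        by (rule P.evolution_family_unique[where \<mu> = \<mu>, OF smooth gen_iff[THEN iffD1, OF that(1)] that(2)])
      show "exponential_dichotomy P.U"
      proof (rule robust[OF P.propagator_U])
        show "norm (P.U t s) \<le> 2 * M * exp (\<bar>\<omega>\<^sub>0 + 1\<bar> * h)" if "s \<le> t" "t \<le> s + h" for s t
        proof -
          have "(\<omega>\<^sub>0 + 1) * (t - s) \<le> \<bar>\<omega>\<^sub>0 + 1\<bar> * h" using that by (intro mult_mono) auto
          then have "2 * M * exp ((\<omega>\<^sub>0 + 1) * (t - s)) \<le> 2 * M * exp (\<bar>\<omega>\<^sub>0 + 1\<bar> * h)"
            using M_nonneg by (intro mult_left_mono) auto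
          with P.norm_U[OF that(1)] show ?thesis by linarith
        qed
        show "norm (P.U (s + h) s - T (s + h - s)) \<le> \<eta>" for s
          using P.norm_U_minus_T[of h s] h \<epsilon>2 by simp
      qed
    qed
  qed
qed

end
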